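(* Let $N\in\mathbb{N}$ and $U(x)=\frac1\gamma e^{\gamma x}$ with $\gamma\neq0$. a) For $(x,\mu,z)\in E_X\times\mathbb{P}(E_Y)\times(0,1]$ it holds that $\mathbf{e}_0(x,\mu,\gamma z)=\frac1\gamma$ and, for $n=0,\ldots,N-1$, $$\mathbf{e}_{n+1}(x,\mu,\gamma z)=\inf_{a\in D(x)}\int_{E_X}\mathbf{e}_n\big(x',\Psi_e(x,a,x',\mu,\gamma z),\beta\gamma z\big)\,\hat{Q}^X(dx'|x,\mu,a,\gamma z),$$ where for $B_1\in\mathcal{B}(E_X)$, $B_2\in\mathcal{B}(E_Y)$ $$\hat{Q}^X(B_1|x,\mu,a,z):=\int_{B_1}\int_{E_Y}e^{zc(x,y,a)}q^X(x'|x,y,a)\,\mu(dy)\lambda(dx'),$$ $$\Psi_e(x,a,x',\mu,z)(B_2):=\frac{\int_{B_2}\int_{E_Y}e^{zc(x,y,a)}q(x',y'|x,y,a)\,\mu(dy)\nu(dy')}{\int_{E_Y}\int_{E_Y}e^{zc(x,y,a)}q(x',y'|x,y,a)\,\mu(dy)\nu(dy')}.$$ The value function is given by $J_N(x)=\mathbf{e}_N(x,Q_0,\gamma)$, $x\in E_X$. b) For every $n=1,\ldots,N$ there exists a minimizer $f_n^*$ of $\mathbf{e}_{n-1}$, and $(g_0^*,\ldots,g_{N-1}^* )$ with $$g_n^*(h_n):=f_{N-n}^*\big(x_n,\mu_n^e(\cdot|h_n),\gamma\beta^n\big),\qquad n=0,\ldots,N-1,$$ is an optimal policy for the problem $J_N(x)=\inf_{\pi\in\Pi}J_{N\pi}(x)$,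 where the sequence $(\mu_n^e)$ of posterior distributions is generated by the updating operator $\Psi_e$ with $\mu_0^e:=Q_0$, i.e. $\mu_{n+1}^e(\cdot|h_n,a,x')=\Psi_e(x_n,a,x',\mu_n^e(\cdot|h_n),\gamma\beta^n)$.
   Context: Notation: $\mathbb{R}_+=[0,\infty)$; $\mathbb{P}(E_Y)$ is the set of probability measures on $E_Y$ with the topology of weak convergence. Model. $E_X,E_Y,A$ are Borel spaces (Borel subsets of Polish spaces). $D\subset E_X\times A$ is Borel, $D(x):=\{a\in A:(x,a)\in D\}$, and $D$ contains the graph of a measurable map $E_X\to A$. $Q$ is a stochastic kernel from $D\times E_Y$ to $E_X\times E_Y$ having a measurable density $q$ with respect to $\sigma$-finite measures $\lambda$ on $E_X$ and $\nu$ on $E_Y$: $Q(B|x,y,a)=\int_Bq(x',y'|x,y,a)\,\lambda(dx')\nu(dy')$. Put $q^X(x'|x,y,a):=\int_{E_Y}q(x',y'|x,y,a)\,\nu(dy')$. $Q_0$ is a probability measure on $E_Y$ (distribution of $Y_0$), $c:D\times E_Y\to\mathbb{R}_+$ is a measurable one-stage cost, written $c(x,y,a)$, and $\beta\in(0,1]$. The component $x$ is observable, $y$ is hidden. Policies. $H_0:=E_X$, $H_n:=H_{n-1}\times A\times E_X$. A decision rule at stage $n$ is a measurable $g_n:H_n\to A$ with $g_n(h_n)\in D(x_n)$ for $h_n=(x_0,a_0,\ldots,x_n)$. A policy is a sequence $\pi=(g_0,g_1,\ldots)$ of such rules; $\Pi$ is the set of all policies (only the first $N$ rules matter for horizon $N$).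 For $\pi\in\Pi$, $\mathbb{E}^\pi_{xy}$ is expectation under the law of the process $(X_n,Y_n)$ with $X_0=x$, $Y_0=y$, actions $A_n:=g_n(X_0,A_0,\ldots,X_n)$ and transition kernel $Q$. Standing assumptions: $D(x)$ is compact for all $x$; $x\mapsto D(x)$ is upper semicontinuous (if $x_n\to x$ and $a_n\in D(x_n)$ then $(a_n)$ has an accumulation point in $D(x)$); $(x,y,a)\mapsto c(x,y,a)$ is continuous; $(x,y,x',y',a)\mapsto q(x',y'|x,y,a)$ is continuous and bounded; there are constants $0<\underline{c}<\overline{c}$ with $\underline{c}\le c\le\overline{c}$. Optimization problem. $J_{N\pi}(x):=\int_{E_Y}\mathbb{E}^\pi_{xy}\big[U\big(\sum_{k=0}^{N-1}\beta^kc(X_k,Y_k,A_k)\big)\big]Q_0(dy)$, $J_N(x):=\inf_{\pi\in\Pi}J_{N\pi}(x)$; a policy is optimal if it attains the infimum for every $x\in E_X$. The functions $\mathbf{e}_n$. For $(x,\mu,z)\in E_X\times\mathbb{P}(E_Y)\times(0,1]$ and $n\in\mathbb{N}_0$, $$\mathbf{e}_n(x,\mu,\gamma z):=\inf_{\pi\in\Pi}\frac1\gamma\int_{E_Y}\mathbb{E}^\pi_{xy}\Big[\exp\Big(\gamma z\sum_{k=0}^{n-1}\beta^kc(X_k,Y_k,A_k)\Big)\Big]\mu(dy).$$ A minimizer of $\mathbf{e}_{n-1}$ is a measurable map $f$ from $E_X\times\mathbb{P}(E_Y)\times\{\gamma z:z\in(0,1]\}$ to $A$ with $f(x,\mu,\gamma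 z)\in D(x)$ such that $a=f(x,\mu,\gamma z)$ attains the infimum in the recursion expressing $\mathbf{e}_n(x,\mu,\gamma z)$ through $\mathbf{e}_{n-1}$, for all $(x,\mu,z)$. $\Psi_e$ is defined only where its denominator is positive; the remaining $x'$ form a $\hat{Q}^X(\cdot|x,\mu,a,z)$-null set and may be ignored. *)

theory Defs
  imports "HOL-Probability.Probability"
begin

section \<open>Probability measures with the topology of weak convergence\<close>

text \<open>
  A Borel space is a Borel subset \<open>E\<close> of a Polish space, carried by a type of class
  \<open>polish_space\<close>, with the subspace topology and the trace of the Borel sigma-algebra.
\<close>

abbreviation borel_on :: "'a::topological_space set \<Rightarrow> 'a measure" where
  "borel_on E \<equiv> restrict_space borel E"

definition prob_measures :: "'a::topological_space set \<Rightarrow> 'a measure set" where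
  "prob_measures E = {\<mu>. prob_space \<mu> \<and> sets \<mu> = sets (borel_on E)}"

definition weak_topology :: "'a::topological_space set \<Rightarrow> 'a measure topology" where
  "weak_topology E = topology_generated_by
     {{\<mu> \<in> prob_measures E. (\<integral>y. f y \<partial>\<mu>) \<in> U} | (f :: 'a \<Rightarrow> real) U.
        continuous_on E f \<and> bounded (f ` E) \<and> open U}"

definition weak_borel :: "'a::topological_space set \<Rightarrow> 'a measure measure" where
  "weak_borel E = sigma (prob_measures E) {V. openin (weak_topology E) V}"


section \<open>The partially observable model\<close>

record ('x, 'y, 'a) pomdp =
  SX :: "'x set"
  SY :: "'y set"
  SA :: "'a set"
  adm :: "('x \<times> 'a) set"                                \<comment> \<open>the set \<open>D\<close>\<close>
  kern :: "'x \<times> 'y \<times> 'a \<Rightarrow> ('x \<times> 'y) measure"            \<comment> \<open>\<open>Q(\<cdot>|x,y,a)\<close>\<close>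
  lam :: "'x measure"
  nu :: "'y measure"
  dens :: "'x \<times> 'y \<Rightarrow> 'x \<times> 'y \<times> 'a \<Rightarrow> real"              \<comment> \<open>\<open>q(x',y'|x,y,a)\<close>\<close>
  init :: "'y measure"                                  \<comment> \<open>\<open>Q\<^sub>0\<close>\<close>
  cost :: "'x \<times> 'y \<times> 'a \<Rightarrow> real"
  disc :: real                                          \<comment> \<open>\<open>\<beta>\<close>\<close>

definition admX :: "('x, 'y, 'a) pomdp \<Rightarrow> 'x \<Rightarrow> 'a set" where
  "admX M x = {a. (x, a) \<in> adm M}"

definition DSY :: "('x, 'y, 'a) pomdp \<Rightarrow> ('x \<times> 'y \<times> 'a) set" where
  "DSY M = {(x, y, a). (x, a) \<in> adm M \<and> y \<in> SY M}"

definition pomdp_model ::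
    "('x::polish_space, 'y::polish_space, 'a::polish_space) pomdp \<Rightarrow> bool" where
  "pomdp_model M \<longleftrightarrow>
     SX M \<in> sets borel \<and> SY M \<in> sets borel \<and> SA M \<in> sets borel \<and>
     adm M \<subseteq> SX M \<times> SA M \<and> adm M \<in> sets borel \<and>
     (\<exists>d. d \<in> borel_on (SX M) \<rightarrow>\<^sub>M borel_on (SA M) \<and> (\<forall>x\<in>SX M. (x, d x) \<in> adm M)) \<and>
     sets (lam M) = sets (borel_on (SX M)) \<and> sigma_finite_measure (lam M) \<and>
     sets (nu M) = sets (borel_on (SY M)) \<and> sigma_finite_measure (nu M) \<and>
     kern M \<in> borel_on (DSY M) \<rightarrow>\<^sub>M prob_algebra (borel_on (SX M) \<Otimes>\<^sub>M borel_on (SY M)) \<and>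
     (\<lambda>(p, s). dens M p s) \<in> borel_measurable (borel_on ((SX M \<times> SY M) \<times> DSY M)) \<and>
     (\<forall>p \<in> SX M \<times> SY M. \<forall>s \<in> DSY M. 0 \<le> dens M p s) \<and>
     (\<forall>s \<in> DSY M. kern M s = density (lam M \<Otimes>\<^sub>M nu M) (\<lambda>p. ennreal (dens M p s))) \<and>
     init M \<in> prob_measures (SY M) \<and>
     cost M \<in> borel_measurable (borel_on (DSY M)) \<and> (\<forall>s \<in> DSY M. 0 \<le> cost M s) \<and>
     0 < disc M \<and> disc M \<le> 1"

definition standing_assumptions ::
    "('x::polish_space, 'y::polish_space, 'a::polish_space) pomdp \<Rightarrow> bool" where
  "standing_assumptions M \<longleftrightarrow>
     (\<forall>x \<in> SX M. compact (admX M x)) \<and>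
     (\<forall>xs x as. (\<forall>n. xs n \<in> SX M \<and> as n \<in> admX M (xs n)) \<and> x \<in> SX M \<and> xs \<longlonglongrightarrow> x \<longrightarrow>
        (\<exists>a \<in> admX M x. \<exists>r. strict_mono r \<and> (as \<circ> r) \<longlonglongrightarrow> a)) \<and>
     continuous_on (DSY M) (cost M) \<and>
     continuous_on ((SX M \<times> SY M) \<times> DSY M) (\<lambda>(p, s). dens M p s) \<and>
     bounded ((\<lambda>(p, s). dens M p s) ` ((SX M \<times> SY M) \<times> DSY M)) \<and>
     (\<exists>c_lo c_hi. 0 < c_lo \<and> c_lo < c_hi \<and> (\<forall>s \<in> DSY M. c_lo \<le> cost M s \<and> cost M s \<le> c_hi))"


section \<open>Policies and the controlled process\<close>

text \<open>
  A history \<open>h\<^sub>n = (x\<^sub>0, a\<^sub>0, \<dots>, a\<^sub>n\<^sub>-\<^sub>1, x\<^sub>n)\<close> is encoded as the pair of the tuples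
  \<open>(x\<^sub>0, \<dots>, x\<^sub>n)\<close> and \<open>(a\<^sub>0, \<dots>, a\<^sub>n\<^sub>-\<^sub>1)\<close>.  As for \<open>H\<^sub>n\<close>, the actions in it are not
  required to be admissible.
\<close>

definition hist ::
    "('x::topological_space, 'y, 'a::topological_space) pomdp \<Rightarrow> nat \<Rightarrow> ((nat \<Rightarrow> 'x) \<times> (nat \<Rightarrow> 'a)) measure" where
  "hist M n = PiM {..n} (\<lambda>_. borel_on (SX M)) \<Otimes>\<^sub>M PiM {..<n} (\<lambda>_. borel_on (SA M))"

type_synonym ('x, 'a) policy = "nat \<Rightarrow> (nat \<Rightarrow> 'x) \<times> (nat \<Rightarrow> 'a) \<Rightarrow> 'a"

definition policies ::
    "('x::topological_space, 'y, 'a::topological_space) pomdp \<Rightarrow> ('x, 'a) policy set" where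
  "policies M = {\<pi>. \<forall>n. \<pi> n \<in> hist M n \<rightarrow>\<^sub>M borel_on (SA M) \<and>
                        (\<forall>h \<in> space (hist M n). \<pi> n h \<in> admX M (fst h n))}"

text \<open>The action \<open>A\<^sub>n = g\<^sub>n(X\<^sub>0, A\<^sub>0, \<dots>, X\<^sub>n)\<close> along a trajectory of the observable component.\<close>

fun action :: "('x, 'a) policy \<Rightarrow> (nat \<Rightarrow> 'x) \<Rightarrow> nat \<Rightarrow> 'a" where
  "action \<pi> xs n =
     \<pi> n (restrict xs {..n}, (\<lambda>i. if i < n then action \<pi> xs i else undefined))"

declare action.simps [simp del]

definition step_kernel ::
    "('x::topological_space, 'y::topological_space, 'a) pomdp \<Rightarrow> ('x, 'a) policy \<Rightarrow> 'x \<Rightarrow> 'y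
     \<Rightarrow> nat \<Rightarrow> (nat \<Rightarrow> 'x \<times> 'y) \<Rightarrow> ('x \<times> 'y) measure" where
  "step_kernel M \<pi> x y n \<omega> = (case n of
       0 \<Rightarrow> return (borel_on (SX M) \<Otimes>\<^sub>M borel_on (SY M)) (x, y)
     | Suc k \<Rightarrow> kern M (fst (\<omega> k), snd (\<omega> k), action \<pi> (fst \<circ> \<omega>) k))"

text \<open>
  The law of \<open>(X\<^sub>n, Y\<^sub>n)\<^sub>n\<close> on the trajectory space, given by the Ionescu-Tulcea theorem.
\<close>

definition law ::
    "('x::topological_space, 'y::topological_space, 'a) pomdp \<Rightarrow> ('x, 'a) policy \<Rightarrow> 'x \<Rightarrow> 'y
     \<Rightarrow> (nat \<Rightarrow> 'x \<times> 'y) measure" where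
  "law M \<pi> x y =
     (let S = (\<lambda>_. borel_on (SX M) \<Otimes>\<^sub>M borel_on (SY M))
      in projective_family.lim UNIV (Ionescu_Tulcea.CI (step_kernel M \<pi> x y) S) S)"

definition total_cost ::
    "('x, 'y, 'a) pomdp \<Rightarrow> ('x, 'a) policy \<Rightarrow> nat \<Rightarrow> (nat \<Rightarrow> 'x \<times> 'y) \<Rightarrow> real" where
  "total_cost M \<pi> n \<omega> =
     (\<Sum>k<n. disc M ^ k * cost M (fst (\<omega> k), snd (\<omega> k), action \<pi> (fst \<circ> \<omega>) k))"


section \<open>The optimization problem\<close>

definition J_pol ::
    "('x::topological_space, 'y::topological_space, 'a) pomdp \<Rightarrow> (real \<Rightarrow> real) \<Rightarrow> nat
     \<Rightarrow> ('x, 'a) policy \<Rightarrow> 'x \<Rightarrow> real" where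
  "J_pol M U N \<pi> x = (\<integral>y. (\<integral>\<omega>. U (total_cost M \<pi> N \<omega>) \<partial>law M \<pi> x y) \<partial>init M)"

definition J_val ::
    "('x::topological_space, 'y::topological_space, 'a::topological_space) pomdp
     \<Rightarrow> (real \<Rightarrow> real) \<Rightarrow> nat \<Rightarrow> 'x \<Rightarrow> real" where
  "J_val M U N x = (INF \<pi> \<in> policies M. J_pol M U N \<pi> x)"

definition optimal_policy ::
    "('x::topological_space, 'y::topological_space, 'a::topological_space) pomdp
     \<Rightarrow> (real \<Rightarrow> real) \<Rightarrow> nat \<Rightarrow> ('x, 'a) policy \<Rightarrow> bool" where
  "optimal_policy M U N \<pi> \<longleftrightarrow>
     \<pi> \<in> policies M \<and> (\<forall>x \<in> SX M. J_pol M U N \<pi> x = J_val M U N x)"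


section \<open>Exponential utility\<close>

text \<open>
  \<open>e_val M \<gamma> n x \<mu> w\<close> is \<open>\<^bold>e\<^sub>n(x, \<mu>, w)\<close>; the last argument \<open>w\<close> stands for the product
  \<open>\<gamma> z\<close>, as in the operators below.
\<close>

definition e_val ::
    "('x::topological_space, 'y::topological_space, 'a::topological_space) pomdp
     \<Rightarrow> real \<Rightarrow> nat \<Rightarrow> 'x \<Rightarrow> 'y measure \<Rightarrow> real \<Rightarrow> real" where
  "e_val M \<gamma> n x \<mu> w =
     (INF \<pi> \<in> policies M.
        1 / \<gamma> * (\<integral>y. (\<integral>\<omega>. exp (w * total_cost M \<pi> n \<omega>) \<partial>law M \<pi> x y) \<partial>\<mu>))"

definition dens_X :: "('x, 'y, 'a) pomdp \<Rightarrow> 'x \<Rightarrow> 'x \<times> 'y \<times> 'a \<Rightarrow> ennreal" where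
  "dens_X M x' s = (\<integral>\<^sup>+y'. ennreal (dens M (x', y') s) \<partial>nu M)"

definition Qhat_X ::
    "('x, 'y, 'a) pomdp \<Rightarrow> 'x \<Rightarrow> 'y measure \<Rightarrow> 'a \<Rightarrow> real \<Rightarrow> 'x measure" where
  "Qhat_X M x \<mu> a z =
     density (lam M)
       (\<lambda>x'. \<integral>\<^sup>+y. ennreal (exp (z * cost M (x, y, a))) * dens_X M x' (x, y, a) \<partial>\<mu>)"

definition Psi_dens ::
    "('x, 'y, 'a) pomdp \<Rightarrow> 'x \<Rightarrow> 'a \<Rightarrow> 'x \<Rightarrow> 'y measure \<Rightarrow> real \<Rightarrow> 'y \<Rightarrow> ennreal" where
  "Psi_dens M x a x' \<mu> z y' =
     (\<integral>\<^sup>+y. ennreal (exp (z * cost M (x, y, a))) * ennreal (dens M (x', y') (x, y, a)) \<partial>\<mu>)"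

text \<open>
  The quotient defining \<open>\<Psi>\<^sub>e\<close> makes sense for admissible \<open>(x, a)\<close> and a denominator in
  \<open>(0, \<infinity>)\<close>; the other \<open>x'\<close> form a \<open>Qhat_X\<close>-null set.  In the remaining cases the prior
  \<open>\<mu>\<close> is kept, so that \<open>\<Psi>\<^sub>e\<close> always returns a probability measure and the posteriors are
  defined on all of \<open>H\<^sub>n\<close>.
\<close>

definition Psi_e ::
    "('x, 'y, 'a) pomdp \<Rightarrow> 'x \<Rightarrow> 'a \<Rightarrow> 'x \<Rightarrow> 'y measure \<Rightarrow> real \<Rightarrow> 'y measure" where
  "Psi_e M x a x' \<mu> z =
     (let m = (\<integral>\<^sup>+y'. Psi_dens M x a x' \<mu> z y' \<partial>nu M)
      in if (x, a) \<in> adm M \<and> 0 < m \<and> m < \<infinity>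
         then scale_measure (1 / m) (density (nu M) (Psi_dens M x a x' \<mu> z))
         else \<mu>)"

text \<open>The expression minimized over \<open>a \<in> D(x)\<close> in the recursion for \<open>\<^bold>e\<^sub>n\<^sub>+\<^sub>1(x, \<mu>, w)\<close>.\<close>

definition e_step ::
    "('x::topological_space, 'y::topological_space, 'a::topological_space) pomdp
     \<Rightarrow> real \<Rightarrow> nat \<Rightarrow> 'x \<Rightarrow> 'y measure \<Rightarrow> real \<Rightarrow> 'a \<Rightarrow> real" where
  "e_step M \<gamma> n x \<mu> w a =
     (\<integral>x'. e_val M \<gamma> n x' (Psi_e M x a x' \<mu> w) (disc M * w) \<partial>Qhat_X M x \<mu> a w)"

definition scaled_params :: "real \<Rightarrow> real set" where
  "scaled_params \<gamma> = {\<gamma> * z | z. 0 < z \<and> z \<le> 1}"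

definition minimizer ::
    "('x::topological_space, 'y::topological_space, 'a::topological_space) pomdp
     \<Rightarrow> real \<Rightarrow> nat \<Rightarrow> ('x \<times> 'y measure \<times> real \<Rightarrow> 'a) \<Rightarrow> bool" where
  "minimizer M \<gamma> n f \<longleftrightarrow>
     f \<in> borel_on (SX M) \<Otimes>\<^sub>M weak_borel (SY M) \<Otimes>\<^sub>M borel_on (scaled_params \<gamma>)
           \<rightarrow>\<^sub>M borel_on (SA M) \<and>
     (\<forall>x \<in> SX M. \<forall>\<mu> \<in> prob_measures (SY M). \<forall>w \<in> scaled_params \<gamma>.
        f (x, \<mu>, w) \<in> admX M x \<and>
        e_step M \<gamma> n x \<mu> w (f (x, \<mu>, w)) = (INF a \<in> admX M x. e_step M \<gamma> n x \<mu> w a))"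

text \<open>The posterior \<open>\<mu>\<^sub>n\<^sup>e(\<cdot>|h\<^sub>n)\<close>, where \<open>h = (xs, as)\<close>.\<close>

fun mu_e ::
    "('x, 'y, 'a) pomdp \<Rightarrow> real \<Rightarrow> nat \<Rightarrow> (nat \<Rightarrow> 'x) \<times> (nat \<Rightarrow> 'a) \<Rightarrow> 'y measure" where
  "mu_e M \<gamma> 0 h = init M"
| "mu_e M \<gamma> (Suc n) h =
     Psi_e M (fst h n) (snd h n) (fst h (Suc n)) (mu_e M \<gamma> n h) (\<gamma> * disc M ^ n)"

text \<open>
  The policy \<open>(g\<^sub>0\<^sup>*, \<dots>, g\<^sub>N\<^sub>-\<^sub>1\<^sup>*)\<close> built from minimizers \<open>f n\<close> of \<open>\<^bold>e\<^sub>n\<^sub>-\<^sub>1\<close>.  The rules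
  from stage \<open>N\<close> on are irrelevant for the horizon \<open>N\<close>; they are taken from a policy \<open>\<rho>\<close>.
\<close>

definition g_star ::
    "('x, 'y, 'a) pomdp \<Rightarrow> real \<Rightarrow> nat \<Rightarrow> (nat \<Rightarrow> 'x \<times> 'y measure \<times> real \<Rightarrow> 'a)
     \<Rightarrow> ('x, 'a) policy \<Rightarrow> ('x, 'a) policy" where
  "g_star M \<gamma> N f \<rho> n h =
     (if n < N then f (N - n) (fst h n, mu_e M \<gamma> n h, \<gamma> * disc M ^ n) else \<rho> n h)"

end

theory Submission
  imports Defs
begin

text \<open>
  For a fixed policy, Bayes' rule for the exponentially weighted law shows that the expected cost
  obeys a recursion along the posteriors generated by \<open>\<Psi>\<^sub>e\<close>. Hence the functions \<open>V\<^sub>n\<close> defined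
  by the claimed recursion are lower bounds for all policies, with equality for a policy that
  plays minimizers. Minimizers exist because the one-step operator preserves lower
  semicontinuity: \<open>q\<close> is a continuous density of a stochastic kernel, so by Scheffe's lemma the
  filter densities converge in \<open>L\<^sup>1\<close>, and the posteriors converge weakly almost everywhere along a
  subsequence. A measurable minimizer is then found by a selection theorem for compact-valued maps.
\<close>

section \<open>Weak convergence\<close>

text \<open>No metric on the space of measures is constructed. Instead \<open>wtest\<close> sends a
  measure to its integrals against countably many test functions, a point of a countable product of
  reals. Weakly open sets are preimages of open sets under \<open>wtest\<close>, so closedness and
  measurability can be decided by sequences; this is why lower semicontinuity is stated sequentially
  throughout.

  Three obstacles shape the estimates. The integrands vary with the index of the sequence as well as
  with the hidden state, so weak convergence is needed for continuously convergent integrands. The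
  constant \<open>\<gamma>\<close> may be negative and \<open>Qhat_X\<close> need not have mass 1;
  Fatou's lemma is applied after adding a constant, whose integral converges because the total mass
  does. The values are only lower semicontinuous, so the set of states at which some optimal action
  lies in a given closed set need not be closed; it is cut out through rational levels.

  The parameter \<open>w\<close> belongs to the state: after one stage the remaining cost is
  weighted by \<open>\<beta> * w\<close>.\<close>

definition dense_seq :: "nat \<Rightarrow> 'a::polish_space" where
  "dense_seq = from_nat_into (SOME D. countable D \<and> (\<forall>X. open X \<longrightarrow> X \<noteq> {} \<longrightarrow> (\<exists>d\<in>D. d \<in> X)))"

lemma dense_seq_dense:
  assumes "open X" "X \<noteq> {}"
  shows "\<exists>i. (dense_seq i :: 'a::polish_space) \<in> X"
proof -
  define D :: "'a set" where "D = (SOME D. countable D \<and> (\<forall>X. open X \<longrightarrow> X \<noteq> {} \<longrightarrow> (\<exists>d\<in>D. d \<in> X)))"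
  have D: "countable D \<and> (\<forall>X. open X \<longrightarrow> X \<noteq> {} \<longrightarrow> (\<exists>d\<in>D. d \<in> X))"
    unfolding D_def by (rule someI_ex) (metis countable_dense_exists)
  then obtain d where "d \<in> D" "d \<in> X" using assms by blast
  then show ?thesis
    using D from_nat_into_surj[of D d] unfolding dense_seq_def D_def[symmetric] by blast
qed

section \<open>A countable family of test functions\<close>

definition spike :: "nat \<times> rat \<times> rat \<Rightarrow> 'a::polish_space \<Rightarrow> real" where
  "spike p y = (case p of (i, q, r) \<Rightarrow> max 0 (real_of_rat q - \<bar>real_of_rat r\<bar> * dist y (dense_seq i)))"

text \<open>Finite maxima make the family of tents upward directed, as monotone convergence
  requires, while indexing by lists keeps it countable.\<close>

fun max_spikes :: "(nat \<times> rat \<times> rat) list \<Rightarrow> 'a::polish_space \<Rightarrow> real" where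
  "max_spikes [] y = 0"
| "max_spikes (p # ps) y = max (spike p y) (max_spikes ps y)"

lemma spike_nonneg: "0 \<le> spike p y"
  by (auto simp: spike_def split: prod.split)

lemma max_spikes_nonneg: "0 \<le> max_spikes ps y"
  by (induction ps) (auto simp: spike_nonneg le_max_iff_disj)

lemma continuous_on_spike: "continuous_on S (spike p)"
  by (cases p) (auto simp: spike_def intro!: continuous_intros)

lemma continuous_on_max_spikes: "continuous_on S (max_spikes ps)"
  by (induction ps) (auto intro!: continuous_intros continuous_on_spike)

lemma measurable_max_spikes[measurable]: "max_spikes ps \<in> borel_measurable borel"
  by (rule borel_measurable_continuous_onI) (rule continuous_on_max_spikes)

lemma max_spikes_append: "max_spikes (ps @ qs) y = max (max_spikes ps y) (max_spikes qs y)"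
  by (induction ps) (auto simp: max_spikes_nonneg max.assoc)

lemma spike_le_max_spikes: "p \<in> set ps \<Longrightarrow> spike p y \<le> max_spikes ps y"
  by (induction ps) (auto simp: le_max_iff_disj)

text \<open>The index type is countable, so \<open>wtest\<close> takes values in a metrizable,
  second countable product of real lines.\<close>

definition wtest :: "'a::polish_space measure \<Rightarrow> (nat \<times> rat \<times> rat) list \<Rightarrow> real" where
  "wtest \<mu> ps = (\<integral>y. max_spikes ps y \<partial>\<mu>)"

text \<open>Convergence is demanded for the countable family only; on \<open>prob_measures E\<close>
  this already gives convergence of all integrals of bounded continuous functions, see
  \<open>integral_wconv_continuous\<close>.\<close>

definition wconv :: "(nat \<Rightarrow> 'a::polish_space measure) \<Rightarrow> 'a measure \<Rightarrow> bool" where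
  "wconv \<mu>s \<mu> \<longleftrightarrow> (\<forall>ps. (\<lambda>n. wtest (\<mu>s n) ps) \<longlonglongrightarrow> wtest \<mu> ps)"

lemma wconv_subseq: "wconv \<mu>s \<mu> \<Longrightarrow> strict_mono r \<Longrightarrow> wconv (\<mu>s \<circ> r) \<mu>"
  unfolding wconv_def comp_def using LIMSEQ_subseq_LIMSEQ[unfolded comp_def] by blast

lemma spike_le: "spike p y \<le> max 0 (real_of_rat (fst (snd p)))"
proof (cases p)
  case (fields i q r)
  have "0 \<le> \<bar>real_of_rat r\<bar> * dist y (dense_seq i)" by simp
  then show ?thesis unfolding fields spike_def prod.case fst_conv snd_conv by linarith
qed

lemma max_spikes_bounded: "\<exists>B. \<forall>y::'a::polish_space. max_spikes ps y \<le> B"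
proof (induction ps)
  case (Cons p ps)
  then obtain B where "\<And>y::'a. max_spikes ps y \<le> B" by blast
  then have "max_spikes (p # ps) y \<le> max (max 0 (real_of_rat (fst (snd p)))) B" for y :: 'a
    using spike_le[of p y] max.coboundedI2[of "max_spikes ps y" B] by (auto intro: max.mono)
  then show ?case by blast
qed auto

lemma space_prob_measures:
  assumes "\<mu> \<in> prob_measures E" shows "space \<mu> = E"
  using assms sets_eq_imp_space_eq[of \<mu> "borel_on E"] by (auto simp: prob_measures_def space_restrict_space)

lemma sets_prob_measures: "\<mu> \<in> prob_measures E \<Longrightarrow> sets \<mu> = sets (borel_on E)"
  by (auto simp: prob_measures_def)

lemma prob_space_prob_measures: "\<mu> \<in> prob_measures E \<Longrightarrow> prob_space \<mu>"
  by (auto simp: prob_measures_def)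

lemma measurable_prob_measures:
  "\<mu> \<in> prob_measures E \<Longrightarrow> measurable \<mu> N = measurable (borel_on E) N"
  by (intro measurable_cong_sets sets_prob_measures refl)

lemma integrable_prob_measures_bounded:
  fixes f :: "'a::polish_space \<Rightarrow> real"
  assumes "\<mu> \<in> prob_measures E" "f \<in> borel_measurable (borel_on E)" "\<And>y. y \<in> E \<Longrightarrow> \<bar>f y\<bar> \<le> B"
  shows "integrable \<mu> f"
proof -
  interpret prob_space \<mu> by (rule prob_space_prob_measures[OF assms(1)])
  show ?thesis
    by (rule integrable_const_bound[where B=B])
       (use assms in \<open>auto simp: measurable_prob_measures space_prob_measures\<close>)
qed

lemma measurable_max_spikes_on[measurable]: "max_spikes ps \<in> borel_measurable (borel_on E)"
  by (intro measurable_restrict_space1) simp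

lemma nn_integral_max_spikes:
  assumes "\<mu> \<in> prob_measures E"
  shows "(\<integral>\<^sup>+y. ennreal (max_spikes ps y) \<partial>\<mu>) = ennreal (wtest \<mu> ps)"
proof -
  obtain B where B: "\<And>y::'a. max_spikes ps y \<le> B" using max_spikes_bounded[of ps] by blast
  have "integrable \<mu> (max_spikes ps)"
    by (rule integrable_prob_measures_bounded[OF assms, where B=B])
       (use B in \<open>auto simp: max_spikes_nonneg\<close>)
  then show ?thesis
    unfolding wtest_def by (intro nn_integral_eq_integral) (auto simp: max_spikes_nonneg)
qed

lemma exists_spike:
  fixes y0 :: "'a::polish_space" and t u \<delta> :: real
  assumes "0 \<le> t" "t < u" "0 < \<delta>"
  shows "\<exists>p. t < spike p y0 \<and> (\<forall>y. spike p y \<le> u) \<and> (\<forall>y. \<delta> \<le> dist y y0 \<longrightarrow> spike p y = 0)"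
proof -
  obtain q where q: "t < real_of_rat q" "real_of_rat q < u"
    using of_rat_dense[OF assms(2)] by blast
  define Q where "Q = real_of_rat q"
  have Q: "t < Q" "Q < u" "0 < Q" using q assms unfolding Q_def by linarith+
  obtain r where r: "2 * Q / \<delta> < real_of_rat r"
    using of_rat_dense[of "2 * Q / \<delta>" "2 * Q / \<delta> + 1"] by auto
  define R where "R = real_of_rat r"
  have "0 < 2 * Q / \<delta>" using Q assms by simp
  then have R: "0 < R" "2 * Q < R * \<delta>" using r assms unfolding R_def by (linarith, simp add: field_simps)
  \<comment> \<open>The centre can only be a dense point near \<open>y0\<close>. A tent of height
    \<open>Q\<close> and slope \<open>R > 2 * Q / \<delta>\<close> vanishes beyond distance
    \<open>\<delta> / 2\<close> of its centre, so a centre within \<open>\<delta> / 2\<close> of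
    \<open>y0\<close> makes it vanish at distance \<open>\<delta>\<close> from \<open>y0\<close>;
    the bound \<open>(Q - t) / R\<close> keeps the value at \<open>y0\<close> above
    \<open>t\<close>.\<close>
  define \<epsilon> where "\<epsilon> = min (\<delta> / 2) ((Q - t) / R)"
  have "0 < \<epsilon>" using Q R assms by (auto simp: \<epsilon>_def)
  then obtain i where i: "dense_seq i \<in> ball y0 \<epsilon>"
    using dense_seq_dense[of "ball y0 \<epsilon>"] by auto
  then have d: "dist y0 (dense_seq i) < \<delta> / 2" "dist y0 (dense_seq i) < (Q - t) / R"
    by (auto simp: \<epsilon>_def)
  have "R * dist y0 (dense_seq i) < Q - t" using d(2) R by (simp add: field_simps)
  have absR: "\<bar>real_of_rat r\<bar> = R" using R(1) unfolding R_def by (rule abs_of_pos)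
  have val: "spike (i, q, r) y = max 0 (Q - R * dist y (dense_seq i))" for y :: 'a
    unfolding spike_def prod.case absR Q_def[symmetric] ..
  have 1: "t < spike (i, q, r) y0"
    using \<open>R * dist y0 (dense_seq i) < Q - t\<close> unfolding val by linarith
  have 2: "spike (i, q, r) y \<le> u" for y
    using spike_le[of "(i,q,r)" y] Q by (simp add: Q_def)
  have 3: "spike (i, q, r) y = 0" if "\<delta> \<le> dist y y0" for y
  proof -
    have "dist y y0 \<le> dist y (dense_seq i) + dist y0 (dense_seq i)" by (rule dist_triangle2)
    then have "\<delta> / 2 \<le> dist y (dense_seq i)" using that d(1) by simp
    then have "R * \<delta> \<le> R * (2 * dist y (dense_seq i))" using R by (intro mult_left_mono) auto
    also have "\<dots> = 2 * (R * dist y (dense_seq i))" by simp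
    finally have "Q \<le> R * dist y (dense_seq i)" using R(2) by linarith
    then show ?thesis unfolding val by simp
  qed
  show ?thesis using 1 2 3 by blast
qed

abbreviation joint_at :: "'a::topological_space \<Rightarrow> 'a set \<Rightarrow> (nat \<times> 'a) filter" where
  "joint_at y E \<equiv> sequentially \<times>\<^sub>F inf (nhds y) (principal E)"

lemma tendsto_joint_atD:
  assumes "((\<lambda>(n, z). g n z) \<longlongrightarrow> h y) (joint_at y E)" "y \<in> E"
  shows "(\<lambda>n. g n y) \<longlonglongrightarrow> h y"
proof -
  have "filterlim (\<lambda>n. (n, y)) (joint_at y E) sequentially"
    by (intro filterlim_Pair filterlim_ident filterlim_inf[THEN iffD2] conjI tendsto_const)
       (simp add: filterlim_principal assms(2))
  from filterlim_compose[OF assms(1) this] show ?thesis by simp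
qed

text \<open>Fatou's lemma for a weakly convergent sequence of measures and a continuously convergent
  sequence of integrands: the limit integrand is a supremum of maxima of spikes, each of
  which lies below all but finitely many members of the sequence.\<close>

lemma nn_integral_wconv_liminf:
  fixes \<mu>s :: "nat \<Rightarrow> 'a::polish_space measure"
  assumes \<mu>s: "\<And>n. \<mu>s n \<in> prob_measures E" and \<mu>: "\<mu> \<in> prob_measures E" and conv: "wconv \<mu>s \<mu>"
    and g: "\<And>n. g n \<in> borel_measurable (borel_on E)" and nonneg: "\<And>n y. y \<in> E \<Longrightarrow> 0 \<le> g n y"
    and lim: "\<And>y. y \<in> E \<Longrightarrow> ((\<lambda>(n, z). g n z) \<longlongrightarrow> h y) (joint_at y E)"
  shows "(\<integral>\<^sup>+y. ennreal (h y) \<partial>\<mu>) \<le> liminf (\<lambda>n. \<integral>\<^sup>+y. ennreal (g n y) \<partial>\<mu>s n)"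
proof -
  define S where "S = {p. \<exists>m. \<forall>n\<ge>m. \<forall>y::'a\<in>E. spike p y \<le> g n y}"
  \<comment> \<open>The zero tent keeps \<open>S\<close> nonempty, so that
    \<open>from_nat_into S\<close> enumerates it.\<close>
  have S0: "(0,0,0) \<in> S"
    by (auto simp: S_def spike_def nonneg intro!: exI[of _ 0])
  define f :: "nat \<Rightarrow> 'a \<Rightarrow> real" where "f j = max_spikes (map (from_nat_into S) [0..<j])" for j
  have S_in: "from_nat_into S i \<in> S" for i
    using S0 from_nat_into[of S i] by blast
  have ev: "\<exists>m. \<forall>n\<ge>m. \<forall>y\<in>E. f j y \<le> g n y" for j
  proof (induction j)
    case 0
    then show ?case by (auto simp: f_def nonneg)
  next
    case (Suc j)
    then obtain m where m: "\<forall>n\<ge>m. \<forall>y\<in>E. f j y \<le> g n y" by blast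
    obtain k where k: "\<forall>n\<ge>k. \<forall>y\<in>E. spike (from_nat_into S j) y \<le> g n y"
      using S_in[of j] unfolding S_def mem_Collect_eq by blast
    show ?case
      by (rule exI[of _ "max m k"])
         (use m k nonneg in \<open>auto simp: f_def max_spikes_append\<close>)
  qed
  have pw: "(\<lambda>n. g n y) \<longlonglongrightarrow> h y" if "y \<in> E" for y
    by (rule tendsto_joint_atD[where E=E]) (use lim that in auto)
  have le: "f j y \<le> h y" if "y \<in> E" for j y
    using ev[of j] that by (intro LIMSEQ_le_const[OF pw[OF that]]) blast
  have fm: "incseq (\<lambda>j. f j y)" for y
    by (rule incseq_SucI) (simp add: f_def max_spikes_append)
  \<comment> \<open>Continuous convergence enters here: for all large \<open>n\<close> the bound
    \<open>u < g n z\<close> holds on the whole part of a ball around \<open>y0\<close> that lies in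
    \<open>E\<close>, which leaves room for a tent of height at most \<open>u\<close>.\<close>
  have *: "\<exists>j. t < f j y0" if "y0 \<in> E" "0 \<le> t" "t < h y0" for t y0
  proof -
    obtain u where u: "t < u" "u < h y0" using dense[OF \<open>t < h y0\<close>] by blast
    have "\<forall>\<^sub>F (n, z) in joint_at y0 E. u < g n z"
      using order_tendstoD(1)[OF lim[OF that(1)] u(2)] by (simp add: case_prod_beta')
    then obtain P1 P2 where P: "eventually P1 sequentially" "eventually P2 (inf (nhds y0) (principal E))"
       "\<And>n z. P1 n \<Longrightarrow> P2 z \<Longrightarrow> u < g n z"
      unfolding eventually_prod_filter by auto
    obtain m where m: "\<And>n. n \<ge> m \<Longrightarrow> P1 n" using P(1) by (auto simp: eventually_sequentially)
    obtain \<delta> where \<delta>: "0 < \<delta>" "\<And>z. dist z y0 < \<delta> \<Longrightarrow> z \<in> E \<Longrightarrow> P2 z"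
      using P(2) by (auto simp: eventually_inf_principal eventually_nhds_metric)
    obtain p where p: "t < spike p y0" "\<And>y::'a. spike p y \<le> u" "\<And>y. \<delta> \<le> dist y y0 \<Longrightarrow> spike p y = 0"
      using exists_spike[OF \<open>0 \<le> t\<close> u(1) \<delta>(1), of y0] by blast
    have "spike p y \<le> g n y" if "n \<ge> m" "y \<in> E" for n y
    proof (cases "dist y y0 < \<delta>")
      case True
      then show ?thesis using P(3)[OF m[OF that(1)] \<delta>(2)[OF True that(2)]] p(2)[of y] by simp
    next
      case False
      then show ?thesis using p(3)[of y] nonneg[OF that(2)] by simp
    qed
    then have "p \<in> S" by (auto simp: S_def)
    then obtain i where i: "from_nat_into S i = p"
      using from_nat_into_surj[of S p] by auto
    have "spike p y0 \<le> f (Suc i) y0"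
      unfolding f_def by (rule spike_le_max_spikes) (use i in auto)
    then show ?thesis using p(1) by (intro exI[of _ "Suc i"]) simp
  qed
  have nonneg_h: "0 \<le> h y" if "y \<in> E" for y
    using le[OF that, of 0] by (simp add: f_def)
  have sup: "ennreal (h y) = (SUP j. ennreal (f j y))" if y: "y \<in> E" for y
  proof (rule antisym)
    show "(SUP j. ennreal (f j y)) \<le> ennreal (h y)"
      by (rule SUP_least) (auto intro!: ennreal_leI le y)
    show "ennreal (h y) \<le> (SUP j. ennreal (f j y))"
    proof (rule dense_le)
      fix t assume t: "t < ennreal (h y)"
      then obtain t' where t': "t = ennreal t'" "0 \<le> t'" by (cases t) auto
      then have "t' < h y" using t by (simp add: ennreal_less_iff)
      then obtain j where "t' < f j y" using *[OF y t'(2)] by blast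
      then show "t \<le> (SUP j. ennreal (f j y))"
        unfolding t' by (intro SUP_upper2[of j]) (auto intro!: ennreal_leI)
    qed
  qed
  have "(\<integral>\<^sup>+y. ennreal (h y) \<partial>\<mu>) = (\<integral>\<^sup>+y. (SUP j. ennreal (f j y)) \<partial>\<mu>)"
    by (rule nn_integral_cong) (simp add: space_prob_measures[OF \<mu>] sup)
  also have "\<dots> = (SUP j. \<integral>\<^sup>+y. ennreal (f j y) \<partial>\<mu>)"
    by (rule nn_integral_monotone_convergence_SUP)
       (use fm in \<open>auto simp: measurable_prob_measures[OF \<mu>] f_def incseq_def le_fun_def intro!: ennreal_leI\<close>)
  also have "\<dots> \<le> liminf (\<lambda>n. \<integral>\<^sup>+y. ennreal (g n y) \<partial>\<mu>s n)"
  proof (rule SUP_least)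
    fix j
    have "(\<lambda>n. \<integral>\<^sup>+y. ennreal (f j y) \<partial>\<mu>s n) \<longlonglongrightarrow> (\<integral>\<^sup>+y. ennreal (f j y) \<partial>\<mu>)"
      using conv unfolding f_def nn_integral_max_spikes[OF \<mu>] nn_integral_max_spikes[OF \<mu>s] wconv_def
      by (intro tendsto_ennrealI) blast
    then have "(\<integral>\<^sup>+y. ennreal (f j y) \<partial>\<mu>) = liminf (\<lambda>n. \<integral>\<^sup>+y. ennreal (f j y) \<partial>\<mu>s n)"
      by (simp add: lim_imp_Liminf)
    also have "\<dots> \<le> liminf (\<lambda>n. \<integral>\<^sup>+y. ennreal (g n y) \<partial>\<mu>s n)"
    proof (rule Liminf_mono)
      obtain m where "\<forall>n\<ge>m. \<forall>y\<in>E. f j y \<le> g n y" using ev by blast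
      then show "\<forall>\<^sub>F n in sequentially. (\<integral>\<^sup>+y. ennreal (f j y) \<partial>\<mu>s n) \<le> (\<integral>\<^sup>+y. ennreal (g n y) \<partial>\<mu>s n)"
        unfolding eventually_sequentially
        by (intro exI[of _ m] allI impI nn_integral_mono ennreal_leI)
           (auto simp: space_prob_measures[OF \<mu>s])
    qed
    finally show "(\<integral>\<^sup>+y. ennreal (f j y) \<partial>\<mu>) \<le> liminf (\<lambda>n. \<integral>\<^sup>+y. ennreal (g n y) \<partial>\<mu>s n)" .
  qed
  finally show ?thesis .
qed

text \<open>Two-sided version of the Fatou bound: it is applied to \<open>g n + B\<close> and to
  \<open>- g n + B\<close>, both nonnegative, and gives the lower and the upper estimate of the
  integrals.\<close>

lemma integral_wconv:
  fixes \<mu>s :: "nat \<Rightarrow> 'a::polish_space measure" and g :: "nat \<Rightarrow> 'a \<Rightarrow> real"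
  assumes \<mu>s: "\<And>n. \<mu>s n \<in> prob_measures E" and \<mu>: "\<mu> \<in> prob_measures E" and conv: "wconv \<mu>s \<mu>"
    and g: "\<And>n. g n \<in> borel_measurable (borel_on E)" and bound: "\<And>n y. y \<in> E \<Longrightarrow> \<bar>g n y\<bar> \<le> B"
    and lim: "\<And>y. y \<in> E \<Longrightarrow> ((\<lambda>(n, z). g n z) \<longlongrightarrow> h y) (joint_at y E)"
  shows "(\<lambda>n. \<integral>y. g n y \<partial>\<mu>s n) \<longlonglongrightarrow> (\<integral>y. h y \<partial>\<mu>)"
proof -
  have pw: "(\<lambda>n. g n y) \<longlonglongrightarrow> h y" if "y \<in> E" for y
    by (rule tendsto_joint_atD[where E=E]) (use lim that in auto)
  have bound_h: "\<bar>h y\<bar> \<le> B" if "y \<in> E" for y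
    using bound[OF that] by (intro LIMSEQ_le_const2[OF tendsto_rabs[OF pw[OF that]]]) auto
  have h: "h \<in> borel_measurable (borel_on E)"
    by (rule borel_measurable_LIMSEQ_real[where u=g]) (auto simp: space_restrict_space pw g)
  have main: "\<forall>\<^sub>F n in sequentially. t < (\<integral>y. g' n y \<partial>\<mu>s n)"
    if g': "\<And>n. g' n \<in> borel_measurable (borel_on E)" "\<And>n y. y \<in> E \<Longrightarrow> \<bar>g' n y\<bar> \<le> B"
      and h': "h' \<in> borel_measurable (borel_on E)" "\<And>y. y \<in> E \<Longrightarrow> \<bar>h' y\<bar> \<le> B"
      and lim': "\<And>y. y \<in> E \<Longrightarrow> ((\<lambda>(n, z). g' n z) \<longlongrightarrow> h' y) (joint_at y E)"
      and t: "t < (\<integral>y. h' y \<partial>\<mu>)" for g' h' t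
  proof -
    have eq: "(\<integral>\<^sup>+y. ennreal (f y + B) \<partial>\<rho>) = ennreal ((\<integral>y. f y \<partial>\<rho>) + B)" 
      and ge: "0 \<le> (\<integral>y. f y \<partial>\<rho>) + B"
      if \<rho>: "\<rho> \<in> prob_measures E" and f: "f \<in> borel_measurable (borel_on E)" "\<And>y. y \<in> E \<Longrightarrow> \<bar>f y\<bar> \<le> B"
      for f \<rho>
    proof -
      interpret prob_space \<rho> by (rule prob_space_prob_measures[OF \<rho>])
      have i: "integrable \<rho> f" by (rule integrable_prob_measures_bounded[OF \<rho> f])
      have nn: "0 \<le> f y + B" if "y \<in> space \<rho>" for y
        using f(2)[of y] that space_prob_measures[OF \<rho>] by auto
      have I: "(\<integral>y. f y + B \<partial>\<rho>) = (\<integral>y. f y \<partial>\<rho>) + B"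
        using i by (simp add: prob_space)
      show "0 \<le> (\<integral>y. f y \<partial>\<rho>) + B" unfolding I[symmetric] by (rule integral_nonneg_AE) (simp add: nn)
      show "(\<integral>\<^sup>+y. ennreal (f y + B) \<partial>\<rho>) = ennreal ((\<integral>y. f y \<partial>\<rho>) + B)"
        unfolding I[symmetric] using i nn by (intro nn_integral_eq_integral) auto
    qed
    have "(\<integral>\<^sup>+y. ennreal (h' y + B) \<partial>\<mu>) \<le> liminf (\<lambda>n. \<integral>\<^sup>+y. ennreal (g' n y + B) \<partial>\<mu>s n)"
    proof (rule nn_integral_wconv_liminf[OF \<mu>s \<mu> conv])
      show "0 \<le> g' n y + B" if "y \<in> E" for n y using g'(2)[OF that, of n] by auto
      show "((\<lambda>(n, z). g' n z + B) \<longlongrightarrow> h' y + B) (joint_at y E)" if "y \<in> E" for y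
        using tendsto_add[OF lim'[OF that] tendsto_const[of B]] by (simp add: case_prod_beta')
    qed (use g' in auto)
    then have *: "ennreal ((\<integral>y. h' y \<partial>\<mu>) + B) \<le> liminf (\<lambda>n. ennreal ((\<integral>y. g' n y \<partial>\<mu>s n) + B))"
      by (simp add: eq[OF \<mu> h'] eq[OF \<mu>s g'])
    show ?thesis
    \<comment> \<open>The embedding \<open>ennreal\<close> truncates negative numbers to 0. A level
      \<open>t\<close> below \<open>- B\<close> needs no limit argument, because the integrals are
      at least \<open>- B\<close>.\<close>
    proof (cases "0 \<le> t + B")
      case True
      then have "ennreal (t + B) < liminf (\<lambda>n. ennreal ((\<integral>y. g' n y \<partial>\<mu>s n) + B))"
        using t by (intro less_le_trans[OF _ *]) (simp add: ennreal_less_iff)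
      from less_LiminfD[OF this] show ?thesis
        by eventually_elim (use True in \<open>simp add: ennreal_less_iff\<close>)
    next
      case False
      have "t < (\<integral>y. g' n y \<partial>\<mu>s n)" for n using ge[OF \<mu>s g'(1) g'(2), of n n] False by simp
      then show ?thesis by simp
    qed
  qed
  show ?thesis
  proof (rule order_tendstoI)
    show "\<forall>\<^sub>F n in sequentially. t < (\<integral>y. g n y \<partial>\<mu>s n)" if "t < (\<integral>y. h y \<partial>\<mu>)" for t
      using main[OF g bound h bound_h lim that] .
    show "\<forall>\<^sub>F n in sequentially. (\<integral>y. g n y \<partial>\<mu>s n) < t" if "(\<integral>y. h y \<partial>\<mu>) < t" for t
    proof -
      have "\<forall>\<^sub>F n in sequentially. - t < (\<integral>y. - g n y \<partial>\<mu>s n)"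
      proof (rule main[where h'="\<lambda>y. - h y"])
        show "((\<lambda>(n, z). - g n z) \<longlongrightarrow> - h y) (joint_at y E)" if "y \<in> E" for y
          using tendsto_minus[OF lim[OF that]] by (simp add: case_prod_beta')
      qed (use g h bound bound_h that in auto)
      then show ?thesis by simp
    qed
  qed
qed

lemma tendsto_fun_component: "X \<longlonglongrightarrow> (x :: 'b \<Rightarrow> 'c::topological_space) \<Longrightarrow> (\<lambda>n. X n i) \<longlonglongrightarrow> x i"
  by (rule continuous_on_tendsto_compose[OF continuous_on_product_coordinates]) auto

lemma measurable_continuous_bounded:
  "continuous_on E f \<Longrightarrow> f \<in> borel_measurable (borel_on E)"
  by (rule borel_measurable_continuous_on_restrict)

text \<open>The tents determine weak convergence: a fixed function that is continuous on
  \<open>E\<close> converges along \<open>joint_at\<close>, so the preceding result applies to the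
  constant sequence of integrands.\<close>

lemma integral_wconv_continuous:
  fixes \<mu>s :: "nat \<Rightarrow> 'a::polish_space measure" and f :: "'a \<Rightarrow> real"
  assumes "\<And>n. \<mu>s n \<in> prob_measures E" "\<mu> \<in> prob_measures E" "wconv \<mu>s \<mu>"
    and f: "continuous_on E f" "bounded (f ` E)"
  shows "(\<lambda>n. \<integral>y. f y \<partial>\<mu>s n) \<longlonglongrightarrow> (\<integral>y. f y \<partial>\<mu>)"
proof -
  obtain B where B: "\<And>y. y \<in> E \<Longrightarrow> \<bar>f y\<bar> \<le> B"
    using f(2) by (auto simp: bounded_iff)
  show ?thesis
  proof (rule integral_wconv[OF assms(1-3)])
    show "((\<lambda>(n::nat, z). f z) \<longlongrightarrow> f y) (joint_at y E)" if "y \<in> E" for y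
    proof -
      have "filterlim snd (inf (nhds y) (principal E)) (joint_at y E)"
        by (rule filterlim_snd)
      then have "(snd \<longlongrightarrow> y) (joint_at y E)"
        and "\<forall>\<^sub>F p in joint_at y E. snd p \<in> E"
        unfolding filterlim_inf filterlim_principal by auto
      from continuous_on_tendsto_compose[OF f(1) this(1) that this(2)]
      show ?thesis by (simp add: case_prod_beta')
    qed
  qed (use f B in \<open>auto intro: measurable_continuous_bounded\<close>)
qed

section \<open>The weak topology seen through countably many integrals\<close>

lemma generate_topology_on_pullback:
  fixes f :: "'a \<Rightarrow> 'b::topological_space"
  assumes "generate_topology_on S V" and "\<And>s. s \<in> S \<Longrightarrow> \<exists>W. open W \<and> s = {x \<in> A. f x \<in> W}"
  shows "\<exists>W. open W \<and> V = {x \<in> A. f x \<in> W}"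
  using assms(1)
proof (induction rule: generate_topology_on.induct)
  case Empty
  then show ?case by (intro exI[of _ "{}"]) auto
next
  case (Int a b)
  then obtain X Y where "open X" "open Y" "a = {x \<in> A. f x \<in> X}"
    "b = {x \<in> A. f x \<in> Y}" by blast
  then have "open (X \<inter> Y)" "a \<inter> b = {x \<in> A. f x \<in> X \<inter> Y}" by blast+
  then show ?case by (intro exI[of _ "X \<inter> Y"] conjI)
next
  case (UN K)
  define W where "W k = (SOME W. open W \<and> k = {x \<in> A. f x \<in> W})" for k
  have W: "open (W k) \<and> k = {x \<in> A. f x \<in> W k}" if "k \<in> K" for k
    unfolding W_def by (rule someI_ex) (rule UN.IH[OF that])
  have "x \<in> k \<longleftrightarrow> x \<in> {x \<in> A. f x \<in> W k}" if "k \<in> K" for k x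
    by (rule arg_cong[where f="\<lambda>k. x \<in> k"]) (rule conjunct2[OF W[OF that]])
  then have "\<Union>K = {x \<in> A. f x \<in> (\<Union>k\<in>K. W k)}"
    by auto
  moreover have "open (\<Union>k\<in>K. W k)" by (intro open_UN ballI) (rule conjunct1[OF W])
  ultimately show ?case by (intro exI[of _ "\<Union>k\<in>K. W k"] conjI)
next
  case (Basis s)
  then show ?case by (rule assms(2))
qed

text \<open>The witness is the complement of the closure of the image of \<open>C\<close> under
  \<open>wtest\<close>. A point of that closure is the limit of a sequence, and if it is the image
  of a probability measure, the sequence is a \<open>wconv\<close>-convergent one. The integrals of
  \<open>f\<close> then converge inside the closed set \<open>- U\<close>, so their limit cannot lie
  in \<open>U\<close>.\<close>

lemma weak_topology_subbasis_pullback: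
  fixes f :: "'a::polish_space \<Rightarrow> real"
  assumes f: "continuous_on E f" "bounded (f ` E)" and U: "open U"
  shows "\<exists>W. open W \<and> {\<mu> \<in> prob_measures E. (\<integral>y. f y \<partial>\<mu>) \<in> U} = {\<mu> \<in> prob_measures E. wtest \<mu> \<in> W}"
proof -
  define s where s: "s = {\<mu> \<in> prob_measures E. (\<integral>y. f y \<partial>\<mu>) \<in> U}"
  define C where "C = {\<mu> \<in> prob_measures E. (\<integral>y. f y \<partial>\<mu>) \<notin> U}"
  have "\<mu> \<notin> s" if \<mu>: "\<mu> \<in> prob_measures E" and "wtest \<mu> \<in> closure (wtest ` C)" for \<mu>
  proof -
    obtain X where X: "\<And>n. X n \<in> wtest ` C" "X \<longlonglongrightarrow> wtest \<mu>"
      using \<open>wtest \<mu> \<in> closure (wtest ` C)\<close> unfolding closure_sequential by blast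
    define \<mu>s where "\<mu>s n = inv_into C wtest (X n)" for n
    have \<mu>s: "\<mu>s n \<in> C" "X n = wtest (\<mu>s n)" for n
      unfolding \<mu>s_def using X(1)[of n] by (rule inv_into_into, simp add: f_inv_into_f X(1))
    have "wconv \<mu>s \<mu>"
      unfolding wconv_def using tendsto_fun_component[OF X(2)] \<mu>s(2) by simp
    then have lim: "(\<lambda>n. \<integral>y. f y \<partial>\<mu>s n) \<longlonglongrightarrow> (\<integral>y. f y \<partial>\<mu>)"
      using \<mu>s(1) \<mu> f by (intro integral_wconv_continuous) (auto simp: C_def)
    have in_C: "(\<integral>y. f y \<partial>\<mu>s n) \<in> - U" for n using \<mu>s(1)[of n] by (simp add: C_def)
    have "(\<integral>y. f y \<partial>\<mu>) \<in> - U"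
      by (rule closed_sequentially[OF closed_Compl[OF U] in_C lim])
    then show ?thesis by (simp add: s)
  qed
  moreover have "\<mu> \<in> s" if "\<mu> \<in> prob_measures E" "wtest \<mu> \<notin> closure (wtest ` C)" for \<mu>
  proof (rule ccontr)
    assume "\<mu> \<notin> s"
    then have "\<mu> \<in> C" using that by (simp add: C_def s)
    then show False using that(2) closure_subset[of "wtest ` C"] by blast
  qed
  moreover have "s \<subseteq> prob_measures E" unfolding s by blast
  ultimately have "s = {\<mu> \<in> prob_measures E. wtest \<mu> \<in> - closure (wtest ` C)}"
    by (intro set_eqI iffI) auto
  then have "\<exists>W. open W \<and> s = {\<mu> \<in> prob_measures E. wtest \<mu> \<in> W}"
    by (intro exI[of _ "- closure (wtest ` C)"]) (simp add: open_Compl)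
  then show ?thesis unfolding s .
qed

text \<open>Being a preimage under \<open>wtest\<close> passes from the subbasis to all open sets.
  Questions about weakly open sets thereby become questions about a countable product of
  reals.\<close>

lemma openin_weak_topologyD:
  fixes V :: "'a::polish_space measure set"
  assumes "openin (weak_topology E) V"
  shows "\<exists>W. open W \<and> V = {\<mu> \<in> prob_measures E. wtest \<mu> \<in> W}"
proof (rule generate_topology_on_pullback)
  show "generate_topology_on {{\<mu> \<in> prob_measures E. (\<integral>y. f y \<partial>\<mu>) \<in> U} | (f :: 'a \<Rightarrow> real) U.
        continuous_on E f \<and> bounded (f ` E) \<and> open U} V"
    using assms unfolding weak_topology_def openin_topology_generated_by_iff .
  fix s assume "s \<in> {{\<mu> \<in> prob_measures E. (\<integral>y. f y \<partial>\<mu>) \<in> U} | (f :: 'a \<Rightarrow> real) U.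
        continuous_on E f \<and> bounded (f ` E) \<and> open U}"
  then have "\<exists>(f :: 'a \<Rightarrow> real) U. s = {\<mu> \<in> prob_measures E. (\<integral>y. f y \<partial>\<mu>) \<in> U} \<and>
        continuous_on E f \<and> bounded (f ` E) \<and> open U" by (rule CollectD)
  then show "\<exists>W. open W \<and> s = {\<mu> \<in> prob_measures E. wtest \<mu> \<in> W}"
    by (elim exE conjE) (hypsubst, rule weak_topology_subbasis_pullback)
qed

lemma openin_weak_topology_integral:
  fixes f :: "'a::polish_space \<Rightarrow> real"
  assumes "continuous_on E f" "bounded (f ` E)" "open U"
  shows "openin (weak_topology E) {\<mu> \<in> prob_measures E. (\<integral>y. f y \<partial>\<mu>) \<in> U}"
  unfolding weak_topology_def
  by (rule topology_generated_by_Basis, rule CollectI, rule exI[of _ f], rule exI[of _ U])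
     (simp add: assms)

lemma openin_weak_topology_subset: "openin (weak_topology E) V \<Longrightarrow> V \<subseteq> prob_measures (E :: 'a::polish_space set)"
  using openin_weak_topologyD[of E V] by auto

section \<open>The Borel sigma-algebra of the weak topology\<close>

lemma space_weak_borel: "space (weak_borel E) = prob_measures E"
  unfolding weak_borel_def by (rule space_measure_of_conv)

lemma sets_weak_borel:
  "sets (weak_borel (E :: 'a::polish_space set)) = sigma_sets (prob_measures E) {V. openin (weak_topology E) V}"
  unfolding weak_borel_def
  by (intro sets_measure_of) (use openin_weak_topology_subset in blast)

lemma measurable_integral_weak_borel:
  fixes f :: "'a::polish_space \<Rightarrow> real"
  assumes "continuous_on E f" "bounded (f ` E)"
  shows "(\<lambda>\<mu>. \<integral>y. f y \<partial>\<mu>) \<in> borel_measurable (weak_borel E)"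
proof (rule borel_measurableI)
  fix U :: "real set" assume "open U"
  have "(\<lambda>\<mu>. \<integral>y. f y \<partial>\<mu>) -` U \<inter> space (weak_borel E) = {\<mu> \<in> prob_measures E. (\<integral>y. f y \<partial>\<mu>) \<in> U}"
    by (auto simp: space_weak_borel)
  also have "\<dots> \<in> sets (weak_borel E)"
    unfolding sets_weak_borel
    by (rule sigma_sets.Basic, rule CollectI) (rule openin_weak_topology_integral[OF assms \<open>open U\<close>])
  finally show "(\<lambda>\<mu>. \<integral>y. f y \<partial>\<mu>) -` U \<inter> space (weak_borel E) \<in> sets (weak_borel E)" .
qed

lemma space_prob_algebra_borel_on: "space (prob_algebra (borel_on E)) = prob_measures E"
  by (auto simp: space_prob_algebra prob_measures_def)

text \<open>By separability, the topology is generated by countably many integrals, so that measurability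
  for the Giry sigma-algebra suffices.\<close>

lemma measurable_weak_borelI:
  assumes "f \<in> N \<rightarrow>\<^sub>M prob_algebra (borel_on (E :: 'a::polish_space set))"
  shows "f \<in> N \<rightarrow>\<^sub>M weak_borel E"
proof (rule measurable_sigma_sets[OF sets_weak_borel])
  have "wtest \<in> prob_algebra (borel_on E) \<rightarrow>\<^sub>M borel"
  proof (rule measurable_coordinatewise_then_product)
    show "(\<lambda>\<mu>. wtest \<mu> ps) \<in> borel_measurable (prob_algebra (borel_on E))" for ps
      unfolding wtest_def prob_algebra_def
      by (intro measurable_restrict_space1 integral_measurable_subprob_algebra measurable_max_spikes_on)
  qed
  from measurable_compose[OF assms this] have m: "(\<lambda>n. wtest (f n)) \<in> N \<rightarrow>\<^sub>M borel" .
  show f: "f \<in> space N \<rightarrow> prob_measures E"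
    using measurable_space[OF assms] by (simp add: space_prob_algebra_borel_on)
  fix V assume "V \<in> {V. openin (weak_topology E) V}"
  then obtain W where W: "open W" "V = {\<mu> \<in> prob_measures E. wtest \<mu> \<in> W}"
    using openin_weak_topologyD[of E V] by auto
  have "f -` V \<inter> space N = (\<lambda>n. wtest (f n)) -` W \<inter> space N" using f W(2) by auto
  also have "\<dots> \<in> sets N" using W(1) by (intro measurable_sets[OF m]) simp
  finally show "f -` V \<inter> space N \<in> sets N" .
qed (use openin_weak_topology_subset in blast)

text \<open>The difference of the two integrals is at most \<open>K\<close> times the L1 distance.
  With \<open>g\<close> a maximum of tents this yields the numerators of the posterior integrals,
  with \<open>g = 1\<close> their denominators.\<close>

lemma tendsto_integral_L1_weight:
  fixes f :: "nat \<Rightarrow> 'a \<Rightarrow> real"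
  assumes int: "\<And>n. integrable N (f n)" "integrable N h"
    and lim: "(\<lambda>n. \<integral>\<^sup>+x. ennreal \<bar>f n x - h x\<bar> \<partial>N) \<longlonglongrightarrow> 0"
    and g: "g \<in> borel_measurable N" "\<And>x. \<bar>g x\<bar> \<le> K"
  shows "(\<lambda>n. \<integral>x. f n x * g x \<partial>N) \<longlonglongrightarrow> (\<integral>x. h x * g x \<partial>N)"
proof -
  have intg: "integrable N (\<lambda>x. k x * g x)" if "integrable N k" for k :: "'a \<Rightarrow> real"
  proof (rule Bochner_Integration.integrable_bound)
    show "integrable N (\<lambda>x. k x * K)" using that by simp
    show "AE x in N. norm (k x * g x) \<le> norm (k x * K)"
      using g(2) by (auto simp: abs_mult intro!: mult_left_mono order_trans[OF g(2)])
  qed (use that g in auto)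
  have le: "\<bar>(\<integral>x. f n x * g x \<partial>N) - (\<integral>x. h x * g x \<partial>N)\<bar> \<le> K * enn2real (\<integral>\<^sup>+x. ennreal \<bar>f n x - h x\<bar> \<partial>N)" for n
  proof -
    have "(\<integral>x. f n x * g x \<partial>N) - (\<integral>x. h x * g x \<partial>N) = (\<integral>x. (f n x - h x) * g x \<partial>N)"
      by (simp add: left_diff_distrib intg int)
    also have "\<bar>\<dots>\<bar> \<le> (\<integral>x. \<bar>(f n x - h x) * g x\<bar> \<partial>N)" by (rule integral_abs_bound)
    also have "\<dots> \<le> (\<integral>x. K * \<bar>f n x - h x\<bar> \<partial>N)"
    proof (rule integral_mono)
      show "integrable N (\<lambda>x. \<bar>(f n x - h x) * g x\<bar>)" using int by (intro integrable_abs intg) auto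
      show "integrable N (\<lambda>x. K * \<bar>f n x - h x\<bar>)" using int by auto
      show "\<bar>(f n x - h x) * g x\<bar> \<le> K * \<bar>f n x - h x\<bar>" for x
        using mult_right_mono[OF g(2)[of x], of "\<bar>f n x - h x\<bar>"] by (simp add: abs_mult mult.commute)
    qed
    also have "\<dots> = K * enn2real (\<integral>\<^sup>+x. ennreal \<bar>f n x - h x\<bar> \<partial>N)"
      using int by (simp add: integral_eq_nn_integral)
    finally show ?thesis .
  qed
  have "(\<lambda>n. enn2real (\<integral>\<^sup>+x. ennreal \<bar>f n x - h x\<bar> \<partial>N)) \<longlonglongrightarrow> 0"
    by (rule tendsto_enn2real) (use lim in simp_all)
  then have "(\<lambda>n. K * enn2real (\<integral>\<^sup>+x. ennreal \<bar>f n x - h x\<bar> \<partial>N)) \<longlonglongrightarrow> K * 0"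
    by (rule tendsto_mult_left)
  then have "(\<lambda>n. K * enn2real (\<integral>\<^sup>+x. ennreal \<bar>f n x - h x\<bar> \<partial>N)) \<longlonglongrightarrow> 0" by simp
  then have "(\<lambda>n. (\<integral>x. f n x * g x \<partial>N) - (\<integral>x. h x * g x \<partial>N)) \<longlonglongrightarrow> 0"
    by (rule Lim_null_comparison[rotated]) (use le in auto)
  then show ?thesis by (rule LIM_zero_cancel)
qed

text \<open>Converts lower semicontinuity stated through sublevel sets into an eventual strict lower
  bound: if the bound failed infinitely often, a subsequence would stay in the sublevel set of
  \<open>t\<close>.\<close>

lemma eventually_greater_of_closed_sublevels:
  fixes v :: "nat \<Rightarrow> real"
  assumes "\<And>s. strict_mono (s :: nat \<Rightarrow> nat) \<Longrightarrow> (\<And>n. v (s n) \<le> t) \<Longrightarrow> False"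
  shows "\<forall>\<^sub>F n in sequentially. t < v n"
proof (rule ccontr)
  assume "\<not> (\<forall>\<^sub>F n in sequentially. t < v n)"
  then obtain s :: "nat \<Rightarrow> nat" where "strict_mono s" "\<And>n. \<not> t < v (s n)"
    using not_eventually_sequentiallyD by blast
  then show False using assms[of s] by (simp add: not_less)
qed

section \<open>Measurable selection\<close>

lemma compact_nested_nonempty:
  fixes K :: "nat \<Rightarrow> 'a::t2_space set"
  assumes "\<And>n. compact (K n)" "\<And>n. K n \<noteq> {}" "\<And>n. K (Suc n) \<subseteq> K n"
  shows "(\<Inter>n. K n) \<noteq> {}"
proof -
  have dec: "K n \<subseteq> K m" if "m \<le> n" for m n
    using lift_Suc_antimono_le[of K] assms(3) that by blast
  have "K 0 \<inter> (\<Inter>n\<in>UNIV. K n) \<noteq> {}"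
  proof (rule compact_imp_fip_image[OF assms(1)])
    show "closed (K n)" for n using assms(1) by (rule compact_imp_closed)
    show "K 0 \<inter> (\<Inter>n\<in>I. K n) \<noteq> {}" if fin: "finite I" for I
    proof -
      obtain m :: nat where "\<forall>i\<in>I. i \<le> m" using fin unfolding finite_nat_set_iff_bounded_le by blast
      then have "K m \<subseteq> K 0 \<inter> (\<Inter>n\<in>I. K n)" using dec by blast
      then show ?thesis using assms(2)[of m] by blast
    qed
  qed
  then show ?thesis by blast
qed

text \<open>A compact-valued form of the Kuratowski--Ryll-Nardzewski theorem: cutting \<open>D p\<close> with the first ball
  of a countable cover that meets it, with radii tending to \<open>0\<close>, leaves a single point.\<close>

theorem measurable_selection_compact:
  fixes D :: "'p \<Rightarrow> 'a::polish_space set"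
  assumes compact: "\<And>p. p \<in> space P \<Longrightarrow> compact (D p)"
    and nonempty: "\<And>p. p \<in> space P \<Longrightarrow> D p \<noteq> {}"
    and meas: "\<And>F. closed F \<Longrightarrow> {p \<in> space P. D p \<inter> F \<noteq> {}} \<in> sets P"
  shows "\<exists>f \<in> P \<rightarrow>\<^sub>M borel. \<forall>p\<in>space P. f p \<in> D p"
proof -
  \<comment> \<open>Taking the least index makes the choice a Boolean combination of conditions of
    the form "the set meets a closed ball", hence measurable in \<open>p\<close>.\<close>
  define i where "i n S = (LEAST i. S \<inter> cball (dense_seq i) ((1/2)^n) \<noteq> {})" for n and S :: "'a set"
  define K where "K = rec_nat D (\<lambda>n S p. S p \<inter> cball (dense_seq (i n (S p))) ((1/2)^n))"
  have K0: "K 0 = D" and KS: "K (Suc n) p = K n p \<inter> cball (dense_seq (i n (K n p))) ((1/2)^n)" for n p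
    by (simp_all add: K_def)
  have ex: "\<exists>i. S \<inter> cball (dense_seq i) ((1/2)^n) \<noteq> {}" if ne: "S \<noteq> {}" for S :: "'a set" and n
  proof -
    obtain s where "s \<in> S" using ne by blast
    moreover obtain j where "dense_seq j \<in> ball s ((1/2)^n)"
      using dense_seq_dense[of "ball s ((1/2)^n)"] centre_in_ball[of s "(1/2)^n"] zero_less_power[of "1/2::real" n]
      by (metis empty_iff half_gt_zero_iff open_ball zero_less_one)
    ultimately have "s \<in> S \<inter> cball (dense_seq j) ((1/2)^n)"
      by (simp add: dist_commute less_imp_le)
    then show ?thesis by blast
  qed
  have i: "S \<inter> cball (dense_seq (i n S)) ((1/2)^n) \<noteq> {}" if ne: "S \<noteq> {}" for S n
    unfolding i_def by (rule LeastI_ex) (rule ex[OF ne])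
  have Kc: "compact (K n p) \<and> K n p \<noteq> {}" if p: "p \<in> space P" for n p
  proof (induction n)
    case 0 then show ?case using compact nonempty p by (simp add: K0)
  next
    case (Suc n) then show ?case using i by (auto simp: KS intro!: compact_Int_closed)
  qed
  \<comment> \<open>Quantifying over all closed \<open>F\<close> makes the induction work: that the
    cut set meets \<open>F\<close> is a condition on \<open>K n p\<close> and the closed set
    \<open>?B j \<inter> F\<close>.\<close>
  have Km: "{p \<in> space P. K n p \<inter> F \<noteq> {}} \<in> sets P" if F: "closed F" for n F
    using F
  proof (induction n arbitrary: F)
    case 0 then show ?case using meas by (simp add: K0)
  next
    case (Suc n)
    let ?B = "\<lambda>j. cball (dense_seq j :: 'a) ((1/2)^n)"
    let ?H = "\<lambda>F. {p \<in> space P. K n p \<inter> F \<noteq> {}}"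
    have eq: "i n (K n p) = j \<longleftrightarrow> K n p \<inter> ?B j \<noteq> {} \<and> (\<forall>k<j. K n p \<inter> ?B k = {})"
      if p: "p \<in> space P" for p j
    proof
      assume "i n (K n p) = j"
      then show "K n p \<inter> ?B j \<noteq> {} \<and> (\<forall>k<j. K n p \<inter> ?B k = {})"
        using i[of "K n p" n] Kc[OF p, of n] not_less_Least[of _ "\<lambda>j. K n p \<inter> ?B j \<noteq> {}"]
        unfolding i_def by blast
    next
      assume "K n p \<inter> ?B j \<noteq> {} \<and> (\<forall>k<j. K n p \<inter> ?B k = {})"
      then show "i n (K n p) = j"
        unfolding i_def by (intro Least_equality) (auto simp: not_less[symmetric])
    qed
    have "{p \<in> space P. K (Suc n) p \<inter> F \<noteq> {}} =
      (\<Union>j. (?H (?B j) - (\<Union>k<j. ?H (?B k))) \<inter> ?H (?B j \<inter> F))" (is "?L = ?R")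
    proof (rule set_eqI)
      fix p
      have "p \<in> ?L \<longleftrightarrow> p \<in> space P \<and> (\<exists>j. i n (K n p) = j \<and> K n p \<inter> (?B j \<inter> F) \<noteq> {})"
        by (auto simp: KS)
      also have "\<dots> \<longleftrightarrow> p \<in> space P \<and> (\<exists>j. (K n p \<inter> ?B j \<noteq> {} \<and> (\<forall>k<j. K n p \<inter> ?B k = {})) \<and> K n p \<inter> (?B j \<inter> F) \<noteq> {})"
        using eq by (intro conj_cong refl) simp
      also have "\<dots> \<longleftrightarrow> p \<in> ?R" by auto
      finally show "p \<in> ?L \<longleftrightarrow> p \<in> ?R" .
    qed
    also have "\<dots> \<in> sets P"
      using Suc by (intro sets.countable_UN sets.Int sets.Diff sets.finite_UN image_subsetI) (auto intro: closed_Int)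
    finally show ?case .
  qed
  define f where "f p = (SOME a. a \<in> (\<Inter>n. K n p))" for p
  have f: "f p \<in> (\<Inter>n. K n p)" if p: "p \<in> space P" for p
  proof -
    have "(\<Inter>n. K n p) \<noteq> {}"
      using Kc[OF p] by (intro compact_nested_nonempty) (auto simp: KS)
    then have "\<exists>a. a \<in> (\<Inter>n. K n p)" by (simp only: ex_in_conv) simp
    then show ?thesis unfolding f_def by (rule someI_ex)
  qed
  have uniq: "a = f p" if p: "p \<in> space P" and a: "a \<in> (\<Inter>n. K n p)" for a p
  proof -
    have le: "dist a (f p) \<le> 2 * (1/2)^n" for n
    proof -
      have "a \<in> K (Suc n) p" "f p \<in> K (Suc n) p" using a f[OF p] by blast+
      then have "dist (dense_seq (i n (K n p))) a \<le> (1/2)^n" "dist (dense_seq (i n (K n p))) (f p) \<le> (1/2)^n"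
        by (auto simp: KS)
      then show ?thesis
        using dist_triangle3[of a "f p" "dense_seq (i n (K n p))"] by linarith
    qed
    have "(\<lambda>n. 2 * (1/2)^n :: real) \<longlonglongrightarrow> 2 * 0"
      by (intro tendsto_intros LIMSEQ_power_zero) auto
    then have "dist a (f p) \<le> 2 * 0" by (rule LIMSEQ_le_const) (use le in auto)
    then show ?thesis by simp
  qed
  have cl: "{p \<in> space P. f p \<in> F} \<in> sets P" if F: "closed F" for F
  proof -
    \<comment> \<open>Compactness turns a condition on the selected point into countably many
      hitting conditions: if every \<open>K n p\<close> meets \<open>F\<close>, the nested compact
      sets \<open>K n p \<inter> F\<close> have a common point, which must be
      \<open>f p\<close>.\<close>
    have "f p \<in> F \<longleftrightarrow> (\<forall>n. K n p \<inter> F \<noteq> {})" if p: "p \<in> space P" for p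
    proof
      assume "\<forall>n. K n p \<inter> F \<noteq> {}"
      then have "(\<Inter>n. K n p \<inter> F) \<noteq> {}"
        using Kc[OF p] F by (intro compact_nested_nonempty compact_Int_closed) (auto simp: KS)
      then obtain a where "a \<in> F" "a \<in> (\<Inter>n. K n p)" by blast
      then show "f p \<in> F" using uniq[OF p] by blast
    qed (use f[OF p] in blast)
    then have "{p \<in> space P. f p \<in> F} = {p \<in> space P. \<forall>n. K n p \<inter> F \<noteq> {}}" by blast
    also have "\<dots> \<in> sets P" by (intro sets.sets_Collect_countable_All Km F)
    finally show ?thesis .
  qed
  have "f \<in> P \<rightarrow>\<^sub>M borel"
  proof (rule borel_measurableI)
    fix U :: "'a set" assume "open U"
    then have "space P - {p \<in> space P. f p \<in> - U} \<in> sets P" by (intro sets.compl_sets cl) auto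
    also have "space P - {p \<in> space P. f p \<in> - U} = f -` U \<inter> space P" by blast
    finally show "f -` U \<inter> space P \<in> sets P" .
  qed
  moreover have "f p \<in> D p" if "p \<in> space P" for p
    using f[OF that] K0 by blast
  ultimately show ?thesis by blast
qed

section \<open>Measurability of sequentially closed sets\<close>

lemma measurable_wtest: "wtest \<in> weak_borel (E :: 'a::polish_space set) \<rightarrow>\<^sub>M borel"
proof (rule measurable_coordinatewise_then_product)
  fix ps
  obtain B where B: "\<And>y::'a. max_spikes ps y \<le> B" using max_spikes_bounded[of ps] by blast
  show "(\<lambda>\<mu>. wtest \<mu> ps) \<in> borel_measurable (weak_borel E)"
    unfolding wtest_def
    by (intro measurable_integral_weak_borel continuous_on_max_spikes boundedI[where B=B])
       (use B in \<open>auto simp: max_spikes_nonneg\<close>)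
qed

text \<open>Applying \<open>wtest\<close> to the middle component maps into a metrizable space,
  where a point of a closure is a limit of a sequence. A sequentially closed set is therefore the
  preimage of the closure of its image, and the map is measurable.\<close>

lemma sets_seq_closed:
  fixes S :: "('x::polish_space \<times> 'y::polish_space measure \<times> real) set"
  assumes sub: "S \<subseteq> X \<times> prob_measures Y \<times> W"
    and closed: "\<And>xs x \<mu>s \<mu> ws w. (\<And>n. (xs n, \<mu>s n, ws n) \<in> S) \<Longrightarrow> x \<in> X \<Longrightarrow> \<mu> \<in> prob_measures Y \<Longrightarrow> w \<in> W
      \<Longrightarrow> xs \<longlonglongrightarrow> x \<Longrightarrow> wconv \<mu>s \<mu> \<Longrightarrow> ws \<longlonglongrightarrow> w \<Longrightarrow> (x, \<mu>, w) \<in> S"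
  shows "S \<in> sets (borel_on X \<Otimes>\<^sub>M weak_borel Y \<Otimes>\<^sub>M borel_on W)" (is "_ \<in> sets ?P")
proof -
  define e where "e = (\<lambda>(x::'x, \<mu>::'y measure, w::real). (x, wtest \<mu>, w))"
  have sp: "space ?P = X \<times> prob_measures Y \<times> W"
    by (simp add: space_pair_measure space_weak_borel space_restrict_space)
  have "e \<in> ?P \<rightarrow>\<^sub>M borel \<Otimes>\<^sub>M borel \<Otimes>\<^sub>M borel"
    unfolding e_def case_prod_beta
    by (intro measurable_Pair measurable_compose[OF measurable_fst] measurable_compose[OF measurable_snd]
          measurable_wtest measurable_restrict_space1 measurable_ident_sets refl)
  then have e: "e \<in> ?P \<rightarrow>\<^sub>M borel" unfolding borel_prod .
  have "S = e -` closure (e ` S) \<inter> space ?P"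
  proof
    show "S \<subseteq> e -` closure (e ` S) \<inter> space ?P"
      using sub closure_subset[of "e ` S"] by (auto simp: sp)
    show "e -` closure (e ` S) \<inter> space ?P \<subseteq> S"
    proof
      fix p assume p: "p \<in> e -` closure (e ` S) \<inter> space ?P"
      obtain x \<mu> w where pe: "p = (x, \<mu>, w)" by (cases p)
      have mem: "x \<in> X" "\<mu> \<in> prob_measures Y" "w \<in> W" using p by (auto simp: sp pe)
      obtain Z where Z: "\<And>n. Z n \<in> e ` S" "Z \<longlonglongrightarrow> (x, wtest \<mu>, w)"
        using p by (auto simp: pe e_def closure_sequential)
      then have "\<forall>n. \<exists>s. s \<in> S \<and> Z n = e s" by blast
      then obtain s where s: "\<And>n. s n \<in> S" "\<And>n. Z n = e (s n)" by metis
      have lims: "(\<lambda>n. fst (Z n)) \<longlonglongrightarrow> x" "(\<lambda>n. fst (snd (Z n))) \<longlonglongrightarrow> wtest \<mu>" "(\<lambda>n. snd (snd (Z n))) \<longlonglongrightarrow> w"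
        using tendsto_fst[OF Z(2)] tendsto_fst[OF tendsto_snd[OF Z(2)]] tendsto_snd[OF tendsto_snd[OF Z(2)]]
        by simp_all
      have "(x, \<mu>, w) \<in> S"
      proof (rule closed[where xs="\<lambda>n. fst (s n)" and \<mu>s="\<lambda>n. fst (snd (s n))" and ws="\<lambda>n. snd (snd (s n))"])
        show "wconv (\<lambda>n. fst (snd (s n))) \<mu>"
          unfolding wconv_def using tendsto_fun_component[OF lims(2)] s(2) by (simp add: e_def case_prod_beta)
      qed (use s lims mem in \<open>auto simp: e_def case_prod_beta\<close>)
      then show "p \<in> S" by (simp add: pe)
    qed
  qed
  also have "\<dots> \<in> sets ?P" by (intro measurable_sets[OF e]) auto
  finally show ?thesis .
qed

section \<open>The model and its filter\<close>

lemma action_cong: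
  "(\<And>i. i \<le> n \<Longrightarrow> xs i = xs' i) \<Longrightarrow> action \<pi> xs n = action \<pi> xs' n"
proof (induction n rule: less_induct)
  case (less n)
  have 1: "restrict xs {..n} = restrict xs' {..n}"
    using less.prems by (intro restrict_ext) auto
  have 2: "(\<lambda>i. if i < n then action \<pi> xs i else undefined) = (\<lambda>i. if i < n then action \<pi> xs' i else undefined)"
  proof (rule ext)
    fix i
    show "(if i < n then action \<pi> xs i else undefined) = (if i < n then action \<pi> xs' i else undefined)"
      using less.IH[of i] less.prems by auto
  qed
  show ?case by (subst (1 2) action.simps) (simp only: 1 2)
qed

locale pomdp =
  fixes M :: "('x::polish_space, 'y::polish_space, 'a::polish_space) pomdp"
  assumes model: "pomdp_model M" and standing: "standing_assumptions M"
begin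

abbreviation "XM \<equiv> borel_on (SX M)"
abbreviation "YM \<equiv> borel_on (SY M)"
abbreviation "AM \<equiv> borel_on (SA M)"
abbreviation "PY \<equiv> prob_measures (SY M)"
abbreviation "XYM \<equiv> XM \<Otimes>\<^sub>M YM"
abbreviation "LN \<equiv> lam M \<Otimes>\<^sub>M nu M"
abbreviation "\<beta> \<equiv> disc M"

lemma sets_SX[measurable]: "SX M \<in> sets borel" and sets_SY[measurable]: "SY M \<in> sets borel"
  and adm_subset: "adm M \<subseteq> SX M \<times> SA M" and sets_adm[measurable]: "adm M \<in> sets borel"
  and sets_lam[measurable_cong]: "sets (lam M) = sets XM" and sets_nu[measurable_cong]: "sets (nu M) = sets YM"
  and init_prob: "init M \<in> PY"
  and disc: "0 < \<beta>" "\<beta> \<le> 1"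
  using model unfolding pomdp_model_def by blast+

lemma sigma_finite_lam: "sigma_finite_measure (lam M)" and sigma_finite_nu: "sigma_finite_measure (nu M)"
  using model unfolding pomdp_model_def by blast+

lemma space_lam: "space (lam M) = SX M" and space_nu: "space (nu M) = SY M"
  using sets_eq_imp_space_eq[OF sets_lam] sets_eq_imp_space_eq[OF sets_nu] by (auto simp: space_restrict_space)

lemma sets_DSY[measurable]: "DSY M \<in> sets borel"
proof -
  have "(\<lambda>s. (fst s, snd (snd s))) \<in> borel \<Otimes>\<^sub>M (borel :: 'y measure) \<Otimes>\<^sub>M borel \<rightarrow>\<^sub>M (borel :: ('x \<times> 'a) measure)"
    unfolding borel_prod[symmetric] by measurable
  from measurable_sets[OF this sets_adm]
  have 1: "(\<lambda>s::'x \<times> 'y \<times> 'a. (fst s, snd (snd s))) -` adm M \<in> sets borel"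
    by (simp only: borel_prod) simp
  have "(\<lambda>s. fst (snd s)) \<in> (borel :: 'x measure) \<Otimes>\<^sub>M borel \<Otimes>\<^sub>M (borel :: 'a measure) \<rightarrow>\<^sub>M (borel :: 'y measure)" by measurable
  from measurable_sets[OF this sets_SY]
  have 2: "(\<lambda>s::'x \<times> 'y \<times> 'a. fst (snd s)) -` SY M \<in> sets borel"
    by (simp only: borel_prod) simp
  have "DSY M = (\<lambda>s. (fst s, snd (snd s))) -` adm M \<inter> (\<lambda>s. fst (snd s)) -` SY M"
    by (auto simp: DSY_def)
  then show ?thesis using sets.Int[OF 1 2] by simp
qed

lemma DSY_iff: "(x, y, a) \<in> DSY M \<longleftrightarrow> (x, a) \<in> adm M \<and> y \<in> SY M"
  by (simp add: DSY_def)

text \<open>The cost is extended by 0 off \<open>DSY M\<close>, and the density \<open>q\<close>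
  likewise, so that measurability, bounds and signs hold on the whole product and no admissibility
  conditions have to be carried along.\<close>

definition c :: "'x \<times> 'y \<times> 'a \<Rightarrow> real" where
  "c s = (if s \<in> DSY M then cost M s else 0)"

definition q :: "'x \<times> 'y \<Rightarrow> 'x \<times> 'y \<times> 'a \<Rightarrow> real" where
  "q p s = (if p \<in> SX M \<times> SY M \<and> s \<in> DSY M then dens M p s else 0)"

lemma measurable_c: "c \<in> borel_measurable (borel \<Otimes>\<^sub>M borel \<Otimes>\<^sub>M borel)"
proof -
  have "cost M \<in> borel_measurable (borel_on (DSY M))" using model unfolding pomdp_model_def by blast
  then have "c \<in> borel_measurable borel"
    unfolding c_def by (subst (asm) measurable_restrict_space_iff[where c=0]) auto
  then show ?thesis by (simp only: borel_prod)
qed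

lemma measurable_q: "(\<lambda>(p, s). q p s) \<in> borel_measurable ((borel \<Otimes>\<^sub>M borel) \<Otimes>\<^sub>M (borel \<Otimes>\<^sub>M borel \<Otimes>\<^sub>M borel))"
proof -
  have m: "(\<lambda>(p, s). dens M p s) \<in> borel_measurable (borel_on ((SX M \<times> SY M) \<times> DSY M))"
    using model unfolding pomdp_model_def by blast
  have "(SX M \<times> SY M) \<times> DSY M \<in> sets borel" by (intro borel_Times sets_SX sets_SY sets_DSY)
  then have "(\<lambda>ps. if ps \<in> (SX M \<times> SY M) \<times> DSY M then (\<lambda>(p, s). dens M p s) ps else 0) \<in> borel_measurable borel"
    using m by (subst (asm) measurable_restrict_space_iff[where c=0]) auto
  moreover have "(\<lambda>ps. if ps \<in> (SX M \<times> SY M) \<times> DSY M then (\<lambda>(p, s). dens M p s) ps else 0) = (\<lambda>(p, s). q p s)"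
    by (auto simp: q_def fun_eq_iff)
  ultimately show ?thesis by (simp only: borel_prod)
qed

lemma measurable_c'[measurable (raw)]:
  assumes "f \<in> N \<rightarrow>\<^sub>M borel" "g \<in> N \<rightarrow>\<^sub>M borel" "h \<in> N \<rightarrow>\<^sub>M borel"
  shows "(\<lambda>x. c (f x, g x, h x)) \<in> borel_measurable N"
  by (rule measurable_compose[OF _ measurable_c]) (intro measurable_Pair assms)

lemma measurable_q'[measurable (raw)]:
  assumes "f \<in> N \<rightarrow>\<^sub>M borel" "g \<in> N \<rightarrow>\<^sub>M borel" "h \<in> N \<rightarrow>\<^sub>M borel" "k \<in> N \<rightarrow>\<^sub>M borel" "l \<in> N \<rightarrow>\<^sub>M borel"
  shows "(\<lambda>x. q (f x, g x) (h x, k x, l x)) \<in> borel_measurable N"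
proof -
  have "(\<lambda>x. ((f x, g x), (h x, k x, l x))) \<in> N \<rightarrow>\<^sub>M ((borel \<Otimes>\<^sub>M borel) \<Otimes>\<^sub>M (borel \<Otimes>\<^sub>M borel \<Otimes>\<^sub>M borel))"
    by (intro measurable_Pair assms)
  from measurable_compose[OF this measurable_q] show ?thesis by simp
qed

lemma q_nonneg: "0 \<le> q p s"
  using model unfolding pomdp_model_def q_def by auto

definition c_max :: real where "c_max = (SOME b. 0 < b \<and> (\<forall>s\<in>DSY M. cost M s \<le> b))"

lemma c_max: "0 < c_max" "\<And>s. c s \<le> c_max" and c_nonneg: "0 \<le> c s"
proof -
  have ex: "\<exists>b. 0 < b \<and> (\<forall>s\<in>DSY M. cost M s \<le> b)"
    using standing unfolding standing_assumptions_def by (meson less_trans)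
  show "0 < c_max" "\<And>s. c s \<le> c_max"
    using someI_ex[OF ex] unfolding c_max_def[symmetric] c_def by (auto simp: less_imp_le)
  show "0 \<le> c s" using model unfolding pomdp_model_def c_def by auto
qed

lemma measurable_borel_onD: "f \<in> N \<rightarrow>\<^sub>M borel_on E \<Longrightarrow> f \<in> N \<rightarrow>\<^sub>M borel"
  by (auto simp: measurable_restrict_space2_iff)

lemma measurable_id_borel_on[measurable]: "(\<lambda>y. y) \<in> borel_on E \<rightarrow>\<^sub>M borel"
  by (intro measurable_restrict_space1) simp

lemma measurable_id_lam[measurable]: "(\<lambda>x. x) \<in> lam M \<rightarrow>\<^sub>M borel"
  by (rule measurable_borel_onD[where E="SX M"]) measurable

lemma measurable_id_nu[measurable]: "(\<lambda>y. y) \<in> nu M \<rightarrow>\<^sub>M borel"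
  by (rule measurable_borel_onD[where E="SY M"]) measurable

lemma measurable_lam_nu_proj[measurable]:
  "fst \<in> LN \<rightarrow>\<^sub>M borel" "snd \<in> LN \<rightarrow>\<^sub>M borel"
  by (auto intro: measurable_borel_onD[where E="SX M"] measurable_borel_onD[where E="SY M"])

lemma measurable_kern: "kern M \<in> borel_on (DSY M) \<rightarrow>\<^sub>M prob_algebra XYM"
  using model unfolding pomdp_model_def by blast

lemma kern_prob_algebra:
  assumes "s \<in> DSY M" shows "prob_space (kern M s)" "sets (kern M s) = sets XYM"
  using measurable_space[OF measurable_kern, of s] assms
  by (auto simp: space_prob_algebra space_restrict_space)

lemma sets_lam_nu: "sets LN = sets XYM"
  by (rule sets_pair_measure_cong[OF sets_lam sets_nu])

lemma space_lam_nu: "space LN = SX M \<times> SY M"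
  by (simp add: space_pair_measure space_lam space_nu)

lemma nn_integral_kern:
  assumes s: "s \<in> DSY M" and F: "F \<in> borel_measurable XYM"
  shows "(\<integral>\<^sup>+p. F p \<partial>kern M s) = (\<integral>\<^sup>+p. ennreal (q p s) * F p \<partial>LN)"
proof -
  obtain x y a where sxya: "s = (x, y, a)" by (cases s)
  have "(\<lambda>p. q (fst p, snd p) (x, y, a)) \<in> borel_measurable LN" by measurable
  then have qm: "(\<lambda>p. q p s) \<in> borel_measurable LN" by (simp add: sxya)
  have dq: "dens M p s = q p s" if "p \<in> space LN" for p
    using that s by (simp add: q_def space_lam_nu)
  have "kern M s = density LN (\<lambda>p. ennreal (dens M p s))"
    using model s unfolding pomdp_model_def by blast
  then have "(\<integral>\<^sup>+p. F p \<partial>kern M s) = (\<integral>\<^sup>+p. ennreal (dens M p s) * F p \<partial>LN)"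
    using F qm by (simp only:) (subst nn_integral_density, auto simp: dq measurable_cong_sets[OF sets_lam_nu refl] cong: measurable_cong)
  also have "\<dots> = (\<integral>\<^sup>+p. ennreal (q p s) * F p \<partial>LN)"
    by (rule nn_integral_cong) (simp add: dq)
  finally show ?thesis .
qed

text \<open>\<open>L\<close> is the numerator density of \<open>\<Psi>\<^sub>e\<close>, jointly in \<open>(x', y')\<close>, and \<open>mass\<close> its denominator.\<close>

definition L :: "'x \<Rightarrow> 'a \<Rightarrow> 'y measure \<Rightarrow> real \<Rightarrow> 'x \<times> 'y \<Rightarrow> ennreal" where
  "L x a \<mu> w p = (\<integral>\<^sup>+y. ennreal (exp (w * c (x, y, a)) * q p (x, y, a)) \<partial>\<mu>)"

definition mass :: "'x \<Rightarrow> 'a \<Rightarrow> 'y measure \<Rightarrow> real \<Rightarrow> 'x \<Rightarrow> ennreal" where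
  "mass x a \<mu> w x' = (\<integral>\<^sup>+y'. L x a \<mu> w (x', y') \<partial>nu M)"

lemma Psi_dens_eq:
  assumes "(x, a) \<in> adm M" "\<mu> \<in> PY" "x' \<in> SX M" "y' \<in> SY M"
  shows "Psi_dens M x a x' \<mu> w y' = L x a \<mu> w (x', y')"
  unfolding Psi_dens_def L_def
  using assms by (intro nn_integral_cong)
     (simp add: space_prob_measures c_def q_def DSY_iff ennreal_mult' del: mult.commute)

lemma Psi_mass_eq:
  assumes "(x, a) \<in> adm M" "\<mu> \<in> PY" "x' \<in> SX M"
  shows "(\<integral>\<^sup>+y'. Psi_dens M x a x' \<mu> w y' \<partial>nu M) = mass x a \<mu> w x'"
  unfolding mass_def using assms by (intro nn_integral_cong) (simp add: Psi_dens_eq space_nu)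

lemma measurable_L[measurable (raw)]:
  assumes [measurable]: "X \<in> N \<rightarrow>\<^sub>M borel" "A \<in> N \<rightarrow>\<^sub>M borel" "W \<in> N \<rightarrow>\<^sub>M borel" "X' \<in> N \<rightarrow>\<^sub>M borel" "Y' \<in> N \<rightarrow>\<^sub>M borel"
    and m: "m \<in> N \<rightarrow>\<^sub>M prob_algebra YM"
  shows "(\<lambda>n. L (X n) (A n) (m n) (W n) (X' n, Y' n)) \<in> borel_measurable N"
proof -
  have [measurable]: "snd \<in> N \<Otimes>\<^sub>M YM \<rightarrow>\<^sub>M borel" by (rule measurable_borel_onD) measurable
  show ?thesis
    unfolding L_def
    by (rule nn_integral_measurable_subprob_algebra2[OF _ measurable_prob_algebraD[OF m]])
       (simp add: case_prod_beta, measurable)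
qed

lemma measurable_L_nu:
  assumes [measurable]: "X \<in> N \<rightarrow>\<^sub>M borel" "A \<in> N \<rightarrow>\<^sub>M borel" "W \<in> N \<rightarrow>\<^sub>M borel" "X' \<in> N \<rightarrow>\<^sub>M borel"
    and m[measurable]: "m \<in> N \<rightarrow>\<^sub>M prob_algebra YM"
  shows "(\<lambda>(n, y'). L (X n) (A n) (m n) (W n) (X' n, y')) \<in> borel_measurable (N \<Otimes>\<^sub>M nu M)"
proof -
  have [measurable]: "snd \<in> N \<Otimes>\<^sub>M nu M \<rightarrow>\<^sub>M borel"
    by (rule measurable_borel_onD[where E="SY M"]) measurable
  show ?thesis by (simp add: case_prod_beta) measurable
qed

lemma measurable_mass[measurable (raw)]:
  assumes [measurable]: "X \<in> N \<rightarrow>\<^sub>M borel" "A \<in> N \<rightarrow>\<^sub>M borel" "W \<in> N \<rightarrow>\<^sub>M borel" "X' \<in> N \<rightarrow>\<^sub>M borel"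
    and m[measurable]: "m \<in> N \<rightarrow>\<^sub>M prob_algebra YM"
  shows "(\<lambda>n. mass (X n) (A n) (m n) (W n) (X' n)) \<in> borel_measurable N"
proof -
  interpret sigma_finite_measure "nu M" by (rule sigma_finite_nu)
  show ?thesis unfolding mass_def
    by (rule borel_measurable_nn_integral) (rule measurable_L_nu; fact)
qed

lemma measurable_L_nu_section:
  assumes \<mu>: "\<mu> \<in> PY"
  shows "(\<lambda>y'. L x a \<mu> w (x', y')) \<in> borel_measurable (nu M)"
proof -
  have [simp]: "\<mu> \<in> space (prob_algebra YM)" using \<mu> by (simp add: space_prob_algebra_borel_on)
  show ?thesis by measurable
qed

lemma nn_integral_Psi_e:
  assumes xa: "(x, a) \<in> adm M" and \<mu>: "\<mu> \<in> PY" and x': "x' \<in> SX M"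
    and F: "F \<in> borel_measurable YM"
  shows "(\<integral>\<^sup>+y. F y \<partial>Psi_e M x a x' \<mu> w) =
     (if 0 < mass x a \<mu> w x' \<and> mass x a \<mu> w x' < \<infinity>
      then 1 / mass x a \<mu> w x' * (\<integral>\<^sup>+y'. L x a \<mu> w (x', y') * F y' \<partial>nu M) else (\<integral>\<^sup>+y. F y \<partial>\<mu>))"
proof (cases "0 < mass x a \<mu> w x' \<and> mass x a \<mu> w x' < \<infinity>")
  case True
  note Lm = measurable_L_nu_section[OF \<mu>, of x a w x']
  have Psi: "Psi_e M x a x' \<mu> w = scale_measure (1 / mass x a \<mu> w x') (density (nu M) (Psi_dens M x a x' \<mu> w))"
    using True xa by (simp add: Psi_e_def Psi_mass_eq[OF xa \<mu> x'])
  have "density (nu M) (Psi_dens M x a x' \<mu> w) = density (nu M) (\<lambda>y'. L x a \<mu> w (x', y'))"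
  proof (rule density_cong)
    show "Psi_dens M x a x' \<mu> w \<in> borel_measurable (nu M)"
      by (subst measurable_cong[of _ _ "\<lambda>y'. L x a \<mu> w (x', y')"]) (auto simp: space_nu Psi_dens_eq[OF xa \<mu> x'] Lm)
  qed (auto simp: space_nu Psi_dens_eq[OF xa \<mu> x'] Lm)
  then show ?thesis
    using True F Lm unfolding Psi
    by (simp add: nn_integral_scale_measure nn_integral_density measurable_cong_sets[OF sets_nu refl])
next
  case False
  then have "Psi_e M x a x' \<mu> w = \<mu>" by (auto simp: Psi_e_def Let_def Psi_mass_eq[OF xa \<mu> x'])
  then show ?thesis by (simp only: if_not_P[OF False])
qed

lemma Psi_e_prob:
  assumes \<mu>: "\<mu> \<in> PY" and x': "x' \<in> SX M"
  shows "Psi_e M x a x' \<mu> w \<in> PY"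
proof (cases "(x, a) \<in> adm M \<and> 0 < mass x a \<mu> w x' \<and> mass x a \<mu> w x' < \<infinity>")
  case True
  then have xa: "(x, a) \<in> adm M" by simp
  have sets: "sets (Psi_e M x a x' \<mu> w) = sets YM"
    using \<mu> by (auto simp: Psi_e_def Let_def sets_nu sets_prob_measures)
  have "emeasure (Psi_e M x a x' \<mu> w) (space (Psi_e M x a x' \<mu> w)) = (\<integral>\<^sup>+y. 1 \<partial>Psi_e M x a x' \<mu> w)"
    by simp
  also have "\<dots> = 1 / mass x a \<mu> w x' * mass x a \<mu> w x'"
    using True by (subst nn_integral_Psi_e[OF xa \<mu> x']) (auto simp: mass_def)
  also have "\<dots> = 1" using True by (auto simp: ennreal_divide_times ennreal_divide_self)
  finally show ?thesis using sets by (auto simp: prob_measures_def intro: prob_spaceI)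
next
  case False
  then have "Psi_e M x a x' \<mu> w = \<mu>"
    using Psi_mass_eq[OF _ \<mu> x'] by (auto simp: Psi_e_def Let_def)
  then show ?thesis using \<mu> by simp
qed

text \<open>Measurability holds jointly, also in the prior. Hence iterated posteriors are measurable
  functions of the history, and measurable value functions and minimizers can be evaluated at
  them.\<close>

lemma measurable_Psi_e[measurable (raw)]:
  assumes [measurable]: "X \<in> N \<rightarrow>\<^sub>M borel" "A \<in> N \<rightarrow>\<^sub>M borel" "W \<in> N \<rightarrow>\<^sub>M borel"
    and X': "X' \<in> N \<rightarrow>\<^sub>M XM" and m[measurable]: "m \<in> N \<rightarrow>\<^sub>M prob_algebra YM"
  shows "(\<lambda>n. Psi_e M (X n) (A n) (X' n) (m n) (W n)) \<in> N \<rightarrow>\<^sub>M prob_algebra YM"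
proof (rule measurable_prob_algebraI)
  have X'm[measurable]: "X' \<in> N \<rightarrow>\<^sub>M borel" using X' by (rule measurable_borel_onD)
  have m_prob: "m n \<in> PY" if "n \<in> space N" for n
    using measurable_space[OF m that] by (simp add: space_prob_algebra_borel_on)
  have X'_in: "X' n \<in> SX M" if "n \<in> space N" for n
    using measurable_space[OF X' that] by (simp add: space_restrict_space)
  have P: "Psi_e M (X n) (A n) (X' n) (m n) (W n) \<in> PY" if "n \<in> space N" for n
    using Psi_e_prob[OF m_prob X'_in] that by blast
  show "prob_space (Psi_e M (X n) (A n) (X' n) (m n) (W n))" if "n \<in> space N" for n
    using P[OF that] by (rule prob_space_prob_measures)
  show "(\<lambda>n. Psi_e M (X n) (A n) (X' n) (m n) (W n)) \<in> N \<rightarrow>\<^sub>M subprob_algebra YM"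
  proof (rule measurable_subprob_algebra)
    show "subprob_space (Psi_e M (X n) (A n) (X' n) (m n) (W n))" if "n \<in> space N" for n
      using P[OF that] by (intro prob_space_imp_subprob_space prob_space_prob_measures)
    show "sets (Psi_e M (X n) (A n) (X' n) (m n) (W n)) = sets YM" if "n \<in> space N" for n
      using P[OF that] by (rule sets_prob_measures)
    fix B assume B[measurable]: "B \<in> sets YM"
    let ?m = "\<lambda>n. mass (X n) (A n) (m n) (W n) (X' n)"
    have eq: "emeasure (Psi_e M (X n) (A n) (X' n) (m n) (W n)) B =
       (if (X n, A n) \<in> adm M \<and> 0 < ?m n \<and> ?m n < \<infinity>
        then 1 / ?m n * (\<integral>\<^sup>+y'. L (X n) (A n) (m n) (W n) (X' n, y') * indicator B y' \<partial>nu M) else emeasure (m n) B)"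
      if n: "n \<in> space N" for n
    proof (cases "(X n, A n) \<in> adm M")
      case True
      have "emeasure (Psi_e M (X n) (A n) (X' n) (m n) (W n)) B =
          (\<integral>\<^sup>+y. indicator B y \<partial>Psi_e M (X n) (A n) (X' n) (m n) (W n))"
        using B sets_prob_measures[OF P[OF n]] by simp
      then show ?thesis
        using True B sets_prob_measures[OF m_prob[OF n]]
        by (subst (asm) nn_integral_Psi_e[OF True m_prob[OF n] X'_in[OF n]]) auto
    next
      case False
      then show ?thesis by (simp add: Psi_e_def Let_def)
    qed
    interpret sigma_finite_measure "nu M" by (rule sigma_finite_nu)
    have [measurable]: "B \<in> sets (nu M)" by (simp add: sets_nu)
    have [measurable]: "(\<lambda>n. \<integral>\<^sup>+y'. L (X n) (A n) (m n) (W n) (X' n, y') * indicator B y' \<partial>nu M) \<in> borel_measurable N"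
    proof (rule borel_measurable_nn_integral)
      have "(\<lambda>(n, y'). L (X n) (A n) (m n) (W n) (X' n, y')) \<in> borel_measurable (N \<Otimes>\<^sub>M nu M)"
        by (rule measurable_L_nu; fact)
      then show "(\<lambda>(n, y'). L (X n) (A n) (m n) (W n) (X' n, y') * indicator B y') \<in> borel_measurable (N \<Otimes>\<^sub>M nu M)"
        unfolding case_prod_beta by measurable
    qed
    have "(\<lambda>n. (X n, A n)) \<in> N \<rightarrow>\<^sub>M borel \<Otimes>\<^sub>M borel" by measurable
    then have [measurable]: "(\<lambda>n. (X n, A n)) \<in> N \<rightarrow>\<^sub>M borel" by (simp only: borel_prod)
    have [measurable]: "(\<lambda>n. emeasure (m n) B) \<in> borel_measurable N"
      by (rule measurable_compose[OF measurable_prob_algebraD[OF m] measurable_emeasure_subprob_algebra[OF B]])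
    show "(\<lambda>n. emeasure (Psi_e M (X n) (A n) (X' n) (m n) (W n)) B) \<in> borel_measurable N"
      by (subst measurable_cong[OF eq]) measurable
  qed
qed

section \<open>Exponential weights and the total mass of the filter\<close>

lemma c_abs: "\<bar>c s\<bar> \<le> c_max"
  using c_nonneg[of s] c_max(2)[of s] by simp

lemma exp_c_le: "exp (w * c s) \<le> exp (\<bar>w\<bar> * c_max)"
proof -
  have "w * c s \<le> \<bar>w\<bar> * c_max"
    using c_abs[of s] by (metis abs_ge_self abs_ge_zero abs_mult mult_left_mono order_trans)
  then show ?thesis by simp
qed

lemma sigma_finite_lam_nu: "sigma_finite_measure LN"
proof -
  interpret pair_sigma_finite "lam M" "nu M"
    by (simp add: pair_sigma_finite_def sigma_finite_lam sigma_finite_nu)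
  show ?thesis by unfold_locales
qed

lemma measurable_L_pair:
  assumes \<mu>: "\<mu> \<in> PY"
  shows "L x a \<mu> w \<in> borel_measurable LN"
proof -
  have [simp]: "\<mu> \<in> space (prob_algebra YM)" using \<mu> by (simp add: space_prob_algebra_borel_on)
  have "(\<lambda>p. L x a \<mu> w (fst p, snd p)) \<in> borel_measurable LN" by measurable
  then show ?thesis by simp
qed

lemma measurable_mass_lam:
  assumes \<mu>: "\<mu> \<in> PY"
  shows "mass x a \<mu> w \<in> borel_measurable (lam M)"
proof -
  have [simp]: "\<mu> \<in> space (prob_algebra YM)" using \<mu> by (simp add: space_prob_algebra_borel_on)
  show ?thesis by measurable
qed

lemma measurable_prob_c:
  "\<mu> \<in> PY \<Longrightarrow> (\<lambda>y. c (x, y, a)) \<in> borel_measurable \<mu>"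
proof -
  assume "\<mu> \<in> PY"
  then have "(\<lambda>y. y) \<in> \<mu> \<rightarrow>\<^sub>M borel"
    by (simp add: measurable_prob_measures measurable_id_borel_on)
  then show ?thesis by measurable
qed

text \<open>After the kernel is written through its density, Tonelli's theorem moves the integral
  over the current hidden state to the inside, where it becomes \<open>L\<close>.\<close>

lemma nn_integral_exp_kern:
  assumes xa: "(x, a) \<in> adm M" and \<mu>: "\<mu> \<in> PY"
    and F: "F \<in> borel_measurable XYM"
  shows "(\<integral>\<^sup>+y. ennreal (exp (w * c (x, y, a))) * (\<integral>\<^sup>+p. F p \<partial>kern M (x, y, a)) \<partial>\<mu>) =
    (\<integral>\<^sup>+p. L x a \<mu> w p * F p \<partial>LN)"
proof -
  interpret \<mu>: prob_space \<mu> by (rule prob_space_prob_measures[OF \<mu>])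
  interpret N: sigma_finite_measure "LN" by (rule sigma_finite_lam_nu)
  interpret P: pair_sigma_finite \<mu> "LN" ..
  have Fm[measurable]: "F \<in> borel_measurable LN"
    using F by (simp add: measurable_cong_sets[OF sets_lam_nu refl])
  have sm: "sets \<mu> = sets YM" using \<mu> by (rule sets_prob_measures)
  have [measurable]: "fst \<in> \<mu> \<Otimes>\<^sub>M LN \<rightarrow>\<^sub>M borel"
    by (rule measurable_borel_onD[where E="SY M"]) (simp add: measurable_cong_sets[OF refl sm[symmetric]])
  have [measurable]: "(\<lambda>z. fst (snd z)) \<in> \<mu> \<Otimes>\<^sub>M LN \<rightarrow>\<^sub>M borel"
    by (rule measurable_borel_onD[where E="SX M"]) measurable
  have [measurable]: "(\<lambda>z. snd (snd z)) \<in> \<mu> \<Otimes>\<^sub>M LN \<rightarrow>\<^sub>M borel"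
    by (rule measurable_borel_onD[where E="SY M"]) measurable
  have id_\<mu>[measurable]: "(\<lambda>y. y) \<in> \<mu> \<rightarrow>\<^sub>M borel"
    using \<mu> by (simp add: measurable_prob_measures measurable_id_borel_on)
  have qm: "(\<lambda>p. q p s) \<in> borel_measurable LN" for s
  proof -
    have "(\<lambda>p. q (fst p, snd p) (fst s, fst (snd s), snd (snd s))) \<in> borel_measurable LN"
      by measurable
    then show ?thesis by simp
  qed
  have "(\<integral>\<^sup>+y. ennreal (exp (w * c (x, y, a))) * (\<integral>\<^sup>+p. F p \<partial>kern M (x, y, a)) \<partial>\<mu>) =
    (\<integral>\<^sup>+y. \<integral>\<^sup>+p. ennreal (exp (w * c (x, y, a)) * q p (x, y, a)) * F p \<partial>LN \<partial>\<mu>)"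
  proof (rule nn_integral_cong)
    fix y assume "y \<in> space \<mu>"
    then have s: "(x, y, a) \<in> DSY M" using xa by (simp add: DSY_iff space_prob_measures[OF \<mu>])
    show "ennreal (exp (w * c (x, y, a))) * (\<integral>\<^sup>+p. F p \<partial>kern M (x, y, a)) =
      (\<integral>\<^sup>+p. ennreal (exp (w * c (x, y, a)) * q p (x, y, a)) * F p \<partial>LN)"
      unfolding nn_integral_kern[OF s F] using qm[of "(x, y, a)"] Fm
      by (subst nn_integral_cmult[symmetric]) (auto simp: ennreal_mult' mult.assoc q_nonneg)
  qed
  also have "\<dots> = (\<integral>\<^sup>+p. \<integral>\<^sup>+y. ennreal (exp (w * c (x, y, a)) * q p (x, y, a)) * F p \<partial>\<mu> \<partial>LN)"
  proof (rule P.Fubini'[symmetric])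
    have "(\<lambda>z. ennreal (exp (w * c (x, fst z, a)) * q (fst (snd z), snd (snd z)) (x, fst z, a)) * F (snd z))
        \<in> borel_measurable (\<mu> \<Otimes>\<^sub>M LN)"
      by measurable
    then show "(\<lambda>(y, p). ennreal (exp (w * c (x, y, a)) * q p (x, y, a)) * F p)
        \<in> borel_measurable (\<mu> \<Otimes>\<^sub>M LN)"
      by (simp add: case_prod_beta)
  qed
  also have "\<dots> = (\<integral>\<^sup>+p. L x a \<mu> w p * F p \<partial>LN)"
  proof (rule nn_integral_cong)
    fix p
    have "(\<lambda>y. q (fst p, snd p) (x, y, a)) \<in> borel_measurable \<mu>" by measurable
    then show "(\<integral>\<^sup>+y. ennreal (exp (w * c (x, y, a)) * q p (x, y, a)) * F p \<partial>\<mu>) = L x a \<mu> w p * F p"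
      unfolding L_def using measurable_prob_c[OF \<mu>] by (subst nn_integral_multc) auto
  qed
  finally show ?thesis .
qed

text \<open>The kernel is a probability measure, so only the exponential weight survives in the
  total mass. Its boundedness makes the denominators finite almost everywhere, and its continuity
  later supplies the convergence of masses in Scheffe's lemma.\<close>

lemma nn_integral_mass:
  assumes xa: "(x, a) \<in> adm M" and \<mu>: "\<mu> \<in> PY"
  shows "(\<integral>\<^sup>+x'. mass x a \<mu> w x' \<partial>lam M) = (\<integral>\<^sup>+y. ennreal (exp (w * c (x, y, a))) \<partial>\<mu>)"
proof -
  interpret sigma_finite_measure "nu M" by (rule sigma_finite_nu)
  have "(\<integral>\<^sup>+y. ennreal (exp (w * c (x, y, a))) \<partial>\<mu>) =
      (\<integral>\<^sup>+y. ennreal (exp (w * c (x, y, a))) * (\<integral>\<^sup>+p. 1 \<partial>kern M (x, y, a)) \<partial>\<mu>)"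
  proof (rule nn_integral_cong)
    fix y assume "y \<in> space \<mu>"
    then have s: "(x, y, a) \<in> DSY M" using xa by (simp add: DSY_iff space_prob_measures[OF \<mu>])
    show "ennreal (exp (w * c (x, y, a))) = ennreal (exp (w * c (x, y, a))) * (\<integral>\<^sup>+p. 1 \<partial>kern M (x, y, a))"
      using prob_space.emeasure_space_1[OF kern_prob_algebra(1)[OF s]] by simp
  qed
  also have "\<dots> = (\<integral>\<^sup>+p. L x a \<mu> w p \<partial>LN)"
    using nn_integral_exp_kern[OF xa \<mu>, of "\<lambda>_. 1" w] by simp
  also have "\<dots> = (\<integral>\<^sup>+x'. mass x a \<mu> w x' \<partial>lam M)"
    unfolding mass_def by (rule nn_integral_fst[symmetric]) (rule measurable_L_pair[OF \<mu>])
  finally show ?thesis ..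
qed

lemma nn_integral_exp_le:
  assumes \<mu>: "\<mu> \<in> PY"
  shows "(\<integral>\<^sup>+y. ennreal (exp (w * c (x, y, a))) \<partial>\<mu>) \<le> ennreal (exp (\<bar>w\<bar> * c_max))"
proof -
  interpret prob_space \<mu> by (rule prob_space_prob_measures[OF \<mu>])
  show ?thesis by (intro nn_integral_le_const AE_I2 ennreal_leI exp_c_le) simp
qed

lemma mass_finite_AE:
  assumes xa: "(x, a) \<in> adm M" and \<mu>: "\<mu> \<in> PY"
  shows "AE x' in lam M. mass x a \<mu> w x' < \<infinity>"
proof -
  have "(\<integral>\<^sup>+x'. mass x a \<mu> w x' \<partial>lam M) \<noteq> \<infinity>"
    unfolding nn_integral_mass[OF xa \<mu>] using nn_integral_exp_le[OF \<mu>, of w x a]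
    by (auto simp: top_unique)
  from nn_integral_PInf_AE[OF measurable_mass_lam[OF \<mu>] this] show ?thesis
    by eventually_elim (simp add: less_top)
qed

text \<open>The definition of \<open>Qhat_X\<close> integrates over the next hidden state first,
  \<open>mass\<close> over the current one first; Tonelli's theorem exchanges them.\<close>

lemma Qhat_X_eq:
  assumes xa: "(x, a) \<in> adm M" and \<mu>: "\<mu> \<in> PY"
  shows "Qhat_X M x \<mu> a w = density (lam M) (mass x a \<mu> w)"
proof -
  interpret \<mu>: prob_space \<mu> by (rule prob_space_prob_measures[OF \<mu>])
  interpret N: sigma_finite_measure "nu M" by (rule sigma_finite_nu)
  interpret P: pair_sigma_finite \<mu> "nu M" ..
  have sm: "sets \<mu> = sets YM" using \<mu> by (rule sets_prob_measures)
  have [measurable]: "fst \<in> \<mu> \<Otimes>\<^sub>M nu M \<rightarrow>\<^sub>M borel"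
    by (rule measurable_borel_onD[where E="SY M"]) (simp add: measurable_cong_sets[OF refl sm[symmetric]])
  have [measurable]: "snd \<in> \<mu> \<Otimes>\<^sub>M nu M \<rightarrow>\<^sub>M borel"
    by (rule measurable_borel_onD[where E="SY M"]) measurable
  have "(\<integral>\<^sup>+y. ennreal (exp (w * cost M (x, y, a))) * dens_X M x' (x, y, a) \<partial>\<mu>) = mass x a \<mu> w x'"
    if x': "x' \<in> SX M" for x'
  proof -
    have "(\<integral>\<^sup>+y. ennreal (exp (w * cost M (x, y, a))) * dens_X M x' (x, y, a) \<partial>\<mu>) =
      (\<integral>\<^sup>+y. \<integral>\<^sup>+y'. ennreal (exp (w * c (x, y, a)) * q (x', y') (x, y, a)) \<partial>nu M \<partial>\<mu>)"
    proof (rule nn_integral_cong)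
      fix y assume "y \<in> space \<mu>"
      then have y: "y \<in> SY M" by (simp add: space_prob_measures[OF \<mu>])
      have "dens_X M x' (x, y, a) = (\<integral>\<^sup>+y'. ennreal (q (x', y') (x, y, a)) \<partial>nu M)"
        unfolding dens_X_def using xa x' y by (intro nn_integral_cong) (simp add: q_def DSY_iff space_nu)
      then show "ennreal (exp (w * cost M (x, y, a))) * dens_X M x' (x, y, a) =
        (\<integral>\<^sup>+y'. ennreal (exp (w * c (x, y, a)) * q (x', y') (x, y, a)) \<partial>nu M)"
        using xa y by (simp add: c_def DSY_iff ennreal_mult' q_nonneg nn_integral_cmult)
    qed
    also have "\<dots> = (\<integral>\<^sup>+y'. \<integral>\<^sup>+y. ennreal (exp (w * c (x, y, a)) * q (x', y') (x, y, a)) \<partial>\<mu> \<partial>nu M)"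
    proof (rule P.Fubini'[symmetric])
      show "(\<lambda>(y, y'). ennreal (exp (w * c (x, y, a)) * q (x', y') (x, y, a))) \<in> borel_measurable (\<mu> \<Otimes>\<^sub>M nu M)"
        unfolding case_prod_beta by measurable
    qed
    also have "\<dots> = mass x a \<mu> w x'" by (simp add: mass_def L_def)
    finally show ?thesis .
  qed
  then show ?thesis
    unfolding Qhat_X_def
  proof (intro density_cong AE_I2)
    show "(\<lambda>x'. \<integral>\<^sup>+y. ennreal (exp (w * cost M (x, y, a))) * dens_X M x' (x, y, a) \<partial>\<mu>) \<in> borel_measurable (lam M)"
      if "\<And>x'. x' \<in> SX M \<Longrightarrow> (\<integral>\<^sup>+y. ennreal (exp (w * cost M (x, y, a))) * dens_X M x' (x, y, a) \<partial>\<mu>) = mass x a \<mu> w x'"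
      using measurable_mass_lam[OF \<mu>] by (subst measurable_cong[OF that]) (auto simp: space_lam)
  qed (auto simp: space_lam measurable_mass_lam[OF \<mu>])
qed

lemma measurable_nn_integral_Psi_e:
  assumes \<mu>: "\<mu> \<in> PY" and F: "F \<in> borel_measurable XYM"
  shows "(\<lambda>x'. \<integral>\<^sup>+y'. F (x', y') \<partial>Psi_e M x a x' \<mu> w) \<in> borel_measurable XM"
proof -
  have [simp]: "\<mu> \<in> space (prob_algebra YM)" using \<mu> by (simp add: space_prob_algebra_borel_on)
  have "(\<lambda>x'. Psi_e M x a x' \<mu> w) \<in> XM \<rightarrow>\<^sub>M prob_algebra YM" by measurable
  from nn_integral_measurable_subprob_algebra2[OF _ measurable_prob_algebraD[OF this], of "\<lambda>x' y'. F (x', y')"] F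
  show ?thesis by simp
qed

text \<open>Bayes' rule in unnormalised form: \<open>\<Psi>\<^sub>e\<close> disintegrates the exponentially weighted joint law of
  the next state with respect to its observable component.\<close>

theorem filter_identity:
  assumes xa: "(x, a) \<in> adm M" and \<mu>: "\<mu> \<in> PY"
    and F: "F \<in> borel_measurable XYM"
  shows "(\<integral>\<^sup>+y. ennreal (exp (w * c (x, y, a))) * (\<integral>\<^sup>+p. F p \<partial>kern M (x, y, a)) \<partial>\<mu>) =
    (\<integral>\<^sup>+x'. (\<integral>\<^sup>+y'. F (x', y') \<partial>Psi_e M x a x' \<mu> w) \<partial>Qhat_X M x \<mu> a w)"
proof -
  interpret sigma_finite_measure "nu M" by (rule sigma_finite_nu)
  have Fm: "F \<in> borel_measurable LN"
    using F by (simp add: measurable_cong_sets[OF sets_lam_nu refl])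
  have "(\<integral>\<^sup>+x'. (\<integral>\<^sup>+y'. F (x', y') \<partial>Psi_e M x a x' \<mu> w) \<partial>Qhat_X M x \<mu> a w) =
      (\<integral>\<^sup>+x'. mass x a \<mu> w x' * (\<integral>\<^sup>+y'. F (x', y') \<partial>Psi_e M x a x' \<mu> w) \<partial>lam M)"
    unfolding Qhat_X_eq[OF xa \<mu>]
    using measurable_mass_lam[OF \<mu>] measurable_nn_integral_Psi_e[OF \<mu> F]
    by (intro nn_integral_density) (auto simp: measurable_cong_sets[OF sets_lam refl])
  also have "\<dots> = (\<integral>\<^sup>+x'. (\<integral>\<^sup>+y'. L x a \<mu> w (x', y') * F (x', y') \<partial>nu M) \<partial>lam M)"
  proof (rule nn_integral_cong_AE)
    show "AE x' in lam M. mass x a \<mu> w x' * (\<integral>\<^sup>+y'. F (x', y') \<partial>Psi_e M x a x' \<mu> w) =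
        (\<integral>\<^sup>+y'. L x a \<mu> w (x', y') * F (x', y') \<partial>nu M)"
      using mass_finite_AE[OF xa \<mu>, of w] AE_space
    proof eventually_elim
      case (elim x')
      then have x': "x' \<in> SX M" by (simp add: space_lam)
      have Fx: "(\<lambda>y'. F (x', y')) \<in> borel_measurable YM"
        using F x' by (intro measurable_compose[OF _ F]) (simp add: space_restrict_space)
      show ?case
      \<comment> \<open>Where the denominator vanishes, so does \<open>L\<close> for almost every
        \<open>y'\<close>. Both sides are 0 whatever value \<open>Psi_e\<close> takes there.\<close>
      proof (cases "mass x a \<mu> w x' = 0")
        case True
        then have "AE y' in nu M. L x a \<mu> w (x', y') = 0"
          unfolding mass_def using measurable_L_nu_section[OF \<mu>] by (simp add: nn_integral_0_iff_AE)
        then have "(\<integral>\<^sup>+y'. L x a \<mu> w (x', y') * F (x', y') \<partial>nu M) = (\<integral>\<^sup>+y'. 0 \<partial>nu M)"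
          by (intro nn_integral_cong_AE) (auto elim: eventually_mono)
        then show ?thesis using True by simp
      next
        case False
        let ?m = "mass x a \<mu> w x'"
        from False have pos: "0 < ?m \<and> ?m < \<infinity>" using elim(1) by (simp add: zero_less_iff_neq_zero)
        then have "?m * (1 / ?m) = 1" by (auto simp: ennreal_times_divide ennreal_divide_self)
        then show ?thesis
          unfolding nn_integral_Psi_e[OF xa \<mu> x' Fx] if_P[OF pos]
          by (simp only: mult.assoc[symmetric]) simp
      qed
    qed
  qed
  also have "\<dots> = (\<integral>\<^sup>+p. L x a \<mu> w p * F p \<partial>LN)"
    using measurable_L_pair[OF \<mu>] Fm by (subst nn_integral_fst[symmetric]) auto
  finally show ?thesis unfolding nn_integral_exp_kern[OF xa \<mu> F] ..
qed

section \<open>The cost of a policy\<close>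

definition snoc :: "nat \<Rightarrow> (nat \<Rightarrow> 'x) \<times> (nat \<Rightarrow> 'a) \<Rightarrow> 'a \<Rightarrow> 'x \<Rightarrow> (nat \<Rightarrow> 'x) \<times> (nat \<Rightarrow> 'a)" where
  "snoc k h a x' = ((fst h)(Suc k := x'), (snd h)(k := a))"

text \<open>\<open>Ecost \<pi> j k h y w\<close> is the conditional expectation of \<open>exp (w \<Sum>\<^sub>i\<^sub><\<^sub>j \<beta>\<^sup>i c\<^sub>k\<^sub>+\<^sub>i)\<close> given the
  history \<open>h\<close> at stage \<open>k\<close> and the hidden state \<open>y\<close>.\<close>

primrec Ecost :: "('x, 'a) policy \<Rightarrow> nat \<Rightarrow> nat \<Rightarrow> (nat \<Rightarrow> 'x) \<times> (nat \<Rightarrow> 'a) \<Rightarrow> 'y \<Rightarrow> real \<Rightarrow> ennreal" where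
  "Ecost \<pi> 0 k h y w = 1"
| "Ecost \<pi> (Suc j) k h y w = ennreal (exp (w * c (fst h k, y, \<pi> k h))) *
     (\<integral>\<^sup>+p. Ecost \<pi> j (Suc k) (snoc k h (\<pi> k h) (fst p)) (snd p) (\<beta> * w) \<partial>kern M (fst h k, y, \<pi> k h))"

lemma policy_measurable: "\<pi> \<in> policies M \<Longrightarrow> \<pi> n \<in> hist M n \<rightarrow>\<^sub>M AM"
  by (simp add: policies_def)

lemma policy_adm: "\<pi> \<in> policies M \<Longrightarrow> h \<in> space (hist M n) \<Longrightarrow> (fst h n, \<pi> n h) \<in> adm M"
  by (auto simp: policies_def admX_def)

lemma measurable_hist_component: "i \<le> n \<Longrightarrow> (\<lambda>h. fst h i) \<in> hist M n \<rightarrow>\<^sub>M XM"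
  unfolding hist_def by (intro measurable_compose[OF measurable_fst] measurable_component_singleton) simp

lemma hist_component: "h \<in> space (hist M n) \<Longrightarrow> i \<le> n \<Longrightarrow> fst h i \<in> SX M"
  using measurable_space[OF measurable_hist_component, of i n h] by (simp add: space_restrict_space)

lemma measurable_hist_action: "i < n \<Longrightarrow> (\<lambda>h. snd h i) \<in> hist M n \<rightarrow>\<^sub>M AM"
  unfolding hist_def by (intro measurable_compose[OF measurable_snd] measurable_component_singleton) simp

lemma measurable_snoc:
  assumes h: "h \<in> N \<rightarrow>\<^sub>M hist M k" and a: "a \<in> N \<rightarrow>\<^sub>M AM" and x: "x \<in> N \<rightarrow>\<^sub>M XM"
  shows "(\<lambda>n. snoc k (h n) (a n) (x n)) \<in> N \<rightarrow>\<^sub>M hist M (Suc k)"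
  unfolding snoc_def hist_def
proof (intro measurable_Pair)
  show "(\<lambda>n. (fst (h n))(Suc k := x n)) \<in> N \<rightarrow>\<^sub>M PiM {..Suc k} (\<lambda>_. XM)"
    by (rule measurable_fun_upd[where J="{..k}"])
       (use h x in \<open>auto simp: hist_def atMost_Suc intro: measurable_compose[OF _ measurable_fst]\<close>)
  show "(\<lambda>n. (snd (h n))(k := a n)) \<in> N \<rightarrow>\<^sub>M PiM {..<Suc k} (\<lambda>_. AM)"
    by (rule measurable_fun_upd[where J="{..<k}"])
       (use h a in \<open>auto simp: hist_def lessThan_Suc intro: measurable_compose[OF _ measurable_snd]\<close>)
qed

lemma snoc_in_hist:
  assumes "h \<in> space (hist M k)" "a \<in> SA M" "x \<in> SX M"
  shows "snoc k h a x \<in> space (hist M (Suc k))"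
proof -
  have "(\<lambda>_. snoc k h a x) \<in> count_space {()} \<rightarrow>\<^sub>M hist M (Suc k)"
    by (rule measurable_snoc) (use assms in \<open>auto simp: space_restrict_space\<close>)
  from measurable_space[OF this, of "()"] show ?thesis by simp
qed

lemma measurable_DSY:
  assumes x: "x \<in> N \<rightarrow>\<^sub>M borel" and y: "y \<in> N \<rightarrow>\<^sub>M YM" and a: "a \<in> N \<rightarrow>\<^sub>M borel"
    and adm: "\<And>n. n \<in> space N \<Longrightarrow> (x n, a n) \<in> adm M"
  shows "(\<lambda>n. (x n, y n, a n)) \<in> N \<rightarrow>\<^sub>M borel_on (DSY M)"
proof (rule measurable_restrict_space2)
  have "(\<lambda>n. (x n, y n, a n)) \<in> N \<rightarrow>\<^sub>M borel \<Otimes>\<^sub>M borel \<Otimes>\<^sub>M borel"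
    by (intro measurable_Pair x a measurable_borel_onD[OF y])
  then show "(\<lambda>n. (x n, y n, a n)) \<in> N \<rightarrow>\<^sub>M borel" by (simp only: borel_prod)
  show "(\<lambda>n. (x n, y n, a n)) \<in> space N \<rightarrow> DSY M"
    using adm measurable_space[OF y] by (auto simp: DSY_iff space_restrict_space)
qed

lemma measurable_kern_compose:
  assumes "x \<in> N \<rightarrow>\<^sub>M borel" "y \<in> N \<rightarrow>\<^sub>M YM" "a \<in> N \<rightarrow>\<^sub>M borel" "\<And>n. n \<in> space N \<Longrightarrow> (x n, a n) \<in> adm M"
  shows "(\<lambda>n. kern M (x n, y n, a n)) \<in> N \<rightarrow>\<^sub>M prob_algebra XYM"
  by (rule measurable_compose[OF measurable_DSY measurable_kern]) (use assms in auto)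

lemma measurable_Ecost:
  assumes \<pi>: "\<pi> \<in> policies M"
  shows "(\<lambda>(h, y). Ecost \<pi> j k h y w) \<in> borel_measurable (hist M k \<Otimes>\<^sub>M YM)"
proof (induction j arbitrary: k w)
  case 0
  then show ?case by simp
next
  case (Suc j)
  let ?N = "hist M k \<Otimes>\<^sub>M YM"
  have a: "(\<lambda>z. \<pi> k (fst z)) \<in> ?N \<rightarrow>\<^sub>M AM"
    by (rule measurable_compose[OF measurable_fst policy_measurable[OF \<pi>]])
  then have [measurable]: "(\<lambda>z. \<pi> k (fst z)) \<in> ?N \<rightarrow>\<^sub>M borel" by (rule measurable_borel_onD)
  have x: "(\<lambda>z. fst (fst z) k) \<in> ?N \<rightarrow>\<^sub>M XM"
    by (rule measurable_compose[OF measurable_fst measurable_hist_component]) simp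
  then have [measurable]: "(\<lambda>z. fst (fst z) k) \<in> ?N \<rightarrow>\<^sub>M borel" by (rule measurable_borel_onD)
  have [measurable]: "snd \<in> ?N \<rightarrow>\<^sub>M borel"
    by (rule measurable_borel_onD[OF measurable_snd])
  have K: "(\<lambda>z. kern M (fst (fst z) k, snd z, \<pi> k (fst z))) \<in> ?N \<rightarrow>\<^sub>M prob_algebra XYM"
  proof (rule measurable_kern_compose)
    show "(fst (fst z) k, \<pi> k (fst z)) \<in> adm M" if "z \<in> space ?N" for z
      using that by (intro policy_adm[OF \<pi>]) (auto simp: space_pair_measure)
  qed auto
  have [measurable]: "(\<lambda>z. \<integral>\<^sup>+p. Ecost \<pi> j (Suc k) (snoc k (fst z) (\<pi> k (fst z)) (fst p)) (snd p) (\<beta> * w)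
      \<partial>kern M (fst (fst z) k, snd z, \<pi> k (fst z))) \<in> borel_measurable ?N"
  proof (rule nn_integral_measurable_subprob_algebra2[OF _ measurable_prob_algebraD[OF K]])
    have "(\<lambda>zp. (snoc k (fst (fst zp)) (\<pi> k (fst (fst zp))) (fst (snd zp)), snd (snd zp)))
      \<in> ?N \<Otimes>\<^sub>M XYM \<rightarrow>\<^sub>M hist M (Suc k) \<Otimes>\<^sub>M YM"
      by (intro measurable_Pair measurable_snoc measurable_compose[OF measurable_fst a]
            measurable_compose[OF measurable_fst measurable_fst] measurable_compose[OF measurable_snd measurable_fst]
            measurable_compose[OF measurable_snd measurable_snd])
    from measurable_compose[OF this Suc.IH]
    show "(\<lambda>(z, p). Ecost \<pi> j (Suc k) (snoc k (fst z) (\<pi> k (fst z)) (fst p)) (snd p) (\<beta> * w))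
      \<in> borel_measurable (?N \<Otimes>\<^sub>M XYM)"
      by (simp add: case_prod_beta)
  qed
  show ?case unfolding Ecost.simps case_prod_beta by measurable
qed

text \<open>Each stage contributes a factor of at most \<open>exp (\<bar>w\<bar> * c_max)\<close>,
  because discounting by \<open>\<beta> \<le> 1\<close> does not increase the modulus of the
  parameter. The bound is uniform in history and hidden state, so passing from
  \<open>ennreal\<close> to reals loses nothing.\<close>

lemma Ecost_le:
  assumes \<pi>: "\<pi> \<in> policies M" and "h \<in> space (hist M k)" "y \<in> SY M"
  shows "Ecost \<pi> j k h y w \<le> ennreal (exp (real j * \<bar>w\<bar> * c_max))"
  using assms(2,3)
proof (induction j arbitrary: k h y w)
  case (Suc j)
  have adm: "(fst h k, \<pi> k h) \<in> adm M" by (rule policy_adm[OF \<pi> Suc.prems(1)])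
  then have s: "(fst h k, y, \<pi> k h) \<in> DSY M" using Suc.prems by (simp add: DSY_iff)
  interpret K: prob_space "kern M (fst h k, y, \<pi> k h)" by (rule kern_prob_algebra[OF s])
  have sp: "space (kern M (fst h k, y, \<pi> k h)) = SX M \<times> SY M"
    using sets_eq_imp_space_eq[OF kern_prob_algebra(2)[OF s]] by (simp add: space_pair_measure space_restrict_space)
  have "real j * \<bar>\<beta> * w\<bar> * c_max \<le> real j * \<bar>w\<bar> * c_max"
    using disc c_max(1) by (intro mult_right_mono mult_left_mono) (auto simp: abs_mult mult_left_le_one_le)
  then have "Ecost \<pi> j (Suc k) (snoc k h (\<pi> k h) (fst p)) (snd p) (\<beta> * w) \<le> ennreal (exp (real j * \<bar>w\<bar> * c_max))"
    if "p \<in> SX M \<times> SY M" for p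
    using that adm adm_subset Suc.prems(1)
    by (intro order_trans[OF Suc.IH]) (auto intro!: snoc_in_hist ennreal_leI)
  then have "(\<integral>\<^sup>+p. Ecost \<pi> j (Suc k) (snoc k h (\<pi> k h) (fst p)) (snd p) (\<beta> * w) \<partial>kern M (fst h k, y, \<pi> k h))
      \<le> ennreal (exp (real j * \<bar>w\<bar> * c_max))"
    by (intro K.nn_integral_le_const AE_I2) (auto simp: sp)
  then have "Ecost \<pi> (Suc j) k h y w \<le> ennreal (exp (\<bar>w\<bar> * c_max)) * ennreal (exp (real j * \<bar>w\<bar> * c_max))"
    unfolding Ecost.simps by (intro mult_mono ennreal_leI exp_c_le) auto
  also have "\<dots> = ennreal (exp (real (Suc j) * \<bar>w\<bar> * c_max))"
    by (simp add: ennreal_mult[symmetric] exp_add[symmetric] algebra_simps)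
  finally show ?case .
qed simp

section \<open>The trajectory law as an iterated integral\<close>

definition hist_of :: "('x, 'a) policy \<Rightarrow> (nat \<Rightarrow> 'x \<times> 'y) \<Rightarrow> nat \<Rightarrow> (nat \<Rightarrow> 'x) \<times> (nat \<Rightarrow> 'a)" where
  "hist_of \<pi> \<omega> k = (restrict (fst \<circ> \<omega>) {..k}, \<lambda>i. if i < k then action \<pi> (fst \<circ> \<omega>) i else undefined)"

lemma action_hist_of: "action \<pi> (fst \<circ> \<omega>) k = \<pi> k (hist_of \<pi> \<omega> k)"
  unfolding hist_of_def by (rule action.simps)

lemma fst_hist_of: "fst (hist_of \<pi> \<omega> k) k = fst (\<omega> k)"
  by (simp add: hist_of_def)

abbreviation "SM \<equiv> (\<lambda>_::nat. XYM)"

lemma measurable_traj: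
  assumes "k \<in> I"
  shows "(\<lambda>\<omega>. fst (\<omega> k)) \<in> PiM I SM \<rightarrow>\<^sub>M XM" "(\<lambda>\<omega>. snd (\<omega> k)) \<in> PiM I SM \<rightarrow>\<^sub>M YM"
proof -
  have "(\<lambda>\<omega>. \<omega> k) \<in> PiM I SM \<rightarrow>\<^sub>M XYM"
    using assms by (rule measurable_component_singleton)
  then show "(\<lambda>\<omega>. fst (\<omega> k)) \<in> PiM I SM \<rightarrow>\<^sub>M XM" "(\<lambda>\<omega>. snd (\<omega> k)) \<in> PiM I SM \<rightarrow>\<^sub>M YM"
    by (rule measurable_compose[OF _ measurable_fst], rule measurable_compose[OF _ measurable_snd])
qed

lemma measurable_hist_of:
  assumes \<pi>: "\<pi> \<in> policies M" and "{..k} \<subseteq> I"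
  shows "(\<lambda>\<omega>. hist_of \<pi> \<omega> k) \<in> PiM I SM \<rightarrow>\<^sub>M hist M k"
  using assms(2)
proof (induction k rule: less_induct)
  case (less k)
  have "(\<lambda>\<omega>. restrict (fst \<circ> \<omega>) {..k}) \<in> PiM I SM \<rightarrow>\<^sub>M PiM {..k} (\<lambda>_. XM)"
    unfolding comp_def using less.prems
    by (intro measurable_restrict measurable_traj) auto
  moreover have "(\<lambda>\<omega>. restrict (\<lambda>i. \<pi> i (hist_of \<pi> \<omega> i)) {..<k}) \<in> PiM I SM \<rightarrow>\<^sub>M PiM {..<k} (\<lambda>_. AM)"
    using less by (intro measurable_restrict measurable_compose[OF less.IH policy_measurable[OF \<pi>]]) auto
  moreover have "hist_of \<pi> \<omega> k = (restrict (fst \<circ> \<omega>) {..k}, restrict (\<lambda>i. \<pi> i (hist_of \<pi> \<omega> i)) {..<k})" for \<omega>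
    by (subst hist_of_def) (auto simp: fun_eq_iff action_hist_of restrict_def)
  ultimately show ?case unfolding hist_def by (simp only:) (intro measurable_Pair)
qed

text \<open>Actions up to stage \<open>k\<close> see only the states up to \<open>k\<close>, so
  adding a state leaves them unchanged. This matches one kernel of the Ionescu-Tulcea construction
  with one step of the recursion for \<open>Ecost\<close>.\<close>

lemma hist_of_upd:
  "hist_of \<pi> ((\<omega>)(Suc k := z)) (Suc k) = snoc k (hist_of \<pi> \<omega> k) (\<pi> k (hist_of \<pi> \<omega> k)) (fst z)"
proof -
  have "action \<pi> (fst \<circ> ((\<omega>)(Suc k := z))) i = action \<pi> (fst \<circ> \<omega>) i" if "i \<le> k" for i
    by (rule action_cong) (use that in auto)
  then show ?thesis
    unfolding snoc_def action_hist_of[symmetric] by (subst (1 2) hist_of_def) (auto simp: fun_eq_iff restrict_def hist_of_def)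
qed

text \<open>This is \<open>total_cost\<close> with the globally measurable \<open>c\<close>, so that
  it can be handled on finite and on infinite trajectory spaces alike; the two agree on actual
  trajectories by \<open>total_cost_eq\<close>.\<close>

definition acc_cost :: "('x, 'a) policy \<Rightarrow> nat \<Rightarrow> (nat \<Rightarrow> 'x \<times> 'y) \<Rightarrow> real" where
  "acc_cost \<pi> n \<omega> = (\<Sum>k<n. \<beta> ^ k * c (fst (\<omega> k), snd (\<omega> k), \<pi> k (hist_of \<pi> \<omega> k)))"

lemma total_cost_eq:
  assumes \<pi>: "\<pi> \<in> policies M" and \<omega>: "\<omega> \<in> space (PiM I SM)" and "{..<n} \<subseteq> I"
  shows "total_cost M \<pi> n \<omega> = acc_cost \<pi> n \<omega>"
  unfolding total_cost_def acc_cost_def action_hist_of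
proof (rule sum.cong)
  fix k assume "k \<in> {..<n}"
  then have k: "{..k} \<subseteq> I" using assms(3) by auto
  have "hist_of \<pi> \<omega> k \<in> space (hist M k)" using measurable_space[OF measurable_hist_of[OF \<pi> k] \<omega>] .
  from policy_adm[OF \<pi> this] have "(fst (\<omega> k), \<pi> k (hist_of \<pi> \<omega> k)) \<in> adm M" by (simp add: fst_hist_of)
  moreover have "\<omega> k \<in> SX M \<times> SY M"
    using \<omega> k by (auto simp: space_PiM space_pair_measure space_restrict_space dest!: PiE_mem[of _ _ _ k])
  ultimately have "(fst (\<omega> k), snd (\<omega> k), \<pi> k (hist_of \<pi> \<omega> k)) \<in> DSY M" by (auto simp: DSY_iff)
  then show "\<beta> ^ k * cost M (fst (\<omega> k), snd (\<omega> k), \<pi> k (hist_of \<pi> \<omega> k)) =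
    \<beta> ^ k * c (fst (\<omega> k), snd (\<omega> k), \<pi> k (hist_of \<pi> \<omega> k))" by (simp add: c_def)
qed simp

lemma measurable_acc_cost:
  assumes \<pi>: "\<pi> \<in> policies M" and "{..<n} \<subseteq> I"
  shows "acc_cost \<pi> n \<in> borel_measurable (PiM I SM)"
  unfolding acc_cost_def
proof (intro borel_measurable_sum borel_measurable_times borel_measurable_const measurable_c')
  fix k assume "k \<in> {..<n}"
  then have k: "{..k} \<subseteq> I" "k \<in> I" using assms(2) by auto
  show "(\<lambda>\<omega>. fst (\<omega> k)) \<in> borel_measurable (PiM I SM)" "(\<lambda>\<omega>. snd (\<omega> k)) \<in> borel_measurable (PiM I SM)"
    by (rule measurable_borel_onD[OF measurable_traj(1)[OF k(2)]],
        rule measurable_borel_onD[OF measurable_traj(2)[OF k(2)]])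
  show "(\<lambda>\<omega>. \<pi> k (hist_of \<pi> \<omega> k)) \<in> borel_measurable (PiM I SM)"
    by (rule measurable_borel_onD[OF measurable_compose[OF measurable_hist_of[OF \<pi> k(1)] policy_measurable[OF \<pi>]]])
qed

lemma hist_of_cong: "(\<And>i. i \<le> k \<Longrightarrow> \<omega> i = \<omega>' i) \<Longrightarrow> hist_of \<pi> \<omega> k = hist_of \<pi> \<omega>' k"
proof -
  assume *: "\<And>i. i \<le> k \<Longrightarrow> \<omega> i = \<omega>' i"
  then have "action \<pi> (fst \<circ> \<omega>) i = action \<pi> (fst \<circ> \<omega>') i" if "i < k" for i
    using that by (intro action_cong) auto
  then show ?thesis using * by (auto simp: hist_of_def fun_eq_iff restrict_def)
qed

lemma acc_cost_cong: "(\<And>i. i < n \<Longrightarrow> \<omega> i = \<omega>' i) \<Longrightarrow> acc_cost \<pi> n \<omega> = acc_cost \<pi> n \<omega>'"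
  unfolding acc_cost_def by (intro sum.cong refl) (auto intro!: arg_cong2[where f="(*)"] arg_cong[where f=c] hist_of_cong arg_cong[where f="\<pi> _"])

lemma Ionescu_Tulcea_step_kernel:
  assumes \<pi>: "\<pi> \<in> policies M" and x: "x \<in> SX M" and y: "y \<in> SY M"
  shows "Ionescu_Tulcea (step_kernel M \<pi> x y) SM"
proof -
  have *: "step_kernel M \<pi> x y i \<in> PiM {0..<i} SM \<rightarrow>\<^sub>M prob_algebra XYM" for i
  proof (cases i)
    case 0
    have "(x, y) \<in> space XYM" using x y by (simp add: space_pair_measure space_restrict_space)
    then show ?thesis
      unfolding 0 step_kernel_def by (simp add: space_prob_algebra prob_space_return)
  next
    case (Suc k)
    have k: "{..k} \<subseteq> {0..<Suc k}" "k \<in> {0..<Suc k}" by auto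
    have "(\<lambda>\<omega>. kern M (fst (\<omega> k), snd (\<omega> k), \<pi> k (hist_of \<pi> \<omega> k))) \<in> PiM {0..<Suc k} SM \<rightarrow>\<^sub>M prob_algebra XYM"
    proof (rule measurable_kern_compose)
      show "(\<lambda>\<omega>. fst (\<omega> k)) \<in> PiM {0..<Suc k} SM \<rightarrow>\<^sub>M borel"
        by (rule measurable_borel_onD[OF measurable_traj(1)[OF k(2)]])
      show "(\<lambda>\<omega>. snd (\<omega> k)) \<in> PiM {0..<Suc k} SM \<rightarrow>\<^sub>M YM"
        by (rule measurable_traj(2)[OF k(2)])
      show "(\<lambda>\<omega>. \<pi> k (hist_of \<pi> \<omega> k)) \<in> PiM {0..<Suc k} SM \<rightarrow>\<^sub>M borel"
        by (rule measurable_borel_onD[OF measurable_compose[OF measurable_hist_of[OF \<pi> k(1)] policy_measurable[OF \<pi>]]])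
      show "(fst (\<omega> k), \<pi> k (hist_of \<pi> \<omega> k)) \<in> adm M" if "\<omega> \<in> space (PiM {0..<Suc k} SM)" for \<omega>
        using policy_adm[OF \<pi> measurable_space[OF measurable_hist_of[OF \<pi> k(1)] that]] by (simp add: fst_hist_of)
    qed
    then show ?thesis unfolding Suc step_kernel_def by (simp add: action_hist_of)
  qed
  show ?thesis
  proof (rule Ionescu_Tulcea.intro)
    show "step_kernel M \<pi> x y i \<in> PiM {0..<i} SM \<rightarrow>\<^sub>M subprob_algebra XYM" for i
      using * by (rule measurable_prob_algebraD)
    show "prob_space (step_kernel M \<pi> x y i \<omega>)" if "\<omega> \<in> space (PiM {0..<i} SM)" for i \<omega>
      using measurable_space[OF * that] by (simp add: space_prob_algebra)
  qed
qed

definition hist0 :: "'x \<Rightarrow> (nat \<Rightarrow> 'x) \<times> (nat \<Rightarrow> 'a)" where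
  "hist0 x = ((\<lambda>_. undefined)(0 := x), \<lambda>_. undefined)"

lemma hist0_in_hist: "x \<in> SX M \<Longrightarrow> hist0 x \<in> space (hist M 0)"
  by (auto simp: hist0_def hist_def space_pair_measure space_PiM space_restrict_space PiE_def extensional_def)

text \<open>The integrand depends on finitely many coordinates, so the projective limit may be
  replaced by a finite composition of kernels. That composition is split off from the front, in the
  same order as the recursion for \<open>Ecost\<close>.\<close>

theorem nn_integral_law:
  assumes \<pi>: "\<pi> \<in> policies M" and x: "x \<in> SX M" and y: "y \<in> SY M"
  shows "(\<integral>\<^sup>+\<omega>. ennreal (exp (w * total_cost M \<pi> n \<omega>)) \<partial>law M \<pi> x y) = Ecost \<pi> n 0 (hist0 x) y w"
proof -
  interpret IT: Ionescu_Tulcea "step_kernel M \<pi> x y" SM by (rule Ionescu_Tulcea_step_kernel[OF \<pi> x y])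
  let ?f = "\<lambda>n \<omega>. ennreal (exp (w * acc_cost \<pi> n \<omega>))"
  have fm: "?f n \<in> borel_measurable (PiM I SM)" if "{..<n} \<subseteq> I" for n I
    using measurable_acc_cost[OF \<pi> that] by measurable
  \<comment> \<open>The trajectory is known up to index \<open>k\<close>, but only the costs of the
    stages before \<open>k\<close> are charged in \<open>?f k\<close>. The cost of stage
    \<open>k\<close> is the first one inside \<open>Ecost\<close>, and by then the parameter has
    been discounted to \<open>w * \<beta> ^ k\<close>.\<close>
  have main: "(\<integral>\<^sup>+\<omega>'. ?f (k + j) \<omega>' \<partial>IT.C (Suc k) j \<omega>) =
      ?f k \<omega> * Ecost \<pi> j k (hist_of \<pi> \<omega> k) (snd (\<omega> k)) (w * \<beta> ^ k)"
    if "\<omega> \<in> space (PiM {0..<Suc k} SM)" for j k \<omega>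
    using that
  proof (induction j arbitrary: k \<omega>)
    case 0
    have "?f k \<in> borel_measurable (PiM {0..<Suc k} SM)" by (rule fm) auto
    from nn_integral_return[OF 0 this] show ?case by simp
  next
    case (Suc j)
    let ?h = "hist_of \<pi> \<omega> k"
    let ?a = "\<pi> k ?h"
    have K: "step_kernel M \<pi> x y (Suc k) \<omega> = kern M (fst (\<omega> k), snd (\<omega> k), ?a)"
      by (simp add: step_kernel_def action_hist_of)
    have spK: "space (step_kernel M \<pi> x y (Suc k) \<omega>) = SX M \<times> SY M"
      using IT.space_P[OF Suc.prems] by (simp add: space_pair_measure space_restrict_space)
    have upd: "(\<omega>)(Suc k := z) \<in> space (PiM {0..<Suc (Suc k)} SM)" if "z \<in> SX M \<times> SY M" for z
      using that Suc.prems
      by (auto simp: space_PiM PiE_def Pi_iff extensional_def space_pair_measure space_restrict_space less_Suc_eq)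
    have C1: "IT.C (Suc k) 1 \<omega> = IT.eP (Suc k) \<omega>"
      using Suc.prems by (simp add: bind_return[OF IT.measurable_eP])
    have "IT.C (Suc k) (Suc j) \<omega> = IT.C (Suc k) 1 \<omega> \<bind> IT.C (Suc k + 1) j"
      using IT.split_C[OF Suc.prems, of 1 j] by simp
    then have C: "IT.C (Suc k) (Suc j) \<omega> = IT.eP (Suc k) \<omega> \<bind> IT.C (Suc (Suc k)) j"
      unfolding C1 by simp
    have Cm: "IT.C (Suc (Suc k)) j \<in> PiM {0..<Suc (Suc k)} SM \<rightarrow>\<^sub>M subprob_algebra (PiM {0..<Suc (Suc k) + j} SM)"
      by (rule IT.measurable_C)
    have fm': "?f (k + Suc j) \<in> borel_measurable (PiM {0..<Suc (Suc k) + j} SM)"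
      by (rule fm) auto
    have "(\<integral>\<^sup>+\<omega>'. ?f (k + Suc j) \<omega>' \<partial>IT.C (Suc k) (Suc j) \<omega>) =
      (\<integral>\<^sup>+\<omega>1. \<integral>\<^sup>+\<omega>'. ?f (k + Suc j) \<omega>' \<partial>IT.C (Suc (Suc k)) j \<omega>1 \<partial>IT.eP (Suc k) \<omega>)"
      unfolding C
      by (rule nn_integral_bind[OF fm'])
         (simp add: measurable_cong_sets[OF IT.sets_eP[OF Suc.prems] refl] Cm del: add_Suc)
    also have "\<dots> = (\<integral>\<^sup>+z. \<integral>\<^sup>+\<omega>'. ?f (k + Suc j) \<omega>' \<partial>IT.C (Suc (Suc k)) j ((\<omega>)(Suc k := z)) \<partial>step_kernel M \<pi> x y (Suc k) \<omega>)"
      by (rule IT.nn_integral_eP[OF Suc.prems])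
         (rule measurable_compose[OF Cm nn_integral_measurable_subprob_algebra[OF fm']])
    also have "\<dots> = (\<integral>\<^sup>+z. ?f (Suc k) \<omega> *
        Ecost \<pi> j (Suc k) (snoc k ?h ?a (fst z)) (snd z) (\<beta> * (w * \<beta> ^ k))
        \<partial>step_kernel M \<pi> x y (Suc k) \<omega>)"
    proof (rule nn_integral_cong)
      fix z assume "z \<in> space (step_kernel M \<pi> x y (Suc k) \<omega>)"
      then have z: "z \<in> SX M \<times> SY M" by (simp add: spK)
      have 1: "acc_cost \<pi> (Suc k) ((\<omega>)(Suc k := z)) = acc_cost \<pi> (Suc k) \<omega>" by (rule acc_cost_cong) simp
      have 2: "w * \<beta> ^ Suc k = \<beta> * (w * \<beta> ^ k)" by simp
      show "(\<integral>\<^sup>+\<omega>'. ?f (k + Suc j) \<omega>' \<partial>IT.C (Suc (Suc k)) j ((\<omega>)(Suc k := z))) =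
        ?f (Suc k) \<omega> * Ecost \<pi> j (Suc k) (snoc k ?h ?a (fst z)) (snd z) (\<beta> * (w * \<beta> ^ k))"
        using Suc.IH[OF upd[OF z]] unfolding 1 2 hist_of_upd by (simp add: fun_upd_def)
    qed
    also have "\<dots> = ?f (Suc k) \<omega> * (\<integral>\<^sup>+z.
        Ecost \<pi> j (Suc k) (snoc k ?h ?a (fst z)) (snd z) (\<beta> * (w * \<beta> ^ k))
        \<partial>step_kernel M \<pi> x y (Suc k) \<omega>)"
    proof (rule nn_integral_cmult)
      have k: "{..k} \<subseteq> {0..<Suc k}" by auto
      have h: "?h \<in> space (hist M k)" by (rule measurable_space[OF measurable_hist_of[OF \<pi> k] Suc.prems])
      have a: "?a \<in> SA M" using policy_adm[OF \<pi> h] adm_subset by auto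
      have "(\<lambda>z. (snoc k ?h ?a (fst z), snd z)) \<in> XYM \<rightarrow>\<^sub>M hist M (Suc k) \<Otimes>\<^sub>M YM"
        using h a by (intro measurable_Pair measurable_snoc) (auto simp: space_restrict_space)
      from measurable_compose[OF this measurable_Ecost[OF \<pi>]]
      show "(\<lambda>z. Ecost \<pi> j (Suc k) (snoc k ?h ?a (fst z)) (snd z) (\<beta> * (w * \<beta> ^ k)))
        \<in> borel_measurable (step_kernel M \<pi> x y (Suc k) \<omega>)"
        by (simp add: measurable_cong_sets[OF IT.sets_P[OF Suc.prems] refl])
    qed
    also have "?f (Suc k) \<omega> = ?f k \<omega> * ennreal (exp (w * \<beta> ^ k * c (fst (\<omega> k), snd (\<omega> k), ?a)))"
      by (simp add: acc_cost_def ennreal_mult[symmetric] exp_add[symmetric] algebra_simps)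
    finally show ?case unfolding Ecost.simps K fst_hist_of by (simp add: mult.assoc)
  qed
  let ?\<omega>0 = "\<lambda>_::nat. undefined :: 'x \<times> 'y"
  \<comment> \<open>One coordinate more than the cost uses: kernel 0 draws the initial state, and
    \<open>n\<close> further kernels match the \<open>n\<close> steps of
    \<open>Ecost\<close>.\<close>
  let ?J = "{0..<Suc n}"
  have \<omega>0: "?\<omega>0 \<in> space (PiM {0..<0} SM)" by (simp add: space_PiM)
  have xy: "(x, y) \<in> space XYM" using x y by (simp add: space_pair_measure space_restrict_space)
  have upJ: "IT.up_to ?J = Suc n"
    by (rule antisym) (auto simp: IT.up_to_iff_Ico intro!: Suc_leI IT.up_to_less)
  have law: "law M \<pi> x y = IT.PF.lim" by (simp add: law_def Let_def)
  have "(\<integral>\<^sup>+\<omega>. ennreal (exp (w * total_cost M \<pi> n \<omega>)) \<partial>law M \<pi> x y) =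
      (\<integral>\<^sup>+\<omega>. ?f n (restrict \<omega> ?J) \<partial>IT.PF.lim)"
    unfolding law
  proof (rule nn_integral_cong)
    fix \<omega> assume "\<omega> \<in> space IT.PF.lim"
    then have "\<omega> \<in> space (PiM UNIV SM)" by simp
    then have "total_cost M \<pi> n \<omega> = acc_cost \<pi> n \<omega>" by (rule total_cost_eq[OF \<pi>]) simp
    also have "\<dots> = acc_cost \<pi> n (restrict \<omega> ?J)" by (rule acc_cost_cong) simp
    finally show "ennreal (exp (w * total_cost M \<pi> n \<omega>)) = ?f n (restrict \<omega> ?J)" by simp
  qed
  also have "\<dots> = (\<integral>\<^sup>+\<omega>. ?f n \<omega> \<partial>distr IT.PF.lim (PiM ?J SM) (\<lambda>\<omega>. restrict \<omega> ?J))"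
  proof (rule nn_integral_distr[symmetric])
    show "(\<lambda>\<omega>. restrict \<omega> ?J) \<in> IT.PF.lim \<rightarrow>\<^sub>M PiM ?J SM"
      by (subst measurable_cong_sets[OF IT.PF.sets_lim refl]) (rule measurable_restrict_subset, simp)
    show "?f n \<in> borel_measurable (distr IT.PF.lim (PiM ?J SM) (\<lambda>\<omega>. restrict \<omega> ?J))"
      unfolding measurable_distr_eq1 by (rule fm) auto
  qed
  also have "distr IT.PF.lim (PiM ?J SM) (\<lambda>\<omega>. restrict \<omega> ?J) = IT.CI ?J"
    by (rule IT.distr_lim) simp
  also have "(\<integral>\<^sup>+\<omega>. ?f n \<omega> \<partial>IT.CI ?J) = (\<integral>\<^sup>+\<omega>. ?f n (restrict \<omega> ?J) \<partial>IT.C 0 (Suc n) ?\<omega>0)"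
    unfolding IT.CI_def upJ
  proof (rule nn_integral_distr)
    show "(\<lambda>\<omega>. restrict \<omega> ?J) \<in> IT.C 0 (Suc n) ?\<omega>0 \<rightarrow>\<^sub>M PiM ?J SM"
      by (subst measurable_cong_sets[OF IT.sets_C[OF \<omega>0] refl]) (rule measurable_restrict_subset, simp)
    show "?f n \<in> borel_measurable (distr (IT.C 0 (Suc n) ?\<omega>0) (PiM ?J SM) (\<lambda>\<omega>. restrict \<omega> ?J))"
      unfolding measurable_distr_eq1 by (rule fm) auto
  qed
  also have "\<dots> = (\<integral>\<^sup>+\<omega>. ?f n \<omega> \<partial>IT.C 0 (Suc n) ?\<omega>0)"
    by (intro nn_integral_cong arg_cong[where f="\<lambda>t. ennreal (exp (w * t))"] acc_cost_cong) simp
  also have "IT.C 0 (Suc n) ?\<omega>0 = IT.eP 0 ?\<omega>0 \<bind> IT.C 1 n"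
  proof -
    have "IT.C 0 1 ?\<omega>0 = IT.eP 0 ?\<omega>0"
      by (simp only: One_nat_def IT.C.simps add_0_right bind_return[OF IT.measurable_eP \<omega>0])
    then show ?thesis using IT.split_C[OF \<omega>0, of 1 n] by (simp only: add_0 plus_1_eq_Suc)
  qed
  also have "(\<integral>\<^sup>+\<omega>. ?f n \<omega> \<partial>(IT.eP 0 ?\<omega>0 \<bind> IT.C 1 n)) = (\<integral>\<^sup>+\<omega>1. \<integral>\<^sup>+\<omega>. ?f n \<omega> \<partial>IT.C 1 n \<omega>1 \<partial>IT.eP 0 ?\<omega>0)"
    by (rule nn_integral_bind[of _ "PiM {0..<1 + n} SM"])
       (rule fm, force, subst measurable_cong_sets[OF IT.sets_eP[OF \<omega>0] refl], use IT.measurable_C[of 1 n] in simp)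
  also have "\<dots> = (\<integral>\<^sup>+z. \<integral>\<^sup>+\<omega>. ?f n \<omega> \<partial>IT.C 1 n (?\<omega>0(0 := z)) \<partial>step_kernel M \<pi> x y 0 ?\<omega>0)"
  proof (rule IT.nn_integral_eP[OF \<omega>0])
    have "?f n \<in> borel_measurable (PiM {0..<1 + n} SM)" by (rule fm) auto
    from measurable_compose[OF IT.measurable_C nn_integral_measurable_subprob_algebra[OF this]]
    show "(\<lambda>\<omega>1. \<integral>\<^sup>+\<omega>. ?f n \<omega> \<partial>IT.C 1 n \<omega>1) \<in> borel_measurable (PiM {0..<Suc 0} SM)" by simp
  qed
  also have "\<dots> = (\<integral>\<^sup>+z. Ecost \<pi> n 0 (hist0 (fst z)) (snd z) w \<partial>return XYM (x, y))"
  proof (simp only: step_kernel_def nat.case, rule nn_integral_cong)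
    fix z assume "z \<in> space (return XYM (x, y))"
    then have "?\<omega>0(0 := z) \<in> space (PiM {0..<Suc 0} SM)" by (auto simp: space_PiM PiE_def extensional_def)
    moreover have "hist_of \<pi> (?\<omega>0(0 := z)) 0 = hist0 (fst z)"
      by (auto simp: hist_of_def hist0_def fun_eq_iff restrict_def)
    ultimately show "(\<integral>\<^sup>+\<omega>. ?f n \<omega> \<partial>IT.C 1 n (?\<omega>0(0 := z))) = Ecost \<pi> n 0 (hist0 (fst z)) (snd z) w"
      using main[of "?\<omega>0(0 := z)" 0 n] by (simp add: acc_cost_def)
  qed
  also have "\<dots> = Ecost \<pi> n 0 (hist0 x) y w"
  proof -
    have "(\<lambda>z. (hist0 (fst z), snd z)) \<in> XYM \<rightarrow>\<^sub>M hist M 0 \<Otimes>\<^sub>M YM"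
      unfolding hist0_def hist_def
      by (intro measurable_Pair measurable_snd measurable_fun_upd[where J="{}"] measurable_fst) (auto simp: space_PiM)
    from measurable_compose[OF this measurable_Ecost[OF \<pi>]] show ?thesis
      by (subst nn_integral_return[OF xy]) auto
  qed
  finally show ?thesis .
qed

section \<open>Lower semicontinuity of the one-step operator\<close>

definition q_max :: real where
  "q_max = (SOME b. 0 \<le> b \<and> (\<forall>p\<in>SX M \<times> SY M. \<forall>s\<in>DSY M. dens M p s \<le> b))"

lemma q_max: "0 \<le> q_max" "q p s \<le> q_max"
proof -
  have "bounded ((\<lambda>(p, s). dens M p s) ` ((SX M \<times> SY M) \<times> DSY M))"
    using standing unfolding standing_assumptions_def by blast
  then obtain b where b: "\<And>p s. p \<in> SX M \<times> SY M \<Longrightarrow> s \<in> DSY M \<Longrightarrow> \<bar>dens M p s\<bar> \<le> b"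
    unfolding bounded_iff by (metis (no_types, lifting) SigmaI case_prod_conv imageI real_norm_def)
  have "\<exists>b. 0 \<le> b \<and> (\<forall>p\<in>SX M \<times> SY M. \<forall>s\<in>DSY M. dens M p s \<le> b)"
    by (rule exI[of _ "max 0 b"]) (use b in \<open>force simp: le_max_iff_disj abs_le_iff\<close>)
  from someI_ex[OF this] show "0 \<le> q_max" "q p s \<le> q_max"
    unfolding q_max_def[symmetric] by (auto simp: q_def)
qed

text \<open>The real version of \<open>L\<close>, for which differences and L1 distances make
  sense.\<close>

definition Lr :: "'x \<Rightarrow> 'a \<Rightarrow> 'y measure \<Rightarrow> real \<Rightarrow> 'x \<times> 'y \<Rightarrow> real" where
  "Lr x a \<mu> w p = (\<integral>y. exp (w * c (x, y, a)) * q p (x, y, a) \<partial>\<mu>)"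

lemma exp_q_bounds: "0 \<le> exp (w * c s) * q p s" "exp (w * c s) * q p s \<le> exp (\<bar>w\<bar> * c_max) * q_max"
  by (auto intro!: mult_mono exp_c_le q_max q_nonneg mult_nonneg_nonneg simp del: zero_le_mult_iff)

lemma measurable_exp_q:
  "(\<lambda>y. exp (w * c (x, y, a)) * q p (x, y, a)) \<in> borel_measurable YM"
proof -
  have "(\<lambda>y. q (fst p, snd p) (x, y, a)) \<in> borel_measurable YM" "(\<lambda>y. c (x, y, a)) \<in> borel_measurable YM" by measurable
  then show ?thesis by simp
qed

lemma integrable_exp_q:
  assumes "\<mu> \<in> PY"
  shows "integrable \<mu> (\<lambda>y. exp (w * c (x, y, a)) * q p (x, y, a))"
  by (rule integrable_prob_measures_bounded[OF assms measurable_exp_q, where B="exp (\<bar>w\<bar> * c_max) * q_max"])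
     (use exp_q_bounds in simp)

lemma Lr_nonneg: "0 \<le> Lr x a \<mu> w p"
  unfolding Lr_def by (rule integral_nonneg_AE) (simp add: exp_q_bounds)

lemma L_eq_Lr: "\<mu> \<in> PY \<Longrightarrow> L x a \<mu> w p = ennreal (Lr x a \<mu> w p)"
  unfolding L_def Lr_def by (rule nn_integral_eq_integral[OF integrable_exp_q]) (auto simp: exp_q_bounds)

definition params_conv ::
    "(nat \<Rightarrow> 'x) \<Rightarrow> 'x \<Rightarrow> (nat \<Rightarrow> 'a) \<Rightarrow> 'a \<Rightarrow> (nat \<Rightarrow> 'y measure) \<Rightarrow> 'y measure \<Rightarrow> (nat \<Rightarrow> real) \<Rightarrow> real \<Rightarrow> bool" where
  "params_conv xs x as a \<mu>s \<mu> ws w \<longleftrightarrow> (\<forall>n. (xs n, as n) \<in> adm M) \<and> (x, a) \<in> adm M \<and>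
     (\<forall>n. \<mu>s n \<in> PY) \<and> \<mu> \<in> PY \<and>
     xs \<longlonglongrightarrow> x \<and> as \<longlonglongrightarrow> a \<and> ws \<longlonglongrightarrow> w \<and> wconv \<mu>s \<mu>"

lemma params_convD:
  assumes "params_conv xs x as a \<mu>s \<mu> ws w"
  shows "(xs n, as n) \<in> adm M" "(x, a) \<in> adm M" "\<mu>s n \<in> PY" "\<mu> \<in> PY"
    "xs \<longlonglongrightarrow> x" "as \<longlonglongrightarrow> a" "ws \<longlonglongrightarrow> w" "wconv \<mu>s \<mu>"
  using assms by (auto simp: params_conv_def)

text \<open>State, action and parameter move together with the measure, so the integrand depends on
  \<open>n\<close>. Continuity on \<open>DSY M\<close> makes it continuously convergent in the
  hidden variable, which is exactly the hypothesis of \<open>integral_wconv\<close>.\<close>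

lemma tendsto_weighted:
  assumes conv: "params_conv xs x as a \<mu>s \<mu> ws w"
    and G: "continuous_on (DSY M) G" "\<And>s. 0 \<le> G s" "\<And>s. G s \<le> K"
      "\<And>x a. (\<lambda>y. G (x, y, a)) \<in> borel_measurable YM"
  shows "(\<lambda>n. \<integral>y. exp (ws n * c (xs n, y, as n)) * G (xs n, y, as n) \<partial>\<mu>s n)
     \<longlonglongrightarrow> (\<integral>y. exp (w * c (x, y, a)) * G (x, y, a) \<partial>\<mu>)"
proof -
  note adm = params_convD(1,2)[OF conv] and \<mu> = params_convD(3,4)[OF conv] and lim = params_convD(5-8)[OF conv]
  \<comment> \<open>Convergent parameters are bounded, which gives a bound on the exponentials
    uniform in \<open>n\<close>.\<close>
  obtain W where W: "\<And>n. \<bar>ws n\<bar> \<le> W"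
    using convergent_imp_Bseq[of ws] lim(3) by (auto simp: convergent_def Bseq_def)
  show ?thesis
  proof (rule integral_wconv[OF \<mu> lim(4)])
    show "(\<lambda>y. exp (ws n * c (xs n, y, as n)) * G (xs n, y, as n)) \<in> borel_measurable YM" for n
    proof -
      note G(4)[measurable]
      show ?thesis by measurable
    qed
    show "\<bar>exp (ws n * c (xs n, y, as n)) * G (xs n, y, as n)\<bar> \<le> exp (W * c_max) * K" for n y
    proof -
      have "exp (ws n * c (xs n, y, as n)) \<le> exp (\<bar>ws n\<bar> * c_max)" by (rule exp_c_le)
      also have "\<dots> \<le> exp (W * c_max)" using W[of n] c_max(1) by (simp add: mult_right_mono)
      finally show ?thesis
        using G(2,3)[of "(xs n, y, as n)"] by (simp add: abs_mult) (intro mult_mono, auto)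
    qed
    fix y assume y: "y \<in> SY M"
    let ?F = "joint_at y (SY M)"
    have fst: "filterlim fst sequentially ?F" by (rule filterlim_fst)
    have "filterlim snd (inf (nhds y) (principal (SY M))) ?F" by (rule filterlim_snd)
    then have snd: "(snd \<longlongrightarrow> y) ?F" and in_SY: "\<forall>\<^sub>F z in ?F. snd z \<in> SY M"
      unfolding filterlim_inf filterlim_principal by auto
    define g where "g z = (xs (fst z), snd z, as (fst z))" for z :: "nat \<times> 'y"
    have g: "(g \<longlongrightarrow> (x, y, a)) ?F" unfolding g_def
      by (intro tendsto_Pair snd filterlim_compose[OF lim(1) fst] filterlim_compose[OF lim(2) fst])
    have ev: "\<forall>\<^sub>F z in ?F. g z \<in> DSY M"
      using in_SY by eventually_elim (simp add: g_def DSY_iff adm)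
    have s: "(x, y, a) \<in> DSY M" using y adm by (simp add: DSY_iff)
    have cc: "continuous_on (DSY M) c"
    proof -
      have "continuous_on (DSY M) (cost M)" using standing unfolding standing_assumptions_def by blast
      then show ?thesis by (rule continuous_on_eq) (simp add: c_def)
    qed
    have "((\<lambda>z. exp (ws (fst z) * c (g z)) * G (g z)) \<longlongrightarrow> exp (w * c (x, y, a)) * G (x, y, a)) ?F"
      by (intro tendsto_intros filterlim_compose[OF lim(3) fst] continuous_on_tendsto_compose[OF cc g s ev]
            continuous_on_tendsto_compose[OF G(1) g s ev])
    then show "((\<lambda>(n, z). exp (ws n * c (xs n, z, as n)) * G (xs n, z, as n)) \<longlongrightarrow> exp (w * c (x, y, a)) * G (x, y, a)) ?F"
      by (simp add: g_def case_prod_beta')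
  qed
qed

lemma tendsto_Lr:
  assumes conv: "params_conv xs x as a \<mu>s \<mu> ws w"
    and p: "p \<in> SX M \<times> SY M"
  shows "(\<lambda>n. Lr (xs n) (as n) (\<mu>s n) (ws n) p) \<longlonglongrightarrow> Lr x a \<mu> w p"
  unfolding Lr_def
proof (rule tendsto_weighted[OF conv, where K=q_max])
  have "continuous_on ((SX M \<times> SY M) \<times> DSY M) (\<lambda>(p, s). dens M p s)"
    using standing unfolding standing_assumptions_def by blast
  then have "continuous_on (DSY M) (\<lambda>s. (\<lambda>(p, s). dens M p s) (p, s))"
    by (rule continuous_on_compose2) (use p in \<open>auto intro!: continuous_intros\<close>)
  then show "continuous_on (DSY M) (q p)"
    by (rule continuous_on_eq) (use p in \<open>simp add: q_def\<close>)
  show "(\<lambda>y. q p (x, y, a)) \<in> borel_measurable YM" for x a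
    using measurable_exp_q[of 0 x a p] by simp
qed (auto simp: q_nonneg q_max)

text \<open>For admissible \<open>(x, a)\<close> this is also the total mass of \<open>L\<close> and
  of \<open>Qhat_X\<close>.\<close>

definition tot :: "'x \<Rightarrow> 'a \<Rightarrow> 'y measure \<Rightarrow> real \<Rightarrow> real" where
  "tot x a \<mu> w = (\<integral>y. exp (w * c (x, y, a)) \<partial>\<mu>)"

lemma tendsto_tot:
  assumes conv: "params_conv xs x as a \<mu>s \<mu> ws w"
  shows "(\<lambda>n. tot (xs n) (as n) (\<mu>s n) (ws n)) \<longlonglongrightarrow> tot x a \<mu> w"
  using tendsto_weighted[OF conv, of "\<lambda>_. 1" 1] by (simp add: tot_def)

lemma measurable_exp_c:
  "(\<lambda>y. exp (w * c (x, y, a))) \<in> borel_measurable YM"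
  by measurable

lemma nn_integral_exp_eq_tot:
  assumes "\<mu> \<in> PY"
  shows "(\<integral>\<^sup>+y. ennreal (exp (w * c (x, y, a))) \<partial>\<mu>) = ennreal (tot x a \<mu> w)"
  unfolding tot_def
  by (rule nn_integral_eq_integral[OF integrable_prob_measures_bounded[OF assms measurable_exp_c, where B="exp (\<bar>w\<bar> * c_max)"]])
     (auto simp: exp_c_le[unfolded exp_le_cancel_iff])

lemma tot_bounds:
  assumes "\<mu> \<in> PY"
  shows "0 \<le> tot x a \<mu> w" "tot x a \<mu> w \<le> exp (\<bar>w\<bar> * c_max)"
proof -
  show "0 \<le> tot x a \<mu> w" unfolding tot_def by (rule integral_nonneg_AE) simp
  then show "tot x a \<mu> w \<le> exp (\<bar>w\<bar> * c_max)"
    using nn_integral_exp_le[OF assms, of w x a] unfolding nn_integral_exp_eq_tot[OF assms] by simp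
qed

lemma nn_integral_L:
  assumes "(x, a) \<in> adm M" "\<mu> \<in> PY"
  shows "(\<integral>\<^sup>+p. L x a \<mu> w p \<partial>LN) = ennreal (tot x a \<mu> w)"
proof -
  interpret sigma_finite_measure "nu M" by (rule sigma_finite_nu)
  show ?thesis
    unfolding nn_integral_exp_eq_tot[OF assms(2), symmetric] nn_integral_mass[OF assms, symmetric] mass_def
    by (rule nn_integral_fst[symmetric, OF measurable_L_pair[OF assms(2)]])
qed

lemma measurable_Lr:
  assumes "\<mu> \<in> PY"
  shows "Lr x a \<mu> w \<in> borel_measurable LN"
proof -
  have "(\<lambda>p. enn2real (L x a \<mu> w p)) \<in> borel_measurable LN"
    using measurable_L_pair[OF assms, of x a w] by measurable
  then show ?thesis by (simp add: L_eq_Lr[OF assms] Lr_nonneg)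
qed

text \<open>Scheffe's lemma: pointwise convergence of the unnormalised filter densities together with
  convergence of their total masses gives convergence in \<open>L\<^sup>1\<close>.\<close>

lemma tendsto_L1_Lr:
  assumes conv: "params_conv xs x as a \<mu>s \<mu> ws w"
  shows "(\<lambda>n. \<integral>\<^sup>+p. ennreal \<bar>Lr (xs n) (as n) (\<mu>s n) (ws n) p - Lr x a \<mu> w p\<bar> \<partial>LN) \<longlonglongrightarrow> 0"
proof -
  note adm = params_convD(1,2)[OF conv] and \<mu> = params_convD(3,4)[OF conv] and lim = params_convD(5-8)[OF conv]
  have norm: "(\<integral>\<^sup>+p. ennreal (norm (Lr x a \<mu> w p)) \<partial>LN) = ennreal (tot x a \<mu> w)"
    if "(x, a) \<in> adm M" "\<mu> \<in> PY" for x a \<mu> w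
    using nn_integral_L[OF that] by (simp add: L_eq_Lr[OF that(2)] Lr_nonneg)
  have int: "integrable LN (Lr x a \<mu> w)"
    if "(x, a) \<in> adm M" "\<mu> \<in> PY" for x a \<mu> w
    using norm[OF that] measurable_Lr[OF that(2)] by (simp add: integrable_iff_bounded)
  have "(\<lambda>n. ennreal (tot (xs n) (as n) (\<mu>s n) (ws n))) \<longlonglongrightarrow> ennreal (tot x a \<mu> w)"
    by (rule tendsto_ennrealI[OF tendsto_tot[OF conv]])
  from lim_imp_Limsup[OF _ this]
  have "limsup (\<lambda>n. \<integral>\<^sup>+p. ennreal (norm (Lr (xs n) (as n) (\<mu>s n) (ws n) p)) \<partial>LN)
      \<le> (\<integral>\<^sup>+p. ennreal (norm (Lr x a \<mu> w p)) \<partial>LN)"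
    unfolding norm[OF adm(1) \<mu>(1)] norm[OF adm(2) \<mu>(2)] by simp
  moreover have "AE p in LN. (\<lambda>n. Lr (xs n) (as n) (\<mu>s n) (ws n) p) \<longlonglongrightarrow> Lr x a \<mu> w p"
    by (rule AE_I2) (simp add: space_lam_nu tendsto_Lr[OF conv])
  ultimately show ?thesis
    using Scheffe_lemma1[OF int[OF adm(1) \<mu>(1)] int[OF adm(2) \<mu>(2)]] by simp
qed

text \<open>By Tonelli's theorem, L1 convergence in \<open>(x', y')\<close> says that the L1
  distances of the sections at \<open>x'\<close> tend to 0 in L1 with respect to
  \<open>lam M\<close>; a subsequence of these distances tends to 0 almost everywhere.\<close>

lemma tendsto_AE_Lr_subseq:
  assumes conv: "params_conv xs x as a \<mu>s \<mu> ws w"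
  shows "\<exists>r. strict_mono r \<and> (AE x' in lam M. (\<lambda>n. \<integral>\<^sup>+y'. ennreal \<bar>Lr (xs (r n)) (as (r n)) (\<mu>s (r n)) (ws (r n)) (x', y')
      - Lr x a \<mu> w (x', y')\<bar> \<partial>nu M) \<longlonglongrightarrow> 0)"
proof -
  note adm = params_convD(1,2)[OF conv] and \<mu> = params_convD(3,4)[OF conv] and lim = params_convD(5-8)[OF conv]
  interpret N: sigma_finite_measure "nu M" by (rule sigma_finite_nu)
  define D where "D n x' = (\<integral>\<^sup>+y'. ennreal \<bar>Lr (xs n) (as n) (\<mu>s n) (ws n) (x', y') - Lr x a \<mu> w (x', y')\<bar> \<partial>nu M)" for n x'
  have m: "(\<lambda>p. ennreal \<bar>Lr (xs n) (as n) (\<mu>s n) (ws n) p - Lr x a \<mu> w p\<bar>) \<in> borel_measurable LN" for n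
    using measurable_Lr[OF \<mu>(1)] measurable_Lr[OF \<mu>(2)] by measurable
  have Dm[measurable]: "D n \<in> borel_measurable (lam M)" for n
    unfolding D_def using N.borel_measurable_nn_integral_fst[OF m[of n]] by simp
  have ID: "(\<integral>\<^sup>+x'. D n x' \<partial>lam M) =
     (\<integral>\<^sup>+p. ennreal \<bar>Lr (xs n) (as n) (\<mu>s n) (ws n) p - Lr x a \<mu> w p\<bar> \<partial>LN)" for n
    unfolding D_def by (rule N.nn_integral_fst[OF m])
  have D0: "(\<lambda>n. \<integral>\<^sup>+x'. D n x' \<partial>lam M) \<longlonglongrightarrow> 0"
    unfolding ID by (rule tendsto_L1_Lr[OF conv])
  have fin: "(\<integral>\<^sup>+x'. D n x' \<partial>lam M) < \<infinity>" for n
  proof -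
    have "(\<integral>\<^sup>+x'. D n x' \<partial>lam M) \<le> (\<integral>\<^sup>+p. L (xs n) (as n) (\<mu>s n) (ws n) p + L x a \<mu> w p \<partial>LN)"
      unfolding ID L_eq_Lr[OF \<mu>(1)] L_eq_Lr[OF \<mu>(2)]
      by (intro nn_integral_mono) (simp add: ennreal_plus[symmetric] Lr_nonneg abs_diff_le_iff del: ennreal_plus)
    also have "\<dots> = ennreal (tot (xs n) (as n) (\<mu>s n) (ws n)) + ennreal (tot x a \<mu> w)"
      by (simp add: nn_integral_add measurable_L_pair \<mu> nn_integral_L adm)
    also have "\<dots> < \<infinity>" by simp
    finally show ?thesis .
  qed
  \<comment> \<open>The extraction of a subsequence is made for real functions; almost everywhere
    finiteness lets it be carried back to the extended distances \<open>D n\<close>.\<close>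
  have AEfin: "AE x' in lam M. D n x' \<noteq> \<infinity>" for n
    by (rule nn_integral_PInf_AE[OF Dm]) (use fin[of n] in auto)
  have eq: "(\<integral>\<^sup>+x'. ennreal (norm (enn2real (D n x'))) \<partial>lam M) = (\<integral>\<^sup>+x'. D n x' \<partial>lam M)" for n
    by (rule nn_integral_cong_AE) (use AEfin[of n] in eventually_elim, simp add: less_top)
  have int: "integrable (lam M) (\<lambda>x'. enn2real (D n x'))" for n
    using fin[of n] unfolding eq[symmetric] by (intro integrableI_bounded) auto
  have "(\<lambda>n. \<integral>x'. norm (enn2real (D n x')) \<partial>lam M) \<longlonglongrightarrow> 0"
  proof -
    have "(\<integral>x'. norm (enn2real (D n x')) \<partial>lam M) = enn2real (\<integral>\<^sup>+x'. D n x' \<partial>lam M)" for n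
      unfolding eq[symmetric] by (rule integral_eq_nn_integral) auto
    moreover have "(\<lambda>n. enn2real (\<integral>\<^sup>+x'. D n x' \<partial>lam M)) \<longlonglongrightarrow> 0"
      by (rule tendsto_enn2real) (use D0 in simp_all)
    ultimately show ?thesis by simp
  qed
  from tendsto_L1_AE_subseq[OF int this]
  obtain r where r: "strict_mono r" "AE x' in lam M. (\<lambda>n. enn2real (D (r n) x')) \<longlonglongrightarrow> 0" by blast
  have "AE x' in lam M. \<forall>n. D n x' \<noteq> \<infinity>" using AEfin by (simp add: AE_all_countable)
  with r(2) have "AE x' in lam M. (\<lambda>n. D (r n) x') \<longlonglongrightarrow> 0"
  proof eventually_elim
    case (elim x')
    have "(\<lambda>n. ennreal (enn2real (D (r n) x'))) \<longlonglongrightarrow> ennreal 0"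
      by (rule tendsto_ennrealI[OF elim(1)])
    then show ?case using elim(2) by (simp add: less_top)
  qed
  then show ?thesis using r(1) unfolding D_def by blast
qed

section \<open>Convergence of the posteriors at a fixed next observation\<close>

lemma measurable_Lr_section:
  assumes \<mu>: "\<mu> \<in> PY"
  shows "(\<lambda>y'. Lr x a \<mu> w (x', y')) \<in> borel_measurable (nu M)"
proof -
  have "(\<lambda>y'. enn2real (L x a \<mu> w (x', y'))) \<in> borel_measurable (nu M)"
    using measurable_L_nu_section[OF assms, of x a w] by measurable
  then show ?thesis by (simp add: L_eq_Lr[OF assms] Lr_nonneg)
qed

lemma mass_eq_Lr:
  assumes \<mu>: "\<mu> \<in> PY" and fin: "mass x a \<mu> w x' < \<infinity>"
  shows "integrable (nu M) (\<lambda>y'. Lr x a \<mu> w (x', y'))"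
    and "mass x a \<mu> w x' = ennreal (\<integral>y'. Lr x a \<mu> w (x', y') \<partial>nu M)"
proof -
  show i: "integrable (nu M) (\<lambda>y'. Lr x a \<mu> w (x', y'))"
    using fin measurable_Lr_section[OF \<mu>] unfolding mass_def L_eq_Lr[OF \<mu>]
    by (simp add: integrable_iff_bounded Lr_nonneg)
  show "mass x a \<mu> w x' = ennreal (\<integral>y'. Lr x a \<mu> w (x', y') \<partial>nu M)"
    unfolding mass_def L_eq_Lr[OF \<mu>] by (rule nn_integral_eq_integral[OF i]) (simp add: Lr_nonneg)
qed

lemma wtest_Psi_e:
  assumes xa: "(x, a) \<in> adm M" and \<mu>: "\<mu> \<in> PY" and x': "x' \<in> SX M"
    and fin: "mass x a \<mu> w x' < \<infinity>" and pos: "0 < (\<integral>y'. Lr x a \<mu> w (x', y') \<partial>nu M)"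
  shows "wtest (Psi_e M x a x' \<mu> w) ps =
    (\<integral>y'. Lr x a \<mu> w (x', y') * max_spikes ps y' \<partial>nu M) / (\<integral>y'. Lr x a \<mu> w (x', y') \<partial>nu M)"
proof -
  let ?m = "\<integral>y'. Lr x a \<mu> w (x', y') \<partial>nu M" and ?I = "\<integral>y'. Lr x a \<mu> w (x', y') * max_spikes ps y' \<partial>nu M"
  obtain B where B: "\<And>y::'y. max_spikes ps y \<le> B" using max_spikes_bounded[of ps] by blast
  have ms: "max_spikes ps \<in> borel_measurable (nu M)"
    by (subst measurable_cong_sets[OF sets_nu refl]) simp
  have i: "integrable (nu M) (\<lambda>y'. Lr x a \<mu> w (x', y') * max_spikes ps y')"
  proof (rule Bochner_Integration.integrable_bound)
    show "integrable (nu M) (\<lambda>y'. Lr x a \<mu> w (x', y') * B)" using mass_eq_Lr(1)[OF \<mu> fin] by simp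
    show "AE y' in nu M. norm (Lr x a \<mu> w (x', y') * max_spikes ps y') \<le> norm (Lr x a \<mu> w (x', y') * B)"
    proof (rule AE_I2)
      fix y' :: 'y
      have "\<bar>max_spikes ps y'\<bar> \<le> \<bar>B\<bar>" using B[of y'] max_spikes_nonneg[of ps y'] by linarith
      then show "norm (Lr x a \<mu> w (x', y') * max_spikes ps y') \<le> norm (Lr x a \<mu> w (x', y') * B)"
        by (simp add: abs_mult mult_left_mono)
    qed
  qed (use ms measurable_Lr_section[OF \<mu>] in simp)
  have P: "Psi_e M x a x' \<mu> w \<in> PY" by (rule Psi_e_prob[OF \<mu> x'])
  have "ennreal (wtest (Psi_e M x a x' \<mu> w) ps) = (\<integral>\<^sup>+y. ennreal (max_spikes ps y) \<partial>Psi_e M x a x' \<mu> w)"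
    by (rule nn_integral_max_spikes[OF P, symmetric])
  also have "\<dots> = 1 / mass x a \<mu> w x' * (\<integral>\<^sup>+y'. L x a \<mu> w (x', y') * ennreal (max_spikes ps y') \<partial>nu M)"
    using fin pos mass_eq_Lr(2)[OF \<mu> fin] by (subst nn_integral_Psi_e[OF xa \<mu> x']) auto
  also have "(\<integral>\<^sup>+y'. L x a \<mu> w (x', y') * ennreal (max_spikes ps y') \<partial>nu M) = ennreal ?I"
    unfolding L_eq_Lr[OF \<mu>] using i
    by (subst nn_integral_eq_integral[symmetric])
       (auto simp: Lr_nonneg max_spikes_nonneg ennreal_mult intro!: nn_integral_cong)
  also have "1 / mass x a \<mu> w x' * ennreal ?I = ennreal (?I / ?m)"
  proof -
    have "0 \<le> ?I" by (rule integral_nonneg_AE) (simp add: Lr_nonneg max_spikes_nonneg)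
    moreover have "1 / ennreal ?m = ennreal (1 / ?m)"
      using divide_ennreal[of 1 ?m] pos by simp
    ultimately show ?thesis
      unfolding mass_eq_Lr(2)[OF \<mu> fin] using pos by (simp add: ennreal_mult[symmetric])
  qed
  finally have eq: "ennreal (wtest (Psi_e M x a x' \<mu> w) ps) = ennreal (?I / ?m)" .
  have "0 \<le> wtest (Psi_e M x a x' \<mu> w) ps" unfolding wtest_def
    by (rule integral_nonneg_AE) (simp add: max_spikes_nonneg)
  moreover have "0 \<le> ?I / ?m" using pos
    by (intro divide_nonneg_pos integral_nonneg_AE) (auto simp: Lr_nonneg max_spikes_nonneg)
  ultimately show ?thesis using eq by simp
qed

text \<open>A posterior integral is a quotient of two integrals against the section of the filter
  density, and both converge when the sections converge in L1. A positive limit of the denominators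
  makes the quotient formula valid for all large \<open>n\<close>.\<close>

lemma tendsto_Psi_e:
  assumes adm: "\<And>n. (xs n, as n) \<in> adm M" "(x, a) \<in> adm M"
    and \<mu>: "\<And>n. \<mu>s n \<in> PY" "\<mu> \<in> PY" and x': "x' \<in> SX M"
    and fin: "\<And>n. mass (xs n) (as n) (\<mu>s n) (ws n) x' < \<infinity>" "mass x a \<mu> w x' < \<infinity>"
    and D: "(\<lambda>n. \<integral>\<^sup>+y'. ennreal \<bar>Lr (xs n) (as n) (\<mu>s n) (ws n) (x', y') - Lr x a \<mu> w (x', y')\<bar> \<partial>nu M) \<longlonglongrightarrow> 0"
  shows "(\<lambda>n. \<integral>y'. Lr (xs n) (as n) (\<mu>s n) (ws n) (x', y') \<partial>nu M) \<longlonglongrightarrow> (\<integral>y'. Lr x a \<mu> w (x', y') \<partial>nu M)"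
    and "0 < (\<integral>y'. Lr x a \<mu> w (x', y') \<partial>nu M) \<Longrightarrow>
      wconv (\<lambda>n. Psi_e M (xs n) (as n) x' (\<mu>s n) (ws n)) (Psi_e M x a x' \<mu> w)"
proof -
  note int = mass_eq_Lr(1)[OF \<mu>(1) fin(1)] mass_eq_Lr(1)[OF \<mu>(2) fin(2)]
  show m: "(\<lambda>n. \<integral>y'. Lr (xs n) (as n) (\<mu>s n) (ws n) (x', y') \<partial>nu M) \<longlonglongrightarrow> (\<integral>y'. Lr x a \<mu> w (x', y') \<partial>nu M)"
    using tendsto_integral_L1_weight[OF int D, of "\<lambda>_. 1" 1] by simp
  assume pos: "0 < (\<integral>y'. Lr x a \<mu> w (x', y') \<partial>nu M)"
  show "wconv (\<lambda>n. Psi_e M (xs n) (as n) x' (\<mu>s n) (ws n)) (Psi_e M x a x' \<mu> w)"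
    unfolding wconv_def
  proof
    fix ps
    obtain B where B: "\<And>y::'y. max_spikes ps y \<le> B" using max_spikes_bounded[of ps] by blast
    have ms: "max_spikes ps \<in> borel_measurable (nu M)"
      by (subst measurable_cong_sets[OF sets_nu refl]) simp
    have I: "(\<lambda>n. \<integral>y'. Lr (xs n) (as n) (\<mu>s n) (ws n) (x', y') * max_spikes ps y' \<partial>nu M)
        \<longlonglongrightarrow> (\<integral>y'. Lr x a \<mu> w (x', y') * max_spikes ps y' \<partial>nu M)"
      by (rule tendsto_integral_L1_weight[OF int D ms, where K=B]) (use B in \<open>simp add: max_spikes_nonneg\<close>)
    have "(\<lambda>n. (\<integral>y'. Lr (xs n) (as n) (\<mu>s n) (ws n) (x', y') * max_spikes ps y' \<partial>nu M) /
          (\<integral>y'. Lr (xs n) (as n) (\<mu>s n) (ws n) (x', y') \<partial>nu M)) \<longlonglongrightarrow> wtest (Psi_e M x a x' \<mu> w) ps"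
      unfolding wtest_Psi_e[OF adm(2) \<mu>(2) x' fin(2) pos] using pos by (intro tendsto_divide I m) simp
    moreover have "\<forall>\<^sub>F n in sequentially. (\<integral>y'. Lr (xs n) (as n) (\<mu>s n) (ws n) (x', y') * max_spikes ps y' \<partial>nu M) /
          (\<integral>y'. Lr (xs n) (as n) (\<mu>s n) (ws n) (x', y') \<partial>nu M) = wtest (Psi_e M (xs n) (as n) x' (\<mu>s n) (ws n)) ps"
      using order_tendstoD(1)[OF m pos]
      by eventually_elim (simp add: wtest_Psi_e[OF adm(1) \<mu>(1) x' fin(1)])
    ultimately show "(\<lambda>n. wtest (Psi_e M (xs n) (as n) x' (\<mu>s n) (ws n)) ps) \<longlonglongrightarrow> wtest (Psi_e M x a x' \<mu> w) ps"
      by (rule Lim_transform_eventually)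
  qed
qed

end

section \<open>Value functions on states, priors and risk parameters\<close>

locale pomdp_exp = pomdp M for M :: "('x::polish_space, 'y::polish_space, 'a::polish_space) pomdp" +
  fixes \<gamma> :: real
  assumes \<gamma>: "\<gamma> \<noteq> 0"
begin

abbreviation "W \<equiv> scaled_params \<gamma>"

lemma W_disc: "w \<in> W \<Longrightarrow> \<beta> * w \<in> W"
  unfolding scaled_params_def
proof clarify
  fix z :: real assume "0 < z" "z \<le> 1"
  then show "\<exists>z'. \<beta> * (\<gamma> * z) = \<gamma> * z' \<and> 0 < z' \<and> z' \<le> 1"
    using disc by (intro exI[of _ "\<beta> * z"]) (simp add: mult_le_one)
qed

lemma W_\<gamma>: "\<gamma> \<in> W"
  unfolding scaled_params_def by (auto intro!: exI[of _ 1])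

lemma W_disc_power: "w \<in> W \<Longrightarrow> w * \<beta> ^ n \<in> W"
proof (induction n)
  case (Suc n)
  then show ?case using W_disc[of "w * \<beta> ^ n"] by (simp add: mult.left_commute)
qed simp

lemma W_abs: "w \<in> W \<Longrightarrow> \<bar>w\<bar> \<le> \<bar>\<gamma>\<bar>"
  unfolding scaled_params_def by (auto simp: abs_mult mult_left_le)

text \<open>Lower semicontinuity in its sublevel form: each set where \<open>u\<close> is at most
  \<open>r\<close> is sequentially closed. In this form it feeds directly into
  \<open>sets_seq_closed\<close>.\<close>

definition seq_lsc :: "('x \<Rightarrow> 'y measure \<Rightarrow> real \<Rightarrow> real) \<Rightarrow> bool" where
  "seq_lsc u \<longleftrightarrow> (\<forall>xs x \<mu>s \<mu> ws w r. (\<forall>n. xs n \<in> SX M \<and> \<mu>s n \<in> PY \<and> ws n \<in> W \<and> u (xs n) (\<mu>s n) (ws n) \<le> r) \<and>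
     x \<in> SX M \<and> \<mu> \<in> PY \<and> w \<in> W \<and> xs \<longlonglongrightarrow> x \<and> wconv \<mu>s \<mu> \<and> ws \<longlonglongrightarrow> w \<longrightarrow> u x \<mu> w \<le> r)"

definition bdd_by :: "real \<Rightarrow> ('x \<Rightarrow> 'y measure \<Rightarrow> real \<Rightarrow> real) \<Rightarrow> bool" where
  "bdd_by B u \<longleftrightarrow> (\<forall>x\<in>SX M. \<forall>\<mu>\<in>PY. \<forall>w\<in>W. \<bar>u x \<mu> w\<bar> \<le> B)"

abbreviation "PM \<equiv> XM \<Otimes>\<^sub>M weak_borel (SY M) \<Otimes>\<^sub>M borel_on W"

lemma space_PM: "space PM = SX M \<times> PY \<times> W"
  by (simp add: space_pair_measure space_weak_borel space_restrict_space)

lemma measurable_seq_lsc: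
  assumes "seq_lsc u"
  shows "(\<lambda>(x, \<mu>, w). u x \<mu> w) \<in> borel_measurable PM"
proof (rule borel_measurableI_le)
  fix r
  have "{p \<in> space PM. (case p of (x, \<mu>, w) \<Rightarrow> u x \<mu> w) \<le> r} =
     {(x, \<mu>, w). x \<in> SX M \<and> \<mu> \<in> PY \<and> w \<in> W \<and> u x \<mu> w \<le> r}"
    unfolding space_PM by auto
  also have "\<dots> \<in> sets PM"
  proof (rule sets_seq_closed)
    fix xs x \<mu>s \<mu> ws w
    assume "\<And>n. (xs n, \<mu>s n, ws n) \<in> {(x, \<mu>, w). x \<in> SX M \<and> \<mu> \<in> PY \<and> w \<in> W \<and> u x \<mu> w \<le> r}"
      and "x \<in> SX M" "\<mu> \<in> PY" "w \<in> W" "xs \<longlonglongrightarrow> x" "wconv \<mu>s \<mu>" "ws \<longlonglongrightarrow> w"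
    then show "(x, \<mu>, w) \<in> {(x, \<mu>, w). x \<in> SX M \<and> \<mu> \<in> PY \<and> w \<in> W \<and> u x \<mu> w \<le> r}"
      using assms unfolding seq_lsc_def by simp blast
  qed auto
  finally show "{p \<in> space PM. (case p of (x, \<mu>, w) \<Rightarrow> u x \<mu> w) \<le> r} \<in> sets PM" .
qed

text \<open>Filters are measurable into the Giry sigma-algebra, values and minimizers are measurable
  for the weak Borel sigma-algebra; this is where the two meet.\<close>

lemma measurable_to_PM:
  assumes "x \<in> N \<rightarrow>\<^sub>M XM" "m \<in> N \<rightarrow>\<^sub>M prob_algebra YM" "w \<in> W"
  shows "(\<lambda>n. (x n, m n, w)) \<in> N \<rightarrow>\<^sub>M PM"
proof (intro measurable_Pair assms(1))
  show "m \<in> N \<rightarrow>\<^sub>M weak_borel (SY M)" by (rule measurable_weak_borelI[OF assms(2)])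
  show "(\<lambda>_. w) \<in> N \<rightarrow>\<^sub>M borel_on W" using assms(3) by (simp add: space_restrict_space)
qed

definition bellman :: "('x \<Rightarrow> 'y measure \<Rightarrow> real \<Rightarrow> real) \<Rightarrow> 'x \<Rightarrow> 'y measure \<Rightarrow> real \<Rightarrow> 'a \<Rightarrow> real" where
  "bellman u x \<mu> w a = (\<integral>x'. u x' (Psi_e M x a x' \<mu> w) (\<beta> * w) \<partial>Qhat_X M x \<mu> a w)"

lemma space_Qhat: "space (Qhat_X M x \<mu> a w) = SX M" and sets_Qhat: "sets (Qhat_X M x \<mu> a w) = sets XM"
  by (simp_all add: Qhat_X_def space_lam sets_lam)

lemma emeasure_Qhat:
  assumes "(x, a) \<in> adm M" "\<mu> \<in> PY"
  shows "emeasure (Qhat_X M x \<mu> a w) (space (Qhat_X M x \<mu> a w)) = ennreal (tot x a \<mu> w)"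
proof -
  have "emeasure (Qhat_X M x \<mu> a w) (space (Qhat_X M x \<mu> a w)) = (\<integral>\<^sup>+x'. mass x a \<mu> w x' \<partial>lam M)"
    unfolding Qhat_X_eq[OF assms] using measurable_mass_lam[OF assms(2)]
    by (simp add: emeasure_density nn_integral_density cong: nn_integral_cong)
  then show ?thesis by (simp add: nn_integral_mass[OF assms] nn_integral_exp_eq_tot[OF assms(2)])
qed

lemma measure_Qhat:
  assumes "(x, a) \<in> adm M" "\<mu> \<in> PY"
  shows "measure (Qhat_X M x \<mu> a w) (space (Qhat_X M x \<mu> a w)) = tot x a \<mu> w"
  using emeasure_Qhat[OF assms, of w] tot_bounds(1)[OF assms(2)] by (simp add: measure_def)

lemma finite_Qhat:
  assumes "(x, a) \<in> adm M" "\<mu> \<in> PY"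
  shows "finite_measure (Qhat_X M x \<mu> a w)"
  by (rule finite_measureI) (simp add: emeasure_Qhat[OF assms])

lemma measurable_Psi_e_section:
  assumes "\<mu> \<in> PY"
  shows "(\<lambda>x'. Psi_e M x a x' \<mu> w) \<in> XM \<rightarrow>\<^sub>M prob_algebra YM"
proof -
  have [simp]: "\<mu> \<in> space (prob_algebra YM)" using assms by (simp add: space_prob_algebra_borel_on)
  show ?thesis by measurable
qed

lemma measurable_bellman_integrand:
  assumes "seq_lsc u" "\<mu> \<in> PY" "w \<in> W"
  shows "(\<lambda>x'. u x' (Psi_e M x a x' \<mu> w) (\<beta> * w)) \<in> borel_measurable XM"
  using measurable_compose[OF measurable_to_PM[OF measurable_ident_sets[OF refl] measurable_Psi_e_section[OF assms(2)] W_disc[OF assms(3)]]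
      measurable_seq_lsc[OF assms(1)]] by simp

lemma bdd_bellman_integrand:
  assumes "bdd_by B u" "\<mu> \<in> PY" "w \<in> W" "x' \<in> SX M"
  shows "\<bar>u x' (Psi_e M x a x' \<mu> w) (\<beta> * w)\<bar> \<le> B"
  using assms unfolding bdd_by_def by (auto intro: Psi_e_prob W_disc)

lemma integrable_bellman:
  assumes "seq_lsc u" "bdd_by B u" "\<mu> \<in> PY" "w \<in> W" "(x, a) \<in> adm M"
  shows "integrable (Qhat_X M x \<mu> a w) (\<lambda>x'. u x' (Psi_e M x a x' \<mu> w) (\<beta> * w))"
proof -
  interpret finite_measure "Qhat_X M x \<mu> a w" by (rule finite_Qhat[OF assms(5,3)])
  show ?thesis
  proof (rule integrable_const_bound[where B=B])
    show "(\<lambda>x'. u x' (Psi_e M x a x' \<mu> w) (\<beta> * w)) \<in> borel_measurable (Qhat_X M x \<mu> a w)"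
      using measurable_bellman_integrand[OF assms(1,3,4)] by (simp add: measurable_cong_sets[OF sets_Qhat refl])
  qed (auto simp: space_Qhat intro!: AE_I2 bdd_bellman_integrand[OF assms(2-4)])
qed

text \<open>Adding \<open>B\<close> makes the integrand nonnegative, so that Fatou's lemma becomes
  available. Since \<open>Qhat_X\<close> has mass \<open>tot\<close>, the shift changes the integral
  by \<open>B * tot x a \<mu> w\<close>, a quantity that is continuous along the sequences
  considered.\<close>

lemma bellman_shift:
  assumes "seq_lsc u" "bdd_by B u" "\<mu> \<in> PY" "w \<in> W" "(x, a) \<in> adm M"
  shows "(\<integral>\<^sup>+x'. mass x a \<mu> w x' * ennreal (u x' (Psi_e M x a x' \<mu> w) (\<beta> * w) + B) \<partial>lam M) =
      ennreal (bellman u x \<mu> w a + B * tot x a \<mu> w)"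
    and "0 \<le> bellman u x \<mu> w a + B * tot x a \<mu> w"
proof -
  interpret finite_measure "Qhat_X M x \<mu> a w" by (rule finite_Qhat[OF assms(5,3)])
  let ?u = "\<lambda>x'. u x' (Psi_e M x a x' \<mu> w) (\<beta> * w)"
  have um: "?u \<in> borel_measurable (lam M)"
    using measurable_bellman_integrand[OF assms(1,3,4)] by (simp add: measurable_cong_sets[OF sets_lam refl])
  have nn: "0 \<le> ?u x' + B" if "x' \<in> SX M" for x'
    using bdd_bellman_integrand[OF assms(2-4) that, of x a] by auto
  note meas = measure_Qhat[OF assms(5,3), of w]
  have I: "(\<integral>x'. ?u x' + B \<partial>Qhat_X M x \<mu> a w) = bellman u x \<mu> w a + B * tot x a \<mu> w"
    using integrable_bellman[OF assms] meas by (simp add: bellman_def mult.commute)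
  show "0 \<le> bellman u x \<mu> w a + B * tot x a \<mu> w"
    unfolding I[symmetric] by (rule integral_nonneg_AE, rule AE_I2) (simp add: space_Qhat nn)
  have "(\<integral>\<^sup>+x'. mass x a \<mu> w x' * ennreal (?u x' + B) \<partial>lam M) = (\<integral>\<^sup>+x'. ennreal (?u x' + B) \<partial>Qhat_X M x \<mu> a w)"
    unfolding Qhat_X_eq[OF assms(5,3)] using measurable_mass_lam[OF assms(3)] um
    by (intro nn_integral_density[symmetric]) auto
  also have "\<dots> = ennreal (bellman u x \<mu> w a + B * tot x a \<mu> w)"
    unfolding I[symmetric] using integrable_bellman[OF assms]
    by (intro nn_integral_eq_integral) (auto simp: space_Qhat nn intro!: AE_I2)
  finally show "(\<integral>\<^sup>+x'. mass x a \<mu> w x' * ennreal (?u x' + B) \<partial>lam M) = ennreal (bellman u x \<mu> w a + B * tot x a \<mu> w)" .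
qed

text \<open>The constant bounds the total mass of \<open>Qhat_X\<close> uniformly, because
  parameters in \<open>W\<close> do not exceed \<open>\<gamma>\<close> in modulus.\<close>

lemma bellman_bound:
  assumes "seq_lsc u" "bdd_by B u" "\<mu> \<in> PY" "w \<in> W" "(x, a) \<in> adm M"
  shows "\<bar>bellman u x \<mu> w a\<bar> \<le> \<bar>B\<bar> * exp (\<bar>\<gamma>\<bar> * c_max)"
proof -
  interpret finite_measure "Qhat_X M x \<mu> a w" by (rule finite_Qhat[OF assms(5,3)])
  note meas = measure_Qhat[OF assms(5,3), of w]
  have "\<bar>bellman u x \<mu> w a\<bar> \<le> (\<integral>x'. \<bar>u x' (Psi_e M x a x' \<mu> w) (\<beta> * w)\<bar> \<partial>Qhat_X M x \<mu> a w)"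
    unfolding bellman_def by (rule integral_abs_bound)
  also have "\<dots> \<le> (\<integral>x'. \<bar>B\<bar> \<partial>Qhat_X M x \<mu> a w)"
    by (intro integral_mono integrable_abs integrable_bellman[OF assms] integrable_const)
       (use bdd_bellman_integrand[OF assms(2-4), of _ x a] in \<open>force simp: space_Qhat\<close>)
  also have "\<dots> = \<bar>B\<bar> * tot x a \<mu> w" using meas by (simp add: mult.commute)
  also have "\<dots> \<le> \<bar>B\<bar> * exp (\<bar>\<gamma>\<bar> * c_max)"
  proof (rule mult_left_mono)
    have "\<bar>w\<bar> * c_max \<le> \<bar>\<gamma>\<bar> * c_max" using W_abs[OF assms(4)] c_max(1) by (intro mult_right_mono) auto
    then show "tot x a \<mu> w \<le> exp (\<bar>\<gamma>\<bar> * c_max)"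
      using tot_bounds(2)[OF assms(3), of x a w] by (meson exp_le_cancel_iff order_trans)
  qed simp
  finally show ?thesis .
qed

text \<open>The denominators \<open>mass\<close> need not converge for every \<open>x'\<close>, only almost everywhere along a
  subsequence; where the limit vanishes, the posteriors may diverge but the lower bound is trivial.\<close>

theorem bellman_lsc:
  assumes u: "seq_lsc u" "bdd_by B u"
    and adm: "\<And>n. (xs n, as n) \<in> adm M" "(x, a) \<in> adm M"
    and \<mu>: "\<And>n. \<mu>s n \<in> PY" "\<mu> \<in> PY"
    and w: "\<And>n. ws n \<in> W" "w \<in> W"
    and lim: "xs \<longlonglongrightarrow> x" "as \<longlonglongrightarrow> a" "ws \<longlonglongrightarrow> w" "wconv \<mu>s \<mu>"
    and le: "\<And>n. bellman u (xs n) (\<mu>s n) (ws n) (as n) \<le> rs n" and rs: "rs \<longlonglongrightarrow> r"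
  shows "bellman u x \<mu> w a \<le> r"
proof -
  have conv: "params_conv xs x as a \<mu>s \<mu> ws w"
    using adm \<mu> lim by (simp add: params_conv_def)
  \<comment> \<open>Passing to a subsequence is harmless: the upper bounds \<open>rs\<close> and the
    shifts \<open>B * tot\<close> converge along the full sequence.\<close>
  obtain s where s: "strict_mono s" and AE_D: "AE x' in lam M. (\<lambda>n. \<integral>\<^sup>+y'. ennreal \<bar>Lr (xs (s n)) (as (s n)) (\<mu>s (s n)) (ws (s n)) (x', y')
      - Lr x a \<mu> w (x', y')\<bar> \<partial>nu M) \<longlonglongrightarrow> 0"
    using tendsto_AE_Lr_subseq[OF conv] by blast
  have limws: "(\<lambda>n. ws (s n)) \<longlonglongrightarrow> w" using LIMSEQ_subseq_LIMSEQ[OF lim(3) s] by (simp add: comp_def)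
  define \<phi> where "\<phi> n x' = u x' (Psi_e M (xs (s n)) (as (s n)) x' (\<mu>s (s n)) (ws (s n))) (\<beta> * ws (s n))" for n x'
  define \<phi>' where "\<phi>' x' = u x' (Psi_e M x a x' \<mu> w) (\<beta> * w)" for x'
  let ?m = "\<lambda>n. mass (xs (s n)) (as (s n)) (\<mu>s (s n)) (ws (s n))"
  have "AE x' in lam M. (\<forall>n. ?m n x' < \<infinity>) \<and> mass x a \<mu> w x' < \<infinity>"
    using mass_finite_AE[OF adm(1) \<mu>(1)] mass_finite_AE[OF adm(2) \<mu>(2)] by (simp add: AE_all_countable)
  with AE_D AE_space have key: "AE x' in lam M. mass x a \<mu> w x' * ennreal (\<phi>' x' + B) \<le> liminf (\<lambda>n. ?m n x' * ennreal (\<phi> n x' + B))"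
  proof eventually_elim
    case (elim x')
    then have x': "x' \<in> SX M" by (simp add: space_lam)
    let ?mr = "\<lambda>n. \<integral>y'. Lr (xs (s n)) (as (s n)) (\<mu>s (s n)) (ws (s n)) (x', y') \<partial>nu M"
    let ?ml = "\<integral>y'. Lr x a \<mu> w (x', y') \<partial>nu M"
    have fin: "?m n x' < \<infinity>" "mass x a \<mu> w x' < \<infinity>" for n using elim by auto
    note T = tendsto_Psi_e[OF adm(1) adm(2) \<mu>(1) \<mu>(2) x' fin elim(1)]
    have mass: "?m n x' = ennreal (?mr n)" "mass x a \<mu> w x' = ennreal ?ml" for n
      by (rule mass_eq_Lr(2)[OF \<mu>(1) fin(1)], rule mass_eq_Lr(2)[OF \<mu>(2) fin(2)])
    have m0_nn: "0 \<le> ?ml" by (rule integral_nonneg_AE) (simp add: Lr_nonneg)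
    have mr_nn: "0 \<le> ?mr n" for n by (rule integral_nonneg_AE) (simp add: Lr_nonneg)
    show ?case
    proof (cases "?ml = 0")
      case True
      then show ?thesis by (simp add: mass(2))
    next
      case False
      then have pos: "0 < ?ml" using m0_nn by simp
      \<comment> \<open>Lower semicontinuity of \<open>u\<close> is used at the fixed observation
        \<open>x'\<close>, along the weakly convergent posteriors and the discounted
        parameters.\<close>
      have ev: "\<forall>\<^sub>F n in sequentially. t < \<phi> n x'" if t: "t < \<phi>' x'" for t
      proof (rule eventually_greater_of_closed_sublevels)
        fix k :: "nat \<Rightarrow> nat" assume k: "strict_mono k" and le_t: "\<And>n. \<phi> (k n) x' \<le> t"
        have "wconv (\<lambda>n. Psi_e M (xs (s (k n))) (as (s (k n))) x' (\<mu>s (s (k n))) (ws (s (k n)))) (Psi_e M x a x' \<mu> w)"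
          using wconv_subseq[OF T(2)[OF pos] k] by (simp add: comp_def)
        moreover have "(\<lambda>n. \<beta> * ws (s (k n))) \<longlonglongrightarrow> \<beta> * w"
          using LIMSEQ_subseq_LIMSEQ[OF limws k] by (intro tendsto_intros) (simp add: comp_def)
        ultimately have "\<phi>' x' \<le> t"
          using u(1)[unfolded seq_lsc_def, rule_format, of "\<lambda>_. x'"
              "\<lambda>n. Psi_e M (xs (s (k n))) (as (s (k n))) x' (\<mu>s (s (k n))) (ws (s (k n)))"
              "\<lambda>n. \<beta> * ws (s (k n))" t x' "Psi_e M x a x' \<mu> w" "\<beta> * w"]
            le_t x' \<mu> w by (simp add: \<phi>_def \<phi>'_def Psi_e_prob W_disc)
        then show False using t by simp
      qed
      have nn': "0 \<le> \<phi>' x' + B"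
        using bdd_bellman_integrand[OF u(2) \<mu>(2) w(2) x', of x a] by (auto simp: \<phi>'_def)
      have "ennreal (?ml * (\<phi>' x' + B)) \<le> liminf (\<lambda>n. ?m n x' * ennreal (\<phi> n x' + B))"
        unfolding le_Liminf_iff
      proof (intro allI impI)
        fix z assume z: "z < ennreal (?ml * (\<phi>' x' + B))"
        then obtain z' where z': "z = ennreal z'" "0 \<le> z'" by (cases z) auto
        then have "z' < ?ml * (\<phi>' x' + B)" using z by (simp add: ennreal_less_iff)
        then have "z' / ?ml < \<phi>' x' + B" using pos by (simp add: field_simps)
        \<comment> \<open>An intermediate level separates the two factors: the denominators
          converge, whereas the shifted values are only eventually above \<open>t\<close>.\<close>
        then obtain t where t: "z' / ?ml < t" "t < \<phi>' x' + B" using dense by blast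
        have t0: "0 < t" using t(1) z'(2) pos by (meson divide_nonneg_pos le_less_trans)
        have "z' < ?ml * t" using t(1) pos by (simp add: field_simps)
        moreover have "(\<lambda>n. ?mr n * t) \<longlonglongrightarrow> ?ml * t" by (intro tendsto_intros T(1))
        ultimately have 1: "\<forall>\<^sub>F n in sequentially. z' < ?mr n * t" by (rule order_tendstoD(1)[rotated])
        have 2: "\<forall>\<^sub>F n in sequentially. t - B < \<phi> n x'" using t(2) by (intro ev) simp
        show "\<forall>\<^sub>F n in sequentially. z < ?m n x' * ennreal (\<phi> n x' + B)"
          using 1 2
        proof eventually_elim
          case (elim n)
          have "?mr n * t \<le> ?mr n * (\<phi> n x' + B)" using elim(2) mr_nn by (intro mult_left_mono) auto
          then have "z' < ?mr n * (\<phi> n x' + B)" using elim(1) by simp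
          then show ?case
            using z' elim(2) t0 mr_nn[of n] by (simp add: mass ennreal_mult[symmetric] ennreal_less_iff)
        qed
      qed
      then show ?thesis using m0_nn nn' by (simp add: mass ennreal_mult)
    qed
  qed
  have "ennreal (bellman u x \<mu> w a + B * tot x a \<mu> w) = (\<integral>\<^sup>+x'. mass x a \<mu> w x' * ennreal (\<phi>' x' + B) \<partial>lam M)"
    unfolding \<phi>'_def by (rule bellman_shift(1)[OF u \<mu>(2) w(2) adm(2), symmetric])
  also have "\<dots> \<le> (\<integral>\<^sup>+x'. liminf (\<lambda>n. ?m n x' * ennreal (\<phi> n x' + B)) \<partial>lam M)"
    by (rule nn_integral_mono_AE[OF key])
  also have "\<dots> \<le> liminf (\<lambda>n. \<integral>\<^sup>+x'. ?m n x' * ennreal (\<phi> n x' + B) \<partial>lam M)"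
  proof (rule nn_integral_liminf)
    show "(\<lambda>x'. ?m n x' * ennreal (\<phi> n x' + B)) \<in> borel_measurable (lam M)" for n
      unfolding \<phi>_def
      using measurable_mass_lam[OF \<mu>(1), of "xs (s n)" "as (s n)" "s n" "ws (s n)"]
        measurable_bellman_integrand[OF u(1) \<mu>(1) w(1), of "xs (s n)" "as (s n)" "s n" "s n"]
      by (simp add: measurable_cong_sets[OF sets_lam refl])
  qed
  also have "\<dots> = liminf (\<lambda>n. ennreal (bellman u (xs (s n)) (\<mu>s (s n)) (ws (s n)) (as (s n)) + B * tot (xs (s n)) (as (s n)) (\<mu>s (s n)) (ws (s n))))"
    unfolding \<phi>_def by (simp only: bellman_shift(1)[OF u \<mu>(1) w(1) adm(1)])
  also have "\<dots> \<le> liminf (\<lambda>n. ennreal (rs (s n) + B * tot (xs (s n)) (as (s n)) (\<mu>s (s n)) (ws (s n))))"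
    by (intro Liminf_mono always_eventually allI ennreal_leI add_right_mono le)
  also have "\<dots> = ennreal (r + B * tot x a \<mu> w)"
  proof (rule lim_imp_Liminf)
    have "(\<lambda>n. rs n + B * tot (xs n) (as n) (\<mu>s n) (ws n)) \<longlonglongrightarrow> r + B * tot x a \<mu> w"
      by (intro tendsto_intros rs tendsto_tot[OF conv])
    from tendsto_ennrealI[OF LIMSEQ_subseq_LIMSEQ[OF this s]]
    show "(\<lambda>n. ennreal (rs (s n) + B * tot (xs (s n)) (as (s n)) (\<mu>s (s n)) (ws (s n)))) \<longlonglongrightarrow> ennreal (r + B * tot x a \<mu> w)"
      by (simp add: comp_def)
  qed simp
  finally have *: "ennreal (bellman u x \<mu> w a + B * tot x a \<mu> w) \<le> ennreal (r + B * tot x a \<mu> w)" .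
  \<comment> \<open>The comparison in \<open>ennreal\<close> yields one of reals only if the
    right-hand side is nonnegative; this follows in the limit from
    \<open>bellman_shift(2)\<close>.\<close>
  have "(\<lambda>n. rs n + B * tot (xs n) (as n) (\<mu>s n) (ws n)) \<longlonglongrightarrow> r + B * tot x a \<mu> w"
    by (intro tendsto_intros rs tendsto_tot[OF conv])
  moreover have "0 \<le> rs n + B * tot (xs n) (as n) (\<mu>s n) (ws n)" for n
    using bellman_shift(2)[OF u \<mu>(1) w(1) adm(1), of n n n] le[of n] by simp
  ultimately have "0 \<le> r + B * tot x a \<mu> w" by (intro LIMSEQ_le_const) auto
  then show ?thesis using * by simp
qed

section \<open>Dynamic programming\<close>

primrec V :: "nat \<Rightarrow> 'x \<Rightarrow> 'y measure \<Rightarrow> real \<Rightarrow> real" where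
  "V 0 = (\<lambda>x \<mu> w. 1 / \<gamma>)"
| "V (Suc n) = (\<lambda>x \<mu> w. INF a\<in>admX M x. bellman (V n) x \<mu> w a)"

lemma admX_iff: "a \<in> admX M x \<longleftrightarrow> (x, a) \<in> adm M"
  by (simp add: admX_def)

lemma exists_selector: "\<exists>d. d \<in> XM \<rightarrow>\<^sub>M AM \<and> (\<forall>x\<in>SX M. (x, d x) \<in> adm M)"
  using model unfolding pomdp_model_def by blast

lemma admX_nonempty: "x \<in> SX M \<Longrightarrow> admX M x \<noteq> {}"
  using exists_selector by (auto simp: admX_def)

lemma admX_usc:
  assumes "\<And>n. xs n \<in> SX M" "\<And>n. as n \<in> admX M (xs n)" "x \<in> SX M" "xs \<longlonglongrightarrow> x"
  obtains a s where "a \<in> admX M x" "strict_mono (s :: nat \<Rightarrow> nat)" "(\<lambda>n. as (s n)) \<longlonglongrightarrow> a"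
proof -
  have "\<forall>xs x as. (\<forall>n. xs n \<in> SX M \<and> as n \<in> admX M (xs n)) \<and> x \<in> SX M \<and> xs \<longlonglongrightarrow> x \<longrightarrow>
        (\<exists>a \<in> admX M x. \<exists>r. strict_mono r \<and> (as \<circ> r) \<longlonglongrightarrow> a)"
    using standing unfolding standing_assumptions_def by blast
  from this[rule_format, of xs as x] assms have "\<exists>a \<in> admX M x. \<exists>r. strict_mono r \<and> (as \<circ> r) \<longlonglongrightarrow> a"
    by blast
  then show ?thesis using that by (auto simp: comp_def)
qed

text \<open>Upper semicontinuity of the admissible sets gives an accumulation point of the actions,
  closedness keeps it in \<open>F\<close>, and \<open>bellman_lsc\<close> passes the bound to it.
  With \<open>F\<close> the whole space this yields attainment and lower semicontinuity of the
  values; general \<open>F\<close> serves the measurable selection. Convergent levels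
  \<open>rs\<close> admit actions that are only nearly optimal.\<close>

lemma bellman_limit_action:
  assumes u: "seq_lsc u" "bdd_by B u" and F: "closed F"
    and dom: "\<And>n. xs n \<in> SX M" "x \<in> SX M" "\<And>n. \<mu>s n \<in> PY" "\<mu> \<in> PY"
      "\<And>n. ws n \<in> W" "w \<in> W"
    and lim: "xs \<longlonglongrightarrow> x" "wconv \<mu>s \<mu>" "ws \<longlonglongrightarrow> w" "rs \<longlonglongrightarrow> r"
    and as: "\<And>n. as n \<in> admX M (xs n) \<inter> F" "\<And>n. bellman u (xs n) (\<mu>s n) (ws n) (as n) \<le> rs n"
  shows "\<exists>a\<in>admX M x \<inter> F. bellman u x \<mu> w a \<le> r"
proof -
  obtain a s where a: "a \<in> admX M x" and s: "strict_mono s" and lim_a: "(\<lambda>n. as (s n)) \<longlonglongrightarrow> a"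
    using admX_usc[of xs as x] dom(1,2) lim(1) as(1) by blast
  have "a \<in> F"
    by (rule closed_sequentially[OF F _ lim_a]) (use as(1) in blast)
  moreover have "bellman u x \<mu> w a \<le> r"
  proof (rule bellman_lsc[OF u])
    show "(xs (s n), as (s n)) \<in> adm M" for n using as(1) by (auto simp: admX_def)
    show "(x, a) \<in> adm M" using a by (simp add: admX_def)
    show "(\<lambda>n. xs (s n)) \<longlonglongrightarrow> x" "(\<lambda>n. ws (s n)) \<longlonglongrightarrow> w" "(\<lambda>n. rs (s n)) \<longlonglongrightarrow> r"
      using LIMSEQ_subseq_LIMSEQ[OF lim(1) s] LIMSEQ_subseq_LIMSEQ[OF lim(3) s] LIMSEQ_subseq_LIMSEQ[OF lim(4) s]
      by (simp_all add: comp_def)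
    show "wconv (\<lambda>n. \<mu>s (s n)) \<mu>" using wconv_subseq[OF lim(2) s] by (simp add: comp_def)
  qed (use dom lim_a as(2) in auto)
  ultimately show ?thesis using a by blast
qed

lemma wconv_const: "wconv (\<lambda>_. \<mu>) \<mu>"
  by (simp add: wconv_def)

text \<open>The limit argument is applied at a constant state to a minimizing sequence of actions,
  whose levels tend to the infimum.\<close>

lemma bellman_attains:
  assumes u: "seq_lsc u" "bdd_by B u" and dom: "x \<in> SX M" "\<mu> \<in> PY" "w \<in> W"
  shows "\<exists>a\<in>admX M x. bellman u x \<mu> w a = (INF a\<in>admX M x. bellman u x \<mu> w a)"
    and "bdd_below (bellman u x \<mu> w ` admX M x)"
proof -
  let ?I = "INF a\<in>admX M x. bellman u x \<mu> w a"
  show bdd: "bdd_below (bellman u x \<mu> w ` admX M x)"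
  proof (rule bdd_belowI2)
    show "- (\<bar>B\<bar> * exp (\<bar>\<gamma>\<bar> * c_max)) \<le> bellman u x \<mu> w a" if "a \<in> admX M x" for a
      using bellman_bound[OF u dom(2,3), of x a] that by (simp add: admX_def abs_le_iff)
  qed
  have "\<exists>a\<in>admX M x. bellman u x \<mu> w a < ?I + inverse (real (Suc n))" for n
    using cInf_lessD[of "bellman u x \<mu> w ` admX M x" "?I + inverse (real (Suc n))"] admX_nonempty[OF dom(1)] by auto
  then obtain as where as: "\<And>n. as n \<in> admX M x" "\<And>n. bellman u x \<mu> w (as n) < ?I + inverse (real (Suc n))"
    by metis
  have "(\<lambda>n. ?I + inverse (real (Suc n))) \<longlonglongrightarrow> ?I + 0"
    by (intro tendsto_intros LIMSEQ_inverse_real_of_nat)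
  then have "\<exists>a\<in>admX M x \<inter> UNIV. bellman u x \<mu> w a \<le> ?I"
    using as by (intro bellman_limit_action[OF u closed_UNIV, where xs="\<lambda>_. x" and \<mu>s="\<lambda>_. \<mu>" and ws="\<lambda>_. w" and as=as])
      (auto simp: dom wconv_const less_imp_le)
  then obtain a where "a \<in> admX M x" "bellman u x \<mu> w a \<le> ?I" by auto
  moreover from this have "?I \<le> bellman u x \<mu> w a" using bdd by (intro cINF_lower)
  ultimately show "\<exists>a\<in>admX M x. bellman u x \<mu> w a = ?I" by force
qed

text \<open>Attainment carries lower semicontinuity through the infimum: optimal actions along the
  sequence accumulate at an action that is admissible in the limit and respects the same level. Each
  stage enlarges the bound by at most the factor
  \<open>exp (\<bar>\<gamma>\<bar> * c_max)\<close>.\<close>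

lemma V_good: "seq_lsc (V n)" "\<exists>B. bdd_by B (V n)"
proof (induction n)
  case 0
  show "seq_lsc (V 0)" by (auto simp: seq_lsc_def)
  show "\<exists>B. bdd_by B (V 0)" by (auto simp: bdd_by_def)
next
  case (Suc n)
  from Suc obtain B where lsc: "seq_lsc (V n)" and B: "bdd_by B (V n)" by blast
  note att = bellman_attains[OF lsc B]
  show "seq_lsc (V (Suc n))"
    unfolding seq_lsc_def
  proof (intro allI impI, elim conjE)
    fix xs x \<mu>s \<mu> ws w r
    assume H: "\<forall>k. xs k \<in> SX M \<and> \<mu>s k \<in> PY \<and> ws k \<in> W \<and> V (Suc n) (xs k) (\<mu>s k) (ws k) \<le> r"
      and dom: "x \<in> SX M" "\<mu> \<in> PY" "w \<in> W" and lim: "xs \<longlonglongrightarrow> x" "wconv \<mu>s \<mu>" "ws \<longlonglongrightarrow> w"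
    have "\<exists>a\<in>admX M (xs k). bellman (V n) (xs k) (\<mu>s k) (ws k) a \<le> r" for k
    proof -
      have Hk: "xs k \<in> SX M" "\<mu>s k \<in> PY" "ws k \<in> W" "V (Suc n) (xs k) (\<mu>s k) (ws k) \<le> r"
        using H by auto
      obtain a where "a \<in> admX M (xs k)" "bellman (V n) (xs k) (\<mu>s k) (ws k) a = V (Suc n) (xs k) (\<mu>s k) (ws k)"
        using att(1)[OF Hk(1-3)] by auto
      then show ?thesis using Hk(4) by (intro bexI[of _ a]) simp_all
    qed
    then obtain as where "\<And>k. as k \<in> admX M (xs k)" "\<And>k. bellman (V n) (xs k) (\<mu>s k) (ws k) (as k) \<le> r" by metis
    then have "\<exists>a\<in>admX M x \<inter> UNIV. bellman (V n) x \<mu> w a \<le> r"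
      using H dom lim by (intro bellman_limit_action[OF lsc B closed_UNIV, where xs=xs and \<mu>s=\<mu>s and ws=ws and rs="\<lambda>_. r" and as=as]) auto
    then obtain a where "a \<in> admX M x" "bellman (V n) x \<mu> w a \<le> r" by blast
    then show "V (Suc n) x \<mu> w \<le> r"
      using cINF_lower[OF att(2)[OF dom]] by (auto intro: order_trans)
  qed
  have "bdd_by (\<bar>B\<bar> * exp (\<bar>\<gamma>\<bar> * c_max)) (V (Suc n))"
    unfolding bdd_by_def
  proof (intro ballI)
    fix x \<mu> w assume dom: "x \<in> SX M" "\<mu> \<in> PY" "w \<in> W"
    obtain a where a: "a \<in> admX M x" "bellman (V n) x \<mu> w a = V (Suc n) x \<mu> w"
      using att(1)[OF dom] by auto
    then show "\<bar>V (Suc n) x \<mu> w\<bar> \<le> \<bar>B\<bar> * exp (\<bar>\<gamma>\<bar> * c_max)"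
      using bellman_bound[OF lsc B dom(2,3), of x a] by (simp add: admX_def)
  qed
  then show "\<exists>B. bdd_by B (V (Suc n))" by blast
qed

lemma V_le_bellman:
  assumes "x \<in> SX M" "\<mu> \<in> PY" "w \<in> W" "(x, a) \<in> adm M"
  shows "V (Suc n) x \<mu> w \<le> bellman (V n) x \<mu> w a"
proof -
  obtain B where "bdd_by B (V n)" using V_good by blast
  from bellman_attains(2)[OF V_good(1) this assms(1-3)] show ?thesis
    using assms(4) by (auto intro!: cINF_lower simp: admX_def)
qed

definition V_minimizer :: "nat \<Rightarrow> ('x \<times> 'y measure \<times> real \<Rightarrow> 'a) \<Rightarrow> bool" where
  "V_minimizer n f \<longleftrightarrow> f \<in> PM \<rightarrow>\<^sub>M AM \<and> (\<forall>x\<in>SX M. \<forall>\<mu>\<in>PY. \<forall>w\<in>W.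
     f (x, \<mu>, w) \<in> admX M x \<and> bellman (V n) x \<mu> w (f (x, \<mu>, w)) = V (Suc n) x \<mu> w)"

text \<open>The sets \<open>D p\<close> of optimal actions are compact because admissible actions
  accumulate in the admissible set and \<open>bellman_lsc\<close> keeps the limit optimal. What
  remains is to measure the set of \<open>p\<close> for which \<open>D p\<close> meets a closed
  set.\<close>

theorem exists_V_minimizer: "\<exists>f. V_minimizer n f"
proof -
  obtain B where B: "bdd_by B (V n)" using V_good by blast
  note u = V_good(1)[of n] B
  define D where "D = (\<lambda>(x, \<mu>, w). {a \<in> admX M x. bellman (V n) x \<mu> w a \<le> V (Suc n) x \<mu> w})"
  have "\<exists>f \<in> PM \<rightarrow>\<^sub>M borel. \<forall>p\<in>space PM. f p \<in> D p"
  proof (rule measurable_selection_compact)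
    fix p assume "p \<in> space PM"
    then obtain x \<mu> w where p: "p = (x, \<mu>, w)" and dom: "x \<in> SX M" "\<mu> \<in> PY" "w \<in> W"
      by (auto simp: space_PM)
    show "D p \<noteq> {}"
      using bellman_attains(1)[OF u dom] by (auto simp: D_def p)
    show "compact (D p)"
      unfolding compact_eq_seq_compact_metric seq_compact_def
    proof (intro allI impI)
      fix as :: "nat \<Rightarrow> 'a" assume as: "\<forall>k. as k \<in> D p"
      then have as_adm: "\<And>k. as k \<in> admX M x" by (auto simp: D_def p)
      obtain a s where a: "a \<in> admX M x" and s: "strict_mono s" and lim: "(\<lambda>n. as (s n)) \<longlonglongrightarrow> a"
        using admX_usc[of "\<lambda>_. x" as x] dom(1) as_adm by auto
      have "bellman (V n) x \<mu> w a \<le> V (Suc n) x \<mu> w"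
        by (rule bellman_lsc[OF u _ _ _ _ _ _ _ lim, where xs="\<lambda>_. x" and \<mu>s="\<lambda>_. \<mu>" and ws="\<lambda>_. w" and rs="\<lambda>_. V (Suc n) x \<mu> w"])
           (use as as_adm a dom in \<open>auto simp: D_def p admX_iff wconv_const simp del: V.simps\<close>)
      then show "\<exists>l\<in>D p. \<exists>r. strict_mono r \<and> (as \<circ> r) \<longlonglongrightarrow> l"
        using a s lim by (auto simp: D_def p comp_def simp del: V.simps intro!: bexI[of _ a] exI[of _ s])
    qed
  next
    fix F :: "'a set" assume F: "closed F"
    define S where "S t = {(x, \<mu>, w). x \<in> SX M \<and> \<mu> \<in> PY \<and> w \<in> W \<and>
      (\<exists>a\<in>admX M x \<inter> F. bellman (V n) x \<mu> w a \<le> t)}" for t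
    have S: "S t \<in> sets PM" for t
    proof (rule sets_seq_closed)
      show "S t \<subseteq> SX M \<times> PY \<times> W" by (auto simp: S_def)
      fix xs x \<mu>s \<mu> ws w
      assume H: "\<And>k. (xs k, \<mu>s k, ws k) \<in> S t"
        and dom: "x \<in> SX M" "\<mu> \<in> PY" "w \<in> W" and lim: "xs \<longlonglongrightarrow> x" "wconv \<mu>s \<mu>" "ws \<longlonglongrightarrow> w"
      have dom': "xs k \<in> SX M" "\<mu>s k \<in> PY" "ws k \<in> W" for k using H[of k] by (auto simp: S_def)
      have "\<exists>a\<in>admX M (xs k) \<inter> F. bellman (V n) (xs k) (\<mu>s k) (ws k) a \<le> t" for k using H[of k] by (auto simp: S_def)
      then obtain as where "\<And>k. as k \<in> admX M (xs k) \<inter> F" "\<And>k. bellman (V n) (xs k) (\<mu>s k) (ws k) (as k) \<le> t" by metis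
      then have "\<exists>a\<in>admX M x \<inter> F. bellman (V n) x \<mu> w a \<le> t"
        using dom dom' lim by (intro bellman_limit_action[OF u F, where xs=xs and \<mu>s=\<mu>s and ws=ws and rs="\<lambda>_. t" and as=as]) auto
      then show "(x, \<mu>, w) \<in> S t" using dom by (simp add: S_def)
    qed
    have [measurable]: "(\<lambda>(x, \<mu>, w). V (Suc n) x \<mu> w) \<in> borel_measurable PM"
      by (rule measurable_seq_lsc[OF V_good(1)])
    define Z where "Z t = {p \<in> space PM. t \<le> (case p of (x, \<mu>, w) \<Rightarrow> V (Suc n) x \<mu> w)}" for t
    have Z: "Z t \<in> sets PM" for t unfolding Z_def by measurable
    \<comment> \<open>The optimal level varies with \<open>p\<close> and is only lower
      semicontinuous, so it is replaced by fixed rational levels: above the optimal value, every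
      level must be reached by an action in \<open>F\<close>. Conversely, actions for rational
      levels decreasing to the optimal value have an optimal limit in \<open>F\<close>.\<close>
    have "{p \<in> space PM. D p \<inter> F \<noteq> {}} = (\<Inter>t::rat. Z (real_of_rat t) \<union> S (real_of_rat t))"
    proof (intro equalityI subsetI)
      fix p assume "p \<in> {p \<in> space PM. D p \<inter> F \<noteq> {}}"
      then show "p \<in> (\<Inter>t::rat. Z (real_of_rat t) \<union> S (real_of_rat t))"
        by (force simp: space_PM Z_def S_def D_def not_le simp del: V.simps)
    next
      fix p assume p: "p \<in> (\<Inter>t::rat. Z (real_of_rat t) \<union> S (real_of_rat t))"
      then have "p \<in> space PM" by (auto simp: Z_def S_def space_PM)
      then obtain x \<mu> w where pe: "p = (x, \<mu>, w)" and dom: "x \<in> SX M" "\<mu> \<in> PY" "w \<in> W"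
        by (auto simp: space_PM)
      let ?v = "V (Suc n) x \<mu> w"
      have "\<forall>k. \<exists>t. ?v < real_of_rat t \<and> real_of_rat t < ?v + inverse (real (Suc k))"
        by (intro allI of_rat_dense) simp
      from choice[OF this] obtain t
        where t: "\<And>k. ?v < real_of_rat (t k)" "\<And>k. real_of_rat (t k) < ?v + inverse (real (Suc k))" by blast
      have "p \<in> S (real_of_rat (t k))" for k
      proof -
        have "p \<notin> Z (real_of_rat (t k))" using t(1)[of k] by (simp add: Z_def pe not_le del: V.simps)
        then show ?thesis using INT_D[OF p UNIV_I, of "t k"] by simp
      qed
      then have "\<forall>k. \<exists>a. a \<in> admX M x \<inter> F \<and> bellman (V n) x \<mu> w a \<le> real_of_rat (t k)"
        unfolding S_def pe by blast
      from choice[OF this] obtain as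
        where as: "\<And>k. as k \<in> admX M x \<inter> F" "\<And>k. bellman (V n) x \<mu> w (as k) \<le> real_of_rat (t k)" by blast
      have up: "(\<lambda>k. ?v + inverse (real (Suc k))) \<longlonglongrightarrow> ?v"
        using LIMSEQ_inverse_real_of_nat_add[of ?v] .
      have lim_t: "(\<lambda>k. real_of_rat (t k)) \<longlonglongrightarrow> ?v"
        by (rule tendsto_sandwich[OF _ _ tendsto_const up])
           (rule always_eventually, rule allI, rule less_imp_le, rule t)+
      have "\<exists>a\<in>admX M x \<inter> F. bellman (V n) x \<mu> w a \<le> ?v"
        by (rule bellman_limit_action[OF u F dom(1) dom(1) dom(2) dom(2) dom(3) dom(3) tendsto_const wconv_const tendsto_const lim_t as])
      then show "p \<in> {p \<in> space PM. D p \<inter> F \<noteq> {}}"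
        using \<open>p \<in> space PM\<close> by (auto simp: D_def pe simp del: V.simps)
    qed
    also have "\<dots> \<in> sets PM"
      using S Z by (intro sets.countable_INT') auto
    finally show "{p \<in> space PM. D p \<inter> F \<noteq> {}} \<in> sets PM" .
  qed
  then obtain f where f: "f \<in> PM \<rightarrow>\<^sub>M borel" "\<And>p. p \<in> space PM \<Longrightarrow> f p \<in> D p" by blast
  have fD: "f (x, \<mu>, w) \<in> admX M x \<and> bellman (V n) x \<mu> w (f (x, \<mu>, w)) = V (Suc n) x \<mu> w"
    if dom: "x \<in> SX M" "\<mu> \<in> PY" "w \<in> W" for x \<mu> w
  proof -
    have "f (x, \<mu>, w) \<in> D (x, \<mu>, w)" using f(2)[of "(x, \<mu>, w)"] dom by (simp add: space_PM)
    then show ?thesis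
      using V_le_bellman[OF dom, of "f (x, \<mu>, w)" n] by (auto simp: D_def admX_iff simp del: V.simps)
  qed
  have "f \<in> PM \<rightarrow>\<^sub>M AM"
    by (rule measurable_restrict_space2[OF _ f(1)]) (use fD adm_subset in \<open>auto simp: space_PM admX_iff\<close>)
  then show ?thesis using fD unfolding V_minimizer_def by blast
qed

section \<open>The value of a policy along the posteriors\<close>

primrec posterior :: "'y measure \<Rightarrow> real \<Rightarrow> nat \<Rightarrow> (nat \<Rightarrow> 'x) \<times> (nat \<Rightarrow> 'a) \<Rightarrow> 'y measure" where
  "posterior \<mu>0 w0 0 h = \<mu>0"
| "posterior \<mu>0 w0 (Suc n) h = Psi_e M (fst h n) (snd h n) (fst h (Suc n)) (posterior \<mu>0 w0 n h) (w0 * \<beta> ^ n)"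

lemma posterior_eq_mu_e: "posterior (init M) w0 n h = mu_e M w0 n h"
  by (induction n) auto

lemma posterior_cong:
  "(\<And>i. i \<le> n \<Longrightarrow> fst h i = fst h' i) \<Longrightarrow> (\<And>i. i < n \<Longrightarrow> snd h i = snd h' i) \<Longrightarrow> posterior \<mu>0 w0 n h = posterior \<mu>0 w0 n h'"
  by (induction n) auto

lemma posterior_snoc: "posterior \<mu>0 w0 (Suc k) (snoc k h a x') = Psi_e M (fst h k) a x' (posterior \<mu>0 w0 k h) (w0 * \<beta> ^ k)"
proof -
  have "posterior \<mu>0 w0 k (snoc k h a x') = posterior \<mu>0 w0 k h"
    by (rule posterior_cong) (auto simp: snoc_def)
  then show ?thesis by (simp add: snoc_def)
qed

lemma measurable_posterior:
  assumes "\<mu>0 \<in> PY" "n \<le> m"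
  shows "posterior \<mu>0 w0 n \<in> hist M m \<rightarrow>\<^sub>M prob_algebra YM"
  using assms(2)
proof (induction n)
  case 0
  then show ?case using assms(1) by (simp add: space_prob_algebra_borel_on)
next
  case (Suc n)
  then have [measurable]: "posterior \<mu>0 w0 n \<in> hist M m \<rightarrow>\<^sub>M prob_algebra YM" by simp
  have x: "(\<lambda>h. fst h n) \<in> hist M m \<rightarrow>\<^sub>M borel" and x': "(\<lambda>h. fst h (Suc n)) \<in> hist M m \<rightarrow>\<^sub>M XM"
    and a: "(\<lambda>h. snd h n) \<in> hist M m \<rightarrow>\<^sub>M borel"
    using Suc.prems by (auto intro: measurable_borel_onD[OF measurable_hist_component]
        measurable_borel_onD[OF measurable_hist_action] measurable_hist_component)
  show ?case unfolding posterior.simps by (rule measurable_Psi_e[OF x a _ x']) auto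
qed

lemma posterior_prob: "\<mu>0 \<in> PY \<Longrightarrow> h \<in> space (hist M n) \<Longrightarrow> posterior \<mu>0 w0 n h \<in> PY"
  using measurable_space[OF measurable_posterior[of \<mu>0 n n w0], of h] by (simp add: space_prob_algebra_borel_on)

definition Icost :: "('x, 'a) policy \<Rightarrow> nat \<Rightarrow> nat \<Rightarrow> (nat \<Rightarrow> 'x) \<times> (nat \<Rightarrow> 'a) \<Rightarrow> 'y measure \<Rightarrow> real \<Rightarrow> ennreal" where
  "Icost \<pi> j k h \<mu> w = (\<integral>\<^sup>+y. Ecost \<pi> j k h y w \<partial>\<mu>)"

definition Jval :: "('x, 'a) policy \<Rightarrow> nat \<Rightarrow> nat \<Rightarrow> (nat \<Rightarrow> 'x) \<times> (nat \<Rightarrow> 'a) \<Rightarrow> 'y measure \<Rightarrow> real \<Rightarrow> real" where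
  "Jval \<pi> j k h \<mu> w = 1 / \<gamma> * enn2real (Icost \<pi> j k h \<mu> w)"

lemma measurable_Ecost_snoc:
  assumes \<pi>: "\<pi> \<in> policies M" and h: "h \<in> space (hist M k)" and a: "a \<in> SA M"
  shows "(\<lambda>p. Ecost \<pi> j (Suc k) (snoc k h a (fst p)) (snd p) w) \<in> borel_measurable XYM"
proof -
  have "(\<lambda>p. (snoc k h a (fst p), snd p)) \<in> XYM \<rightarrow>\<^sub>M hist M (Suc k) \<Otimes>\<^sub>M YM"
    using h a by (intro measurable_Pair measurable_snoc) (auto simp: space_restrict_space)
  from measurable_compose[OF this measurable_Ecost[OF \<pi>]] show ?thesis by simp
qed

lemma policy_SA: "\<pi> \<in> policies M \<Longrightarrow> h \<in> space (hist M k) \<Longrightarrow> \<pi> k h \<in> SA M"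
  using policy_adm adm_subset by blast

text \<open>The chosen action depends on the history alone, not on the hidden state, so
  \<open>filter_identity\<close> applies with the remaining cost as the test function of the next
  pair.\<close>

lemma Icost_Suc:
  assumes \<pi>: "\<pi> \<in> policies M" and h: "h \<in> space (hist M k)" and \<mu>: "\<mu> \<in> PY"
  shows "Icost \<pi> (Suc j) k h \<mu> w = (\<integral>\<^sup>+x'. Icost \<pi> j (Suc k) (snoc k h (\<pi> k h) x')
     (Psi_e M (fst h k) (\<pi> k h) x' \<mu> w) (\<beta> * w) \<partial>Qhat_X M (fst h k) \<mu> (\<pi> k h) w)"
  unfolding Icost_def Ecost.simps
  using filter_identity[OF policy_adm[OF \<pi> h] \<mu> measurable_Ecost_snoc[OF \<pi> h policy_SA[OF \<pi> h]]] by simp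

lemma measurable_Icost:
  assumes \<pi>: "\<pi> \<in> policies M" and h: "h \<in> space (hist M k)" and \<mu>: "\<mu> \<in> PY"
  shows "(\<lambda>x'. Icost \<pi> j (Suc k) (snoc k h (\<pi> k h) x') (Psi_e M (fst h k) (\<pi> k h) x' \<mu> w) (\<beta> * w)) \<in> borel_measurable XM"
  unfolding Icost_def
  using measurable_nn_integral_Psi_e[OF \<mu> measurable_Ecost_snoc[OF \<pi> h policy_SA[OF \<pi> h]]] by simp

lemma Icost_le:
  assumes \<pi>: "\<pi> \<in> policies M" and h: "h \<in> space (hist M k)" and \<mu>: "\<mu> \<in> PY"
  shows "Icost \<pi> j k h \<mu> w \<le> ennreal (exp (real j * \<bar>w\<bar> * c_max))"
proof -
  interpret prob_space \<mu> by (rule prob_space_prob_measures[OF \<mu>])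
  show ?thesis unfolding Icost_def
    by (rule nn_integral_le_const) (auto simp: space_prob_measures[OF \<mu>] intro!: AE_I2 Ecost_le[OF \<pi> h])
qed

text \<open>The uniform bound on \<open>Icost\<close> allows the recursion to be read in reals,
  where the factor \<open>1 / \<gamma>\<close> of either sign commutes with the integral.\<close>

lemma Jval_Suc:
  assumes \<pi>: "\<pi> \<in> policies M" and h: "h \<in> space (hist M k)" and \<mu>: "\<mu> \<in> PY"
  shows "Jval \<pi> (Suc j) k h \<mu> w = (\<integral>x'. Jval \<pi> j (Suc k) (snoc k h (\<pi> k h) x')
     (Psi_e M (fst h k) (\<pi> k h) x' \<mu> w) (\<beta> * w) \<partial>Qhat_X M (fst h k) \<mu> (\<pi> k h) w)" (is "_ = (\<integral>x'. ?J x' \<partial>?Q)")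
    and "integrable (Qhat_X M (fst h k) \<mu> (\<pi> k h) w) (\<lambda>x'. Jval \<pi> j (Suc k) (snoc k h (\<pi> k h) x')
     (Psi_e M (fst h k) (\<pi> k h) x' \<mu> w) (\<beta> * w))"
proof -
  let ?a = "\<pi> k h"
  let ?F = "\<lambda>x'. Icost \<pi> j (Suc k) (snoc k h ?a x') (Psi_e M (fst h k) ?a x' \<mu> w) (\<beta> * w)"
  interpret finite_measure ?Q by (rule finite_Qhat[OF policy_adm[OF \<pi> h] \<mu>])
  have Fm: "?F \<in> borel_measurable ?Q"
    using measurable_Icost[OF \<pi> h \<mu>] by (simp add: measurable_cong_sets[OF sets_Qhat refl])
  have le: "?F x' \<le> ennreal (exp (real j * \<bar>\<beta> * w\<bar> * c_max))" if "x' \<in> SX M" for x'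
    by (intro Icost_le[OF \<pi>] snoc_in_hist h policy_SA[OF \<pi> h] that Psi_e_prob[OF \<mu> that])
  have int: "integrable ?Q (\<lambda>x'. enn2real (?F x'))"
  proof (rule integrable_const_bound[where B="exp (real j * \<bar>\<beta> * w\<bar> * c_max)"])
    show "AE x' in ?Q. norm (enn2real (?F x')) \<le> exp (real j * \<bar>\<beta> * w\<bar> * c_max)"
      using le by (intro AE_I2) (simp add: space_Qhat enn2real_leI)
  qed (use Fm in measurable)
  then show "integrable ?Q ?J" unfolding Jval_def by simp
  have "Icost \<pi> (Suc j) k h \<mu> w = (\<integral>\<^sup>+x'. ennreal (enn2real (?F x')) \<partial>?Q)"
    unfolding Icost_Suc[OF \<pi> h \<mu>]
  proof (rule nn_integral_cong)
    fix x' assume "x' \<in> space ?Q"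
    then have "?F x' \<le> ennreal (exp (real j * \<bar>\<beta> * w\<bar> * c_max))" using le by (simp add: space_Qhat)
    then have "?F x' < top" by (rule le_less_trans) simp
    then show "?F x' = ennreal (enn2real (?F x'))" by simp
  qed
  then have "enn2real (Icost \<pi> (Suc j) k h \<mu> w) = (\<integral>x'. enn2real (?F x') \<partial>?Q)"
    using Fm by (simp add: integral_eq_nn_integral)
  then show "Jval \<pi> (Suc j) k h \<mu> w = (\<integral>x'. ?J x' \<partial>?Q)"
    unfolding Jval_def by simp
qed

lemma Jval_0: "\<mu> \<in> PY \<Longrightarrow> Jval \<pi> 0 k h \<mu> w = 1 / \<gamma>"
  using prob_space.emeasure_space_1[OF prob_space_prob_measures, of \<mu> "SY M"] by (simp add: Jval_def Icost_def)

text \<open>The belief \<open>\<mu>\<close> is arbitrary and need not be the posterior belonging to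
  \<open>h\<close>. The induction can therefore replace the pair by the extended history and the
  updated belief at each step.\<close>

theorem V_le_Jval:
  assumes \<pi>: "\<pi> \<in> policies M" and "h \<in> space (hist M k)" "\<mu> \<in> PY" "w \<in> W"
  shows "V j (fst h k) \<mu> w \<le> Jval \<pi> j k h \<mu> w"
  using assms(2-4)
proof (induction j arbitrary: k h \<mu> w)
  case 0
  then show ?case by (simp add: Jval_0)
next
  case (Suc j)
  note h = Suc.prems(1) and \<mu> = Suc.prems(2) and w = Suc.prems(3)
  obtain B where B: "bdd_by B (V j)" using V_good by blast
  have adm: "(fst h k, \<pi> k h) \<in> adm M" by (rule policy_adm[OF \<pi> h])
  have "V (Suc j) (fst h k) \<mu> w \<le> bellman (V j) (fst h k) \<mu> w (\<pi> k h)"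
    by (rule V_le_bellman[OF hist_component[OF h order_refl] \<mu> w adm])
  also have "\<dots> \<le> Jval \<pi> (Suc j) k h \<mu> w"
    unfolding bellman_def Jval_Suc(1)[OF \<pi> h \<mu>]
  proof (rule integral_mono[OF integrable_bellman[OF V_good(1) B \<mu> w adm] Jval_Suc(2)[OF \<pi> h \<mu>]])
    fix x' assume "x' \<in> space (Qhat_X M (fst h k) \<mu> (\<pi> k h) w)"
    then have x': "x' \<in> SX M" by (simp add: space_Qhat)
    show "V j x' (Psi_e M (fst h k) (\<pi> k h) x' \<mu> w) (\<beta> * w)
      \<le> Jval \<pi> j (Suc k) (snoc k h (\<pi> k h) x') (Psi_e M (fst h k) (\<pi> k h) x' \<mu> w) (\<beta> * w)"
      using Suc.IH[OF snoc_in_hist[OF h policy_SA[OF \<pi> h] x'] Psi_e_prob[OF \<mu> x'] W_disc[OF w]]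
      by (simp add: snoc_def)
  qed
  finally show ?case .
qed

text \<open>Here the belief must be the posterior of \<open>h\<close>, since only there is the
  action of the policy known to be optimal. With \<open>j\<close> stages left at stage
  \<open>k\<close>, the relation \<open>j + k = N\<close> makes \<open>V (N - Suc k)\<close> the
  continuation value.\<close>

theorem Jval_eq_V:
  assumes \<pi>: "\<pi> \<in> policies M" and \<mu>0: "\<mu>0 \<in> PY"
    and opt: "\<And>k h. k < N \<Longrightarrow> h \<in> space (hist M k) \<Longrightarrow>
      bellman (V (N - Suc k)) (fst h k) (posterior \<mu>0 w0 k h) (w0 * \<beta> ^ k) (\<pi> k h) = V (N - k) (fst h k) (posterior \<mu>0 w0 k h) (w0 * \<beta> ^ k)"
    and "j + k = N" "h \<in> space (hist M k)"
  shows "Jval \<pi> j k h (posterior \<mu>0 w0 k h) (w0 * \<beta> ^ k) = V j (fst h k) (posterior \<mu>0 w0 k h) (w0 * \<beta> ^ k)"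
  using assms(4,5)
proof (induction j arbitrary: k h)
  case 0
  then show ?case by (simp add: Jval_0 posterior_prob[OF \<mu>0])
next
  case (Suc j)
  note h = Suc.prems(2)
  have k: "k < N" "N - Suc k = j" "N - k = Suc j" using Suc.prems(1) by auto
  have \<mu>: "posterior \<mu>0 w0 k h \<in> PY" by (rule posterior_prob[OF \<mu>0 h])
  have "Jval \<pi> (Suc j) k h (posterior \<mu>0 w0 k h) (w0 * \<beta> ^ k) =
      bellman (V j) (fst h k) (posterior \<mu>0 w0 k h) (w0 * \<beta> ^ k) (\<pi> k h)"
    unfolding bellman_def Jval_Suc(1)[OF \<pi> h \<mu>]
  proof (rule Bochner_Integration.integral_cong[OF refl])
    fix x' assume "x' \<in> space (Qhat_X M (fst h k) (posterior \<mu>0 w0 k h) (\<pi> k h) (w0 * \<beta> ^ k))"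
    then have x': "x' \<in> SX M" by (simp add: space_Qhat)
    have "w0 * \<beta> ^ Suc k = \<beta> * (w0 * \<beta> ^ k)" by simp
    then show "Jval \<pi> j (Suc k) (snoc k h (\<pi> k h) x') (Psi_e M (fst h k) (\<pi> k h) x' (posterior \<mu>0 w0 k h) (w0 * \<beta> ^ k)) (\<beta> * (w0 * \<beta> ^ k)) =
      V j x' (Psi_e M (fst h k) (\<pi> k h) x' (posterior \<mu>0 w0 k h) (w0 * \<beta> ^ k)) (\<beta> * (w0 * \<beta> ^ k))"
      using Suc.IH[OF _ snoc_in_hist[OF h policy_SA[OF \<pi> h] x']] Suc.prems(1)
      unfolding posterior_snoc by (simp add: snoc_def mult.left_commute)
  qed
  then show ?case using opt[OF k(1) h] unfolding k(2,3) by simp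
qed

text \<open>Both nested integrals have nonnegative integrands with finite values, so they coincide
  with their counterparts in \<open>ennreal\<close>. This connects the expression in
  \<open>e_val\<close> and \<open>J_pol\<close> with the recursion for \<open>Ecost\<close>.\<close>

lemma policy_value:
  assumes \<pi>: "\<pi> \<in> policies M" and x: "x \<in> SX M" and \<mu>: "\<mu> \<in> PY"
  shows "1 / \<gamma> * (\<integral>y. (\<integral>\<omega>. exp (w * total_cost M \<pi> n \<omega>) \<partial>law M \<pi> x y) \<partial>\<mu>) = Jval \<pi> n 0 (hist0 x) \<mu> w"
proof -
  have inner: "(\<integral>\<omega>. exp (w * total_cost M \<pi> n \<omega>) \<partial>law M \<pi> x y) = enn2real (Ecost \<pi> n 0 (hist0 x) y w)"
    if y: "y \<in> SY M" for y
  proof -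
    interpret IT: Ionescu_Tulcea "step_kernel M \<pi> x y" SM by (rule Ionescu_Tulcea_step_kernel[OF \<pi> x y])
    have law: "law M \<pi> x y = IT.PF.lim" by (simp add: law_def Let_def)
    have "(\<lambda>\<omega>. exp (w * acc_cost \<pi> n \<omega>)) \<in> borel_measurable (PiM UNIV SM)"
      using measurable_acc_cost[OF \<pi>, of n UNIV] by simp
    then have "(\<lambda>\<omega>. exp (w * total_cost M \<pi> n \<omega>)) \<in> borel_measurable (PiM UNIV SM)"
      by (subst measurable_cong[where g="\<lambda>\<omega>. exp (w * acc_cost \<pi> n \<omega>)"]) (auto simp: total_cost_eq[OF \<pi>])
    then have "(\<lambda>\<omega>. exp (w * total_cost M \<pi> n \<omega>)) \<in> borel_measurable (law M \<pi> x y)"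
      unfolding law by (simp add: measurable_cong_sets[OF IT.PF.sets_lim refl])
    then show ?thesis
      by (simp add: integral_eq_nn_integral nn_integral_law[OF \<pi> x y])
  qed
  have h: "hist0 x \<in> space (hist M 0)" by (rule hist0_in_hist[OF x])
  have Em: "(\<lambda>y. Ecost \<pi> n 0 (hist0 x) y w) \<in> borel_measurable \<mu>"
    unfolding measurable_prob_measures[OF \<mu>]
    using measurable_compose[OF measurable_Pair1'[OF h] measurable_Ecost[OF \<pi>]] by simp
  have "(\<integral>y. (\<integral>\<omega>. exp (w * total_cost M \<pi> n \<omega>) \<partial>law M \<pi> x y) \<partial>\<mu>) = (\<integral>y. enn2real (Ecost \<pi> n 0 (hist0 x) y w) \<partial>\<mu>)"
    by (rule Bochner_Integration.integral_cong[OF refl]) (simp add: inner space_prob_measures[OF \<mu>])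
  also have "\<dots> = enn2real (\<integral>\<^sup>+y. ennreal (enn2real (Ecost \<pi> n 0 (hist0 x) y w)) \<partial>\<mu>)"
    using Em by (simp add: integral_eq_nn_integral)
  also have "(\<integral>\<^sup>+y. ennreal (enn2real (Ecost \<pi> n 0 (hist0 x) y w)) \<partial>\<mu>) = Icost \<pi> n 0 (hist0 x) \<mu> w"
    unfolding Icost_def
  proof (rule nn_integral_cong)
    fix y assume "y \<in> space \<mu>"
    then have "Ecost \<pi> n 0 (hist0 x) y w \<le> ennreal (exp (real n * \<bar>w\<bar> * c_max))"
      using Ecost_le[OF \<pi> h] by (simp add: space_prob_measures[OF \<mu>])
    then have "Ecost \<pi> n 0 (hist0 x) y w < top" by (rule le_less_trans) simp
    then show "ennreal (enn2real (Ecost \<pi> n 0 (hist0 x) y w)) = Ecost \<pi> n 0 (hist0 x) y w" by simp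
  qed
  finally show ?thesis by (simp add: Jval_def)
qed

text \<open>\<open>feedback\<close> generalises \<open>g_star\<close> to an arbitrary prior and parameter, so that it also
  attains \<open>\<^bold>e\<^sub>n\<close> at every \<open>(x, \<mu>, w)\<close>.\<close>

definition feedback :: "'y measure \<Rightarrow> real \<Rightarrow> nat \<Rightarrow> (nat \<Rightarrow> 'x \<times> 'y measure \<times> real \<Rightarrow> 'a) \<Rightarrow> ('x, 'a) policy \<Rightarrow> ('x, 'a) policy" where
  "feedback \<mu>0 w0 N f \<rho> n h = (if n < N then f (N - n) (fst h n, posterior \<mu>0 w0 n h, w0 * \<beta> ^ n) else \<rho> n h)"

text \<open>Posteriors stay in \<open>PY\<close> and the parameters \<open>w0 * \<beta> ^ n\<close>
  stay in \<open>W\<close>, which is the region where minimizers are known to be measurable and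
  admissible.\<close>

lemma feedback_policy:
  assumes f: "\<And>n. n \<in> {1..N} \<Longrightarrow> V_minimizer (n - 1) (f n)" and \<rho>: "\<rho> \<in> policies M"
    and \<mu>0: "\<mu>0 \<in> PY" and w0: "w0 \<in> W"
  shows "feedback \<mu>0 w0 N f \<rho> \<in> policies M"
  unfolding policies_def
proof (intro CollectI allI)
  fix n
  show "feedback \<mu>0 w0 N f \<rho> n \<in> hist M n \<rightarrow>\<^sub>M AM \<and> (\<forall>h\<in>space (hist M n). feedback \<mu>0 w0 N f \<rho> n h \<in> admX M (fst h n))"
  proof (cases "n < N")
    case True
    then have f': "V_minimizer (N - n - 1) (f (N - n))" using f[of "N - n"] by auto
    have "(\<lambda>h. f (N - n) (fst h n, posterior \<mu>0 w0 n h, w0 * \<beta> ^ n)) \<in> hist M n \<rightarrow>\<^sub>M AM"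
      using f' unfolding V_minimizer_def
      by (intro measurable_compose[OF measurable_to_PM] measurable_hist_component measurable_posterior[OF \<mu>0] W_disc_power[OF w0]) auto
    moreover have "f (N - n) (fst h n, posterior \<mu>0 w0 n h, w0 * \<beta> ^ n) \<in> admX M (fst h n)" if "h \<in> space (hist M n)" for h
      using f' hist_component[OF that] posterior_prob[OF \<mu>0 that] W_disc_power[OF w0] unfolding V_minimizer_def by blast
    ultimately show ?thesis using True by (simp add: feedback_def[abs_def])
  next
    case False
    then have "feedback \<mu>0 w0 N f \<rho> n = \<rho> n" by (simp add: feedback_def fun_eq_iff)
    then show ?thesis using \<rho> by (simp add: policies_def)
  qed
qed

lemma feedback_value:
  assumes f: "\<And>n. n \<in> {1..N} \<Longrightarrow> V_minimizer (n - 1) (f n)" and \<rho>: "\<rho> \<in> policies M"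
    and \<mu>0: "\<mu>0 \<in> PY" and w0: "w0 \<in> W" and x: "x \<in> SX M"
  shows "Jval (feedback \<mu>0 w0 N f \<rho>) N 0 (hist0 x) \<mu>0 w0 = V N x \<mu>0 w0"
proof -
  let ?\<pi> = "feedback \<mu>0 w0 N f \<rho>"
  have \<pi>: "?\<pi> \<in> policies M" by (rule feedback_policy[OF f \<rho> \<mu>0 w0])
  have "Jval ?\<pi> N 0 (hist0 x) (posterior \<mu>0 w0 0 (hist0 x)) (w0 * \<beta> ^ 0) = V N (fst (hist0 x) 0) (posterior \<mu>0 w0 0 (hist0 x)) (w0 * \<beta> ^ 0)"
  proof (rule Jval_eq_V[OF \<pi> \<mu>0])
    fix k h assume k: "k < N" and h: "h \<in> space (hist M k)"
    have f': "V_minimizer (N - Suc k) (f (N - k))" using f[of "N - k"] k by auto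
    have N: "N - k = Suc (N - Suc k)" using k by simp
    show "bellman (V (N - Suc k)) (fst h k) (posterior \<mu>0 w0 k h) (w0 * \<beta> ^ k) (?\<pi> k h) = V (N - k) (fst h k) (posterior \<mu>0 w0 k h) (w0 * \<beta> ^ k)"
      using f' hist_component[OF h] posterior_prob[OF \<mu>0 h] W_disc_power[OF w0] k
      unfolding V_minimizer_def feedback_def N[symmetric] by (simp del: V.simps)
  qed (use hist0_in_hist[OF x] in auto)
  then show ?thesis by (simp add: hist0_def)
qed

section \<open>Identification of the recursive values with the infima over policies\<close>

lemma policies_nonempty: "policies M \<noteq> {}"
proof -
  obtain d where d: "d \<in> XM \<rightarrow>\<^sub>M AM" "\<forall>x\<in>SX M. (x, d x) \<in> adm M" using exists_selector by blast
  have "(\<lambda>n h. d (fst h n)) \<in> policies M"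
    unfolding policies_def
    using d hist_component by (auto simp: admX_def intro!: measurable_compose[OF measurable_hist_component d(1)])
  then show ?thesis by blast
qed

lemma V_minimizers_exist: "\<exists>f. \<forall>n. V_minimizer (n - 1) (f n)"
  using exists_V_minimizer by (intro choice) blast

text \<open>\<open>V\<close> lies below the value of every policy, and the feedback policy started
  from this very \<open>\<mu>\<close> and \<open>w\<close> attains it, so the infimum is a minimum.
  The attaining policy may depend on the prior and the parameter, as the infimum is taken for each
  separately.\<close>

theorem e_val_eq_V:
  assumes x: "x \<in> SX M" and \<mu>: "\<mu> \<in> PY" and w: "w \<in> W"
  shows "e_val M \<gamma> n x \<mu> w = V n x \<mu> w"
proof -
  obtain f where f: "\<And>n. V_minimizer (n - 1) (f n)" using V_minimizers_exist by blast
  obtain \<rho> where \<rho>: "\<rho> \<in> policies M" using policies_nonempty by blast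
  have "e_val M \<gamma> n x \<mu> w = (INF \<pi>\<in>policies M. Jval \<pi> n 0 (hist0 x) \<mu> w)"
    unfolding e_val_def by (intro INF_cong refl policy_value x \<mu>)
  also have "\<dots> = V n x \<mu> w"
  proof (rule cInf_eq_minimum)
    show "V n x \<mu> w \<in> (\<lambda>\<pi>. Jval \<pi> n 0 (hist0 x) \<mu> w) ` policies M"
      using feedback_value[OF f \<rho> \<mu> w x, of n] feedback_policy[OF f \<rho> \<mu> w] by (metis image_eqI)
    fix v assume "v \<in> (\<lambda>\<pi>. Jval \<pi> n 0 (hist0 x) \<mu> w) ` policies M"
    then show "V n x \<mu> w \<le> v"
      using V_le_Jval[OF _ hist0_in_hist[OF x] \<mu> w, of _ n] by (auto simp: hist0_def)
  qed
  finally show ?thesis .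
qed

lemma e_step_eq_bellman:
  assumes "x \<in> SX M" "\<mu> \<in> PY" "w \<in> W"
  shows "e_step M \<gamma> n x \<mu> w a = bellman (V n) x \<mu> w a"
  unfolding e_step_def bellman_def
  by (rule Bochner_Integration.integral_cong[OF refl]) (simp add: space_Qhat e_val_eq_V Psi_e_prob W_disc assms)

text \<open>Since the values agree on the whole domain, optimality can be proved for arbitrary
  minimizers of the original problem and not only for those obtained by selection.\<close>

lemma minimizer_iff: "minimizer M \<gamma> n f \<longleftrightarrow> V_minimizer n f"
  unfolding minimizer_def V_minimizer_def by (auto simp: e_step_eq_bellman)

end

theorem theorem4p4:
  fixes M :: "('x::polish_space, 'y::polish_space, 'a::polish_space) pomdp"
    and U :: "real \<Rightarrow> real" and \<gamma> :: real and N :: nat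
  assumes "pomdp_model M" and "standing_assumptions M"
    and "N \<ge> 1" and "\<gamma> \<noteq> 0" and "\<And>t. U t = 1 / \<gamma> * exp (\<gamma> * t)"
  shows
    "(\<forall>x \<in> SX M. \<forall>\<mu> \<in> prob_measures (SY M). \<forall>z \<in> {0<..1}.
        e_val M \<gamma> 0 x \<mu> (\<gamma> * z) = 1 / \<gamma> \<and>
        (\<forall>n<N. e_val M \<gamma> (Suc n) x \<mu> (\<gamma> * z) =
           (INF a \<in> admX M x.
              \<integral>x'. e_val M \<gamma> n x' (Psi_e M x a x' \<mu> (\<gamma> * z)) (disc M * (\<gamma> * z))
                \<partial>Qhat_X M x \<mu> a (\<gamma> * z))))
   \<and> (\<forall>x \<in> SX M. J_val M U N x = e_val M \<gamma> N x (init M) \<gamma>)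
   \<and> (\<forall>n \<in> {1..N}. \<exists>f. minimizer M \<gamma> (n - 1) f)
   \<and> (\<forall>f. (\<forall>n \<in> {1..N}. minimizer M \<gamma> (n - 1) (f n)) \<longrightarrow>
        (\<forall>\<rho> \<in> policies M. optimal_policy M U N (g_star M \<gamma> N f \<rho>)))"
proof -
  interpret pomdp_exp M \<gamma> by unfold_locales (use assms in auto)
  have J_pol: "J_pol M U N \<pi> x = 1 / \<gamma> * (\<integral>y. (\<integral>\<omega>. exp (\<gamma> * total_cost M \<pi> N \<omega>) \<partial>law M \<pi> x y) \<partial>init M)" for \<pi> x
    unfolding J_pol_def assms(5) by simp
  have J_val: "J_val M U N x = e_val M \<gamma> N x (init M) \<gamma>" for x
    unfolding J_val_def e_val_def J_pol ..
  have rec: "e_val M \<gamma> 0 x \<mu> (\<gamma> * z) = 1 / \<gamma> \<and>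
      (\<forall>n<N. e_val M \<gamma> (Suc n) x \<mu> (\<gamma> * z) = (INF a \<in> admX M x.
        \<integral>x'. e_val M \<gamma> n x' (Psi_e M x a x' \<mu> (\<gamma> * z)) (disc M * (\<gamma> * z)) \<partial>Qhat_X M x \<mu> a (\<gamma> * z)))"
    if dom: "x \<in> SX M" "\<mu> \<in> prob_measures (SY M)" and z: "z \<in> {0<..1}" for x \<mu> z
  proof -
    have w: "\<gamma> * z \<in> W" using z by (auto simp: scaled_params_def)
    show ?thesis
      unfolding e_step_def[symmetric] e_step_eq_bellman[OF dom w] e_val_eq_V[OF dom w] by simp
  qed
  have opt: "optimal_policy M U N (g_star M \<gamma> N f \<rho>)"
    if f: "\<forall>n \<in> {1..N}. minimizer M \<gamma> (n - 1) (f n)" and \<rho>: "\<rho> \<in> policies M" for f \<rho>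
  proof -
    have f': "V_minimizer (n - 1) (f n)" if "n \<in> {1..N}" for n using f that by (simp add: minimizer_iff)
    have g: "g_star M \<gamma> N f \<rho> = feedback (init M) \<gamma> N f \<rho>"
      by (intro ext) (simp add: g_star_def feedback_def posterior_eq_mu_e)
    have pol: "g_star M \<gamma> N f \<rho> \<in> policies M"
      unfolding g by (rule feedback_policy[OF f' \<rho> init_prob W_\<gamma>])
    have "J_pol M U N (g_star M \<gamma> N f \<rho>) x = J_val M U N x" if x: "x \<in> SX M" for x
      unfolding J_val e_val_eq_V[OF x init_prob W_\<gamma>] J_pol policy_value[OF pol x init_prob]
      unfolding g by (rule feedback_value[OF f' \<rho> init_prob W_\<gamma> x])
    then show ?thesis using pol by (simp add: optimal_policy_def)
  qed
  have "\<exists>f. minimizer M \<gamma> (n - 1) f" for n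
    using V_minimizers_exist unfolding minimizer_iff by blast
  then show ?thesis using rec J_val opt by blast
qed

end
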